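(* Let $n\ge1$ and $1\le J\le n$. With the tensor product quasi-interpolation operators $\pi_{\otimes n}^{k,l}$, the BGG operators $\mathscr D^k$ and the spaces $H(\mathscr D^k)$ defined in the context, set $l_k=J-1$ for $k\le J-1$ and $l_k=J$ for $k\ge J$. Then the operators $\pi_{\otimes n}$ commute with $\mathscr D$: for every $0\le k\le n-1$, $$\pi_{\otimes n}^{k+1,l_{k+1}}\,\mathscr D^k u=\mathscr D^k\,\pi_{\otimes n}^{k,l_k}u\qquad\text{for all }u\in H(\mathscr D^k).$$
   Context: **Algebra.** $\mathrm{Alt}^k=\mathrm{Alt}^k\mathbb R^n$ is the space of alternating $k$-linear forms on $\mathbb R^n$ ($0$ if $k<0$ or $k>n$), and $\mathrm{Alt}^{k,l}=\mathrm{Alt}^k\otimes\mathrm{Alt}^l$. For $\sigma=\{\sigma_1<\dots<\sigma_k\}\subset\{1,\dots,n\}$ let $dx^\sigma=dx^{\sigma_1}\wedge\cdots\wedge dx^{\sigma_k}$, and let $\chi_m(\sigma)=1$ if $m\in\sigma$ and $0$ otherwise. $\mathrm{Alt}^{k,l}$ carries the inner product in which the forms $dx^\sigma\otimes dx^\tau$ ($|\sigma|=k$, $|\tau|=l$) are orthonormal. The linear map $s^{k,l}:\mathrm{Alt}^{k,l}\to\mathrm{Alt}^{k+1,l-1}$ is $$s^{k,l}\mu(v_0,\dots,v_k)(w_1,\dots,w_{l-1})=\sum_{i=0}^{k}(-1)^i\mu(v_0,\dots,\widehat{v_i},\dots,v_k)(v_i,w_1,\dots,w_{l-1}),$$ with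 $s^{-1,l}=0$. The map $s^{J-1,J}$ is bijective. **BGG operators.** On $\mathrm{Alt}^{k,l}$-valued distributions on the interior of $\mathcal I^n=[0,1]^n$, $d^k(f\,dx^\sigma\otimes dx^\tau)=\sum_m\partial_m f\,(dx^m\wedge dx^\sigma)\otimes dx^\tau$. Put $$\mathscr D^k=\begin{cases}(I\otimes P_{\mathcal R(s^{k,J})^\perp})\,d^k, & k<J-1,\\ d^{J-1}\,(I\otimes s^{J-1,J})^{-1}\,d^{J-1}, & k=J-1,\\ d^k,& k\ge J,\end{cases}$$ where $P_{\mathcal R(s^{k,J})^\perp}$ is the orthogonal projection of $\mathrm{Alt}^{k+1,J-1}$ onto the orthogonal complement of the range of $s^{k,J}$; thus $\mathscr D^k$ acts on $\mathrm{Alt}^{k,l_k}$-valued distributions. Let $\mathbb E^k=\mathcal R(s^{k-1,J})^\perp\subset\mathrm{Alt}^{k,J-1}$ for $k\le J-1$ and $\mathbb E^k=\ker(s^{k,J})\subset\mathrm{Alt}^{k,J}$ for $k\ge J$, and $$H(\mathscr D^k)=\{u\in L^2(\mathcal I^n)\otimes\mathbb E^k:\ \mathscr D^ku\in L^2(\mathcal I^n)\otimes\mathbb E^{k+1}\}.$$ **One-dimensional data.** Let $\mathcal I=[0,1]$. For each direction $m=1,\dots,n$ there are given finite-dimensional subspaces $\mathcal S^{(m)}_a\subset L^2(\mathcal I)$, $a=0,1,2$ (in the paper $\mathcal S^{(m)}_a=\mathcal S^{p_m-a}_{\mathbf r_m-a}$), such that for $a=0,1$ the weak derivative is defined on $\mathcal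 S_a^{(m)}$ and maps it onto $\mathcal S_{a+1}^{(m)}$. There are also given $L^2$-bounded linear operators $\tilde\pi_m^{i,j}:L^2(\mathcal I)\to\mathcal S^{(m)}_{i+j}$, $i,j\in\{0,1\}$ (the action on coefficients of the 1D quasi-interpolation operators $\pi^{i,j}$ of $(i,j)$-forms), with $$(\tilde\pi_m^{0,j}u)'=\tilde\pi_m^{1,j}u'\quad (u\in H^1(\mathcal I),\ j=0,1),\qquad \tilde\pi_m^{0,1}=\tilde\pi_m^{1,0}.$$ **Tensor product operators.** $\pi_{\otimes n}^{k,l}$ is the bounded linear operator on $L^2(\mathcal I^n)\otimes\mathrm{Alt}^{k,l}$ given by $$\pi_{\otimes n}^{k,l}(f\,dx^\sigma\otimes dx^\tau)=\Bigl(\bigl(\tilde\pi_1^{\chi_1(\sigma),\chi_1(\tau)}\otimes\cdots\otimes\tilde\pi_n^{\chi_n(\sigma),\chi_n(\tau)}\bigr)f\Bigr)\,dx^\sigma\otimes dx^\tau ,$$ where the tensor product of operators is the bounded operator on $L^2(\mathcal I^n)$ determined by $f_1\otimes\cdots\otimes f_n\mapsto \tilde\pi_1f_1\otimes\cdots\otimes\tilde\pi_nf_n$. It takes values in $\bigoplus_{\sigma,\tau}\bigl(\bigotimes_m\mathcal S^{(m)}_{\chi_m(\sigma)+\chi_m(\tau)}\bigr)dx^\sigma\otimes dx^\tau$. *)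

theory Defs
  imports "HOL-Analysis.Analysis"
begin

section \<open>Square-integrable functions on the unit cube\<close>

text \<open>The development is for an arbitrary Euclidean space, so that it covers both
  \<open>\<I> = [0,1]\<close> (type \<open>real\<close>, only basis vector \<open>1\<close>) and \<open>\<I>\<^sup>n\<close> (type \<open>real ^ 'n\<close>, basis vectors
  \<open>axis m 1\<close>).  Elements of \<open>L\<^sup>2\<close> are represented by Borel measurable functions, whose values
  outside the cube are irrelevant; equality in \<open>L\<^sup>2\<close> is equality almost everywhere on the cube.\<close>

definition cube_measure :: "'a::euclidean_space measure" where
  "cube_measure = restrict_space lborel (cbox 0 One)"

definition L2 :: "('a::euclidean_space \<Rightarrow> real) set" where
  "L2 = {f \<in> borel_measurable cube_measure. integrable cube_measure (\<lambda>x. (f x)\<^sup>2)}"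

definition L2_norm :: "('a::euclidean_space \<Rightarrow> real) \<Rightarrow> real" where
  "L2_norm f = sqrt (\<integral>x. (f x)\<^sup>2 \<partial>cube_measure)"

definition L2_eq :: "('a::euclidean_space \<Rightarrow> real) \<Rightarrow> ('a \<Rightarrow> real) \<Rightarrow> bool" where
  "L2_eq f g \<longleftrightarrow> (AE x in cube_measure. f x = g x)"

text \<open>Compatibility with equality almost everywhere is a consequence of linearity and
  boundedness.\<close>

definition bounded_L2_op ::
  "(('a::euclidean_space \<Rightarrow> real) \<Rightarrow> ('a \<Rightarrow> real)) \<Rightarrow> bool" where
  "bounded_L2_op T \<longleftrightarrow>
     (\<forall>f\<in>L2. T f \<in> L2) \<and>
     (\<forall>f\<in>L2. \<forall>g\<in>L2. L2_eq (T (\<lambda>x. f x + g x)) (\<lambda>x. T f x + T g x)) \<and>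
     (\<forall>f\<in>L2. \<forall>c. L2_eq (T (\<lambda>x. c * f x)) (\<lambda>x. c * T f x)) \<and>
     (\<exists>C. \<forall>f\<in>L2. L2_norm (T f) \<le> C * L2_norm f)"

definition fin_dim_L2_subspace :: "('a::euclidean_space \<Rightarrow> real) set \<Rightarrow> bool" where
  "fin_dim_L2_subspace V \<longleftrightarrow>
     (\<exists>B. finite B \<and> B \<subseteq> L2 \<and>
          V = {f \<in> L2. \<exists>c. L2_eq f (\<lambda>x. \<Sum>b\<in>B. c b * b x)})"


section \<open>Test functions and weak derivatives\<close>

definition partial :: "'a::euclidean_space \<Rightarrow> ('a \<Rightarrow> real) \<Rightarrow> 'a \<Rightarrow> real" where
  "partial b \<phi> x = frechet_derivative \<phi> (at x) b"

definition smooth_fun :: "('a::euclidean_space \<Rightarrow> real) \<Rightarrow> bool" where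
  "smooth_fun \<phi> \<longleftrightarrow> (\<forall>bs\<in>lists Basis. \<forall>x. foldr partial bs \<phi> differentiable (at x))"

definition test_funs :: "('a::euclidean_space \<Rightarrow> real) set" where
  "test_funs = {\<phi>. smooth_fun \<phi> \<and> closure {x. \<phi> x \<noteq> 0} \<subseteq> box 0 One}"

definition weak_deriv :: "(real \<Rightarrow> real) \<Rightarrow> (real \<Rightarrow> real) \<Rightarrow> bool" where
  "weak_deriv f g \<longleftrightarrow>
     (\<forall>\<phi>\<in>test_funs. (\<integral>x. f x * partial 1 \<phi> x \<partial>cube_measure) =
                   - (\<integral>x. g x * \<phi> x \<partial>cube_measure))"


section \<open>Alternating forms\<close>

text \<open>A \<open>k\<close>-linear form is a function on lists of vectors which vanishes on lists whose length is
  not \<open>k\<close>.  The tensor product of \<open>Alt\<^sup>k\<close> and \<open>Alt\<^sup>l\<close> is identified with the functions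
  \<open>\<mu> [v\<^sub>1,\<dots>,v\<^sub>k] [w\<^sub>1,\<dots>,w\<^sub>l]\<close> that are alternating and multilinear in each group of arguments.\<close>

type_synonym 'n form = "(real ^ 'n) list \<Rightarrow> real"
type_synonym 'n form2 = "(real ^ 'n) list \<Rightarrow> (real ^ 'n) list \<Rightarrow> real"

definition alternating_form :: "nat \<Rightarrow> ('n::finite) form \<Rightarrow> bool" where
  "alternating_form k \<omega> \<longleftrightarrow>
     (\<forall>vs. length vs \<noteq> k \<longrightarrow> \<omega> vs = 0) \<and>
     (\<forall>vs i. length vs = k \<longrightarrow> i < k \<longrightarrow> linear (\<lambda>v. \<omega> (vs[i := v]))) \<and>
     (\<forall>vs i j. length vs = k \<longrightarrow> i < j \<longrightarrow> j < k \<longrightarrow> vs ! i = vs ! j \<longrightarrow> \<omega> vs = 0)"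

definition Alt :: "nat \<Rightarrow> nat \<Rightarrow> ('n::finite) form2 set" where
  "Alt k l = {\<mu>. (\<forall>ws. alternating_form k (\<lambda>vs. \<mu> vs ws)) \<and> (\<forall>vs. alternating_form l (\<mu> vs))}"

definition remove_nth :: "nat \<Rightarrow> 'a list \<Rightarrow> 'a list" where
  "remove_nth i xs = take i xs @ drop (Suc i) xs"

definition wedge1 :: "'n \<Rightarrow> ('n::finite) form \<Rightarrow> 'n form" where
  \<comment> \<open>\<open>dx\<^sup>m \<and> \<omega>\<close>\<close>
  "wedge1 m \<omega> vs = (\<Sum>i<length vs. (-1) ^ i * (vs ! i $ m) * \<omega> (remove_nth i vs))"

definition dx :: "'n set \<Rightarrow> ('n::{finite,linorder}) form" where
  "dx \<sigma> = foldr wedge1 (sorted_list_of_set \<sigma>) (\<lambda>vs. if vs = [] then 1 else 0)"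

definition basis_list :: "'n set \<Rightarrow> (real ^ ('n::{finite,linorder})) list" where
  "basis_list \<sigma> = map (\<lambda>m. axis m 1) (sorted_list_of_set \<sigma>)"

text \<open>The coefficient of \<open>dx\<^sup>\<sigma> \<otimes> dx\<^sup>\<tau>\<close>.\<close>

definition coeff_form :: "('n::{finite,linorder}) form2 \<Rightarrow> 'n set \<Rightarrow> 'n set \<Rightarrow> real" where
  "coeff_form \<mu> \<sigma> \<tau> = \<mu> (basis_list \<sigma>) (basis_list \<tau>)"

definition inner_form :: "('n::{finite,linorder}) form2 \<Rightarrow> 'n form2 \<Rightarrow> real" where
  "inner_form \<mu> \<nu> = (\<Sum>\<sigma>\<in>UNIV. \<Sum>\<tau>\<in>UNIV. coeff_form \<mu> \<sigma> \<tau> * coeff_form \<nu> \<sigma> \<tau>)"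

definition orth_compl :: "nat \<Rightarrow> nat \<Rightarrow> ('n::{finite,linorder}) form2 set \<Rightarrow> 'n form2 set" where
  "orth_compl k l R = {\<mu> \<in> Alt k l. \<forall>\<rho>\<in>R. inner_form \<mu> \<rho> = 0}"

definition orth_proj :: "('n::{finite,linorder}) form2 set \<Rightarrow> 'n form2 \<Rightarrow> 'n form2" where
  "orth_proj V \<mu> =
     (THE \<nu>. \<nu> \<in> V \<and> (\<forall>\<rho>\<in>V. inner_form (\<lambda>vs ws. \<mu> vs ws - \<nu> vs ws) \<rho> = 0))"

text \<open>The map \<open>s\<^sup>k\<^sup>,\<^sup>l\<close> is the restriction of \<open>s_map\<close> to \<open>Alt k l\<close>.\<close>

definition s_map :: "('n::finite) form2 \<Rightarrow> 'n form2" where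
  "s_map \<mu> vs ws = (\<Sum>i<length vs. (-1) ^ i * \<mu> (remove_nth i vs) (vs ! i # ws))"

text \<open>The range of \<open>s\<^sup>k\<^sup>-\<^sup>1\<^sup>,\<^sup>l\<close>, where \<open>s\<^sup>-\<^sup>1\<^sup>,\<^sup>l = 0\<close>.\<close>

fun s_range_into :: "nat \<Rightarrow> nat \<Rightarrow> ('n::finite) form2 set" where
  "s_range_into 0 l = {\<lambda>vs ws. 0}"
| "s_range_into (Suc k) l = s_map ` Alt k l"


section \<open>The BGG operators\<close>

text \<open>A form-valued distribution is represented by its action on test functions; the values at
  functions outside \<open>test_funs\<close> are irrelevant, so equality of distributions is \<open>dist_eq\<close>.\<close>

type_synonym 'n distr = "(real ^ 'n \<Rightarrow> real) \<Rightarrow> 'n form2"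

definition dist_eq :: "('n::finite) distr \<Rightarrow> 'n distr \<Rightarrow> bool" where
  "dist_eq U V \<longleftrightarrow> (\<forall>\<phi>\<in>test_funs. U \<phi> = V \<phi>)"

definition dist_of :: "(real ^ ('n::finite) \<Rightarrow> 'n form2) \<Rightarrow> 'n distr" where
  "dist_of u \<phi> vs ws = (\<integral>x. u x vs ws * \<phi> x \<partial>cube_measure)"

text \<open>The minus sign comes from \<open>(\<partial>\<^sub>m f)(\<phi>) = - f(\<partial>\<^sub>m \<phi>)\<close>.\<close>

definition ext_d :: "('n::finite) distr \<Rightarrow> 'n distr" where
  "ext_d U \<phi> vs ws =
     - (\<Sum>m\<in>UNIV. wedge1 m (\<lambda>vs'. U (partial (axis m 1) \<phi>) vs' ws) vs)"

definition BGG :: "nat \<Rightarrow> nat \<Rightarrow> ('n::{finite,linorder}) distr \<Rightarrow> 'n distr" where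
  "BGG J k U =
     (if k + 1 < J then
        (\<lambda>\<phi>. orth_proj (orth_compl (k + 1) (J - 1) (s_range_into (k + 1) J)) (ext_d U \<phi>))
      else if k + 1 = J then
        ext_d (\<lambda>\<phi>. inv_into (Alt (J - 1) J) s_map (ext_d U \<phi>))
      else ext_d U)"

definition l_deg :: "nat \<Rightarrow> nat \<Rightarrow> nat" where
  "l_deg J k = (if k \<le> J - 1 then J - 1 else J)"

definition BGG_E :: "nat \<Rightarrow> nat \<Rightarrow> ('n::{finite,linorder}) form2 set" where
  "BGG_E J k =
     (if k \<le> J - 1 then orth_compl k (J - 1) (s_range_into k J)
      else {\<mu> \<in> Alt k J. s_map \<mu> = (\<lambda>vs ws. 0)})"

definition L2_forms :: "('n::finite) form2 set \<Rightarrow> (real ^ 'n \<Rightarrow> 'n form2) set" where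
  "L2_forms E = {u. (\<forall>x\<in>cbox 0 One. u x \<in> E) \<and> (\<forall>vs ws. (\<lambda>x. u x vs ws) \<in> L2)}"

definition H_BGG :: "nat \<Rightarrow> nat \<Rightarrow> (real ^ ('n::{finite,linorder}) \<Rightarrow> 'n form2) set" where
  "H_BGG J k = {u \<in> L2_forms (BGG_E J k).
     \<exists>g \<in> L2_forms (BGG_E J (k + 1)). dist_eq (BGG J k (dist_of u)) (dist_of g)}"

text \<open>For \<open>u \<in> H_BGG J k\<close>, a representative of the square-integrable function that the
  distribution \<open>BGG J k (dist_of u)\<close> is given by.\<close>

definition BGG_fun :: "nat \<Rightarrow> nat \<Rightarrow> (real ^ ('n::{finite,linorder}) \<Rightarrow> 'n form2)
    \<Rightarrow> (real ^ ('n::{finite,linorder}) \<Rightarrow> 'n form2)" where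
  "BGG_fun J k u =
     (SOME g. g \<in> L2_forms (BGG_E J (k + 1)) \<and> dist_eq (BGG J k (dist_of u)) (dist_of g))"


section \<open>Tensor product operators\<close>

definition tensor_fun :: "('n::finite \<Rightarrow> real \<Rightarrow> real) \<Rightarrow> real ^ 'n \<Rightarrow> real" where
  "tensor_fun f x = (\<Prod>m\<in>UNIV. f m (x $ m))"

definition is_tensor_op :: "('n::finite \<Rightarrow> (real \<Rightarrow> real) \<Rightarrow> (real \<Rightarrow> real))
    \<Rightarrow> ((real ^ 'n \<Rightarrow> real) \<Rightarrow> (real ^ 'n \<Rightarrow> real)) \<Rightarrow> bool" where
  "is_tensor_op A T \<longleftrightarrow> bounded_L2_op T \<and>
     (\<forall>f. (\<forall>m. f m \<in> L2) \<longrightarrow> L2_eq (T (tensor_fun f)) (tensor_fun (\<lambda>m. A m (f m))))"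

text \<open>The tensor product of bounded operators exists and is unique up to equality in \<open>L\<^sup>2\<close>;
  the choice only selects representatives.\<close>

definition tensor_op :: "('n::finite \<Rightarrow> (real \<Rightarrow> real) \<Rightarrow> (real \<Rightarrow> real))
    \<Rightarrow> (real ^ 'n \<Rightarrow> real) \<Rightarrow> (real ^ 'n \<Rightarrow> real)" where
  "tensor_op A = (SOME T. is_tensor_op A T)"

definition chi :: "'n \<Rightarrow> 'n set \<Rightarrow> nat" where
  "chi m \<sigma> = (if m \<in> \<sigma> then 1 else 0)"

definition tensor_interp ::
  "('n::{finite,linorder} \<Rightarrow> nat \<Rightarrow> nat \<Rightarrow> (real \<Rightarrow> real) \<Rightarrow> (real \<Rightarrow> real)) \<Rightarrow> nat \<Rightarrow> nat
    \<Rightarrow> (real ^ ('n::{finite,linorder}) \<Rightarrow> 'n form2) \<Rightarrow> (real ^ ('n::{finite,linorder}) \<Rightarrow> 'n form2)" where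
  "tensor_interp p k l u x vs ws =
     (\<Sum>\<sigma> | card \<sigma> = k. \<Sum>\<tau> | card \<tau> = l.
        tensor_op (\<lambda>m. p m (chi m \<sigma>) (chi m \<tau>)) (\<lambda>y. coeff_form (u y) \<sigma> \<tau>) x
          * (dx \<sigma> vs * dx \<tau> ws))"

end

theory Submission
  imports Defs
begin

text \<open>Give \<open>dx\<^sup>\<sigma> \<otimes> dx\<^sup>\<tau>\<close> the weight \<open>m \<mapsto> \<chi>\<^sub>m(\<sigma>) + \<chi>\<^sub>m(\<tau>)\<close>.  Since \<open>\<pi>\<^sup>0\<^sup>,\<^sup>1 = \<pi>\<^sup>1\<^sup>,\<^sup>0\<close>, the interpolation
  acts on a coefficient through its weight only.  The maps \<open>s\<close>, \<open>s\<^sup>-\<^sup>1\<close> and the projections preserve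
  weights, and \<open>d\<close> adds one in the direction \<open>m\<close> of \<open>\<partial>\<^sub>m\<close>; hence each coefficient of \<open>\<D> u\<close> is a
  constant-coefficient combination of derivatives \<open>\<partial>\<^sup>\<gamma> u\<^sub>t\<close>, in which the weight of \<open>u\<^sub>t\<close> plus \<open>\<gamma>\<close> is
  the weight of the target.

  Only the combination is known to be square integrable, not its single terms, so the commutation
  is proved by duality.  For a test function \<open>\<psi>\<close>, the adjoints of the one-dimensional operators turn
  \<open>\<psi>, \<psi>', \<psi>''\<close> into functions that behave like a function and its derivatives with vanishing boundary
  values; a du Bois-Reymond argument, one direction at a time, shows that such tensor products are
  admissible as test functions.  This gives the claim on products of test functions.  The
  interpolants lie in tensor products of spaces of weakly differentiable functions, so both sides
  are given by square-integrable functions and the claim follows for all test functions.\<close>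

section \<open>Square-integrable functions on the unit cube\<close>

text \<open>Vanishing boundary values come out of the adjoints because the one-dimensional
  commutation holds for every \<open>u\<close> with a square-integrable weak derivative, without
  boundary conditions on \<open>u\<close>: pairing it with a test function leaves no boundary term.
  The new functions are merely square integrable, so they can enter only through
  \<open>deriv_chain\<close>, an integration by parts against all such \<open>u\<close>. Orders
  never exceed two in any direction, because a weight is a sum of two indicators; hence regularity
  up to second order is enough, and a term of weight \<open>a\<close> can absorb the derivatives
  missing up to the target weight, since its interpolant is built from functions in
  \<open>S m (a m)\<close>, which have \<open>2 - a m\<close> weak derivatives.
  \<open>tensor_op\<close> is a choice among the bounded operators with prescribed values on
  products, so existence and uniqueness have to be supplied. The finite-dimensional ranges give an
  explicit finite sum of rank-one operators, and orthogonality to all products gives uniqueness.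
  Density of products of test functions is not a separate result: it is the order-zero case of the
  replacement of test functions by chains.\<close>

definition ip :: "('a::euclidean_space \<Rightarrow> real) \<Rightarrow> ('a \<Rightarrow> real) \<Rightarrow> real" where
  "ip f g = (\<integral>x. f x * g x \<partial>cube_measure)"

lemma emeasure_cube_One: "emeasure lborel (cbox 0 (One::'a::euclidean_space)) = 1"
  by (simp add: emeasure_lborel_cbox_eq)

lemma space_cube [simp]: "space cube_measure = cbox 0 One"
  by (simp add: cube_measure_def space_restrict_space)

lemma emeasure_space_cube: "emeasure cube_measure (cbox 0 (One::'a::euclidean_space)) = 1"
  by (simp add: cube_measure_def emeasure_restrict_space emeasure_cube_One)

interpretation cube: finite_measure "cube_measure :: 'a::euclidean_space measure"
  by (rule finite_measureI) (simp add: emeasure_space_cube)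

lemma borel_measurable_cube:
  "f \<in> borel_measurable borel \<Longrightarrow> f \<in> borel_measurable cube_measure"
  unfolding cube_measure_def by (intro measurable_restrict_space1) simp

lemma L2_measurable: "f \<in> L2 \<Longrightarrow> f \<in> borel_measurable cube_measure"
  by (simp add: L2_def)

lemma L2_integrable_square: "f \<in> L2 \<Longrightarrow> integrable cube_measure (\<lambda>x. (f x)\<^sup>2)"
  by (simp add: L2_def)

lemma L2_I:
  "f \<in> borel_measurable cube_measure \<Longrightarrow> integrable cube_measure (\<lambda>x. (f x)\<^sup>2) \<Longrightarrow> f \<in> L2"
  by (simp add: L2_def)

lemma L2_integrable_mult:
  assumes "f \<in> L2" "g \<in> L2"
  shows "integrable cube_measure (\<lambda>x. f x * g x)"
proof (rule Bochner_Integration.integrable_bound)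
  show "integrable cube_measure (\<lambda>x. (f x)\<^sup>2 + (g x)\<^sup>2)"
    using assms by (intro Bochner_Integration.integrable_add L2_integrable_square)
  show "(\<lambda>x. f x * g x) \<in> borel_measurable cube_measure"
    using assms by (intro borel_measurable_times L2_measurable)
  have "\<bar>a * b\<bar> \<le> a\<^sup>2 + b\<^sup>2" for a b :: real
  proof -
    have "2 * \<bar>a\<bar> * \<bar>b\<bar> \<le> a\<^sup>2 + b\<^sup>2"
      using sum_squares_bound[of "\<bar>a\<bar>" "\<bar>b\<bar>"] by simp
    moreover have "0 \<le> \<bar>a\<bar> * \<bar>b\<bar>" by simp
    ultimately have "\<bar>a\<bar> * \<bar>b\<bar> \<le> a\<^sup>2 + b\<^sup>2" by linarith
    then show ?thesis by (simp add: abs_mult)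
  qed
  then show "AE x in cube_measure. norm (f x * g x) \<le> norm ((f x)\<^sup>2 + (g x)\<^sup>2)"
    by simp
qed

lemma L2_add:
  assumes "f \<in> L2" "g \<in> L2"
  shows "(\<lambda>x. f x + g x) \<in> L2"
proof (rule L2_I)
  have "integrable cube_measure (\<lambda>x. (f x)\<^sup>2 + (g x)\<^sup>2 + 2 * (f x * g x))"
    using assms
    by (intro Bochner_Integration.integrable_add Bochner_Integration.integrable_mult_right
        L2_integrable_square L2_integrable_mult) auto
  then show "integrable cube_measure (\<lambda>x. (f x + g x)\<^sup>2)"
    by (simp add: power2_sum mult.assoc)
qed (use assms in \<open>intro borel_measurable_add L2_measurable\<close>)

lemma L2_cmult: "f \<in> L2 \<Longrightarrow> (\<lambda>x. c * f x) \<in> L2"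
  by (auto simp: L2_def power_mult_distrib)

lemma L2_zero [simp]: "(\<lambda>x. 0) \<in> L2"
  by (simp add: L2_def)

lemma L2_diff: "f \<in> L2 \<Longrightarrow> g \<in> L2 \<Longrightarrow> (\<lambda>x. f x - g x) \<in> L2"
  using L2_add[of f "\<lambda>x. - 1 * g x"] L2_cmult[of g "-1"] by simp

lemma L2_sum: "(\<And>i. i \<in> I \<Longrightarrow> f i \<in> L2) \<Longrightarrow> (\<lambda>x. \<Sum>i\<in>I. f i x) \<in> L2"
  by (induction I rule: infinite_finite_induct) (auto intro: L2_add)

lemma L2_bounded:
  assumes "f \<in> borel_measurable cube_measure" "\<And>x. x \<in> cbox 0 One \<Longrightarrow> \<bar>f x\<bar> \<le> C"
  shows "f \<in> L2"
proof (rule L2_I)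
  show "integrable cube_measure (\<lambda>x. (f x)\<^sup>2)"
  proof (rule cube.integrable_const_bound)
    show "AE x in cube_measure. norm ((f x)\<^sup>2) \<le> C\<^sup>2"
    proof (rule AE_I2)
      fix x :: 'a assume "x \<in> space cube_measure"
      then have "\<bar>f x\<bar>\<^sup>2 \<le> C\<^sup>2" using assms(2) by (intro power_mono) auto
      then show "norm ((f x)\<^sup>2) \<le> C\<^sup>2" by simp
    qed
    show "(\<lambda>x. (f x)\<^sup>2) \<in> borel_measurable cube_measure" using assms(1) by measurable
  qed
qed fact

lemma L2_const [simp]: "(\<lambda>x. c) \<in> L2"
  by (rule L2_bounded[of _ "\<bar>c\<bar>"]) auto

lemma ip_commute: "ip f g = ip g f"
  by (simp add: ip_def mult.commute)

lemma ip_add_left: "f \<in> L2 \<Longrightarrow> g \<in> L2 \<Longrightarrow> h \<in> L2 \<Longrightarrow> ip (\<lambda>x. f x + g x) h = ip f h + ip g h"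
  by (simp add: ip_def distrib_right Bochner_Integration.integral_add L2_integrable_mult)

lemma ip_cmult_left [simp]: "ip (\<lambda>x. c * f x) h = c * ip f h"
  by (simp add: ip_def mult.assoc)

lemma ip_zero_left [simp]: "ip (\<lambda>x. 0) h = 0"
  by (simp add: ip_def)

lemma ip_diff_left: "f \<in> L2 \<Longrightarrow> g \<in> L2 \<Longrightarrow> h \<in> L2 \<Longrightarrow> ip (\<lambda>x. f x - g x) h = ip f h - ip g h"
  by (simp add: ip_def left_diff_distrib Bochner_Integration.integral_diff L2_integrable_mult)

lemma ip_sum_left:
  "(\<And>i. i \<in> I \<Longrightarrow> f i \<in> L2) \<Longrightarrow> h \<in> L2 \<Longrightarrow> ip (\<lambda>x. \<Sum>i\<in>I. f i x) h = (\<Sum>i\<in>I. ip (f i) h)"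
  by (induction I rule: infinite_finite_induct) (auto simp: ip_add_left L2_sum)

lemma ip_add_right: "f \<in> L2 \<Longrightarrow> g \<in> L2 \<Longrightarrow> h \<in> L2 \<Longrightarrow> ip h (\<lambda>x. f x + g x) = ip h f + ip h g"
  by (simp add: ip_commute[of h] ip_add_left)

lemma ip_cmult_right [simp]: "ip h (\<lambda>x. c * f x) = c * ip h f"
  by (simp add: ip_commute[of h])

lemma ip_zero_right [simp]: "ip h (\<lambda>x. 0) = 0"
  by (simp add: ip_commute[of h])

lemma ip_diff_right: "f \<in> L2 \<Longrightarrow> g \<in> L2 \<Longrightarrow> h \<in> L2 \<Longrightarrow> ip h (\<lambda>x. f x - g x) = ip h f - ip h g"
  by (simp add: ip_commute[of h] ip_diff_left)

lemma ip_self_nonneg: "0 \<le> ip f f"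
  unfolding ip_def by (rule Bochner_Integration.integral_nonneg) simp

lemma L2_norm_power2: "(L2_norm f)\<^sup>2 = ip f f"
  using ip_self_nonneg[of f] by (simp add: L2_norm_def ip_def power2_eq_square)

lemma L2_norm_nonneg [simp]: "0 \<le> L2_norm f"
  by (simp add: L2_norm_def)

lemma L2_norm_ip: "L2_norm f = sqrt (ip f f)"
  by (simp add: L2_norm_def ip_def power2_eq_square)

lemma ip_self_eq_0_iff:
  assumes "f \<in> L2"
  shows "ip f f = 0 \<longleftrightarrow> L2_eq f (\<lambda>x. 0)"
  unfolding ip_def L2_eq_def
  by (subst integral_nonneg_eq_0_iff_AE[OF L2_integrable_mult[OF assms assms]]) auto

lemma L2_eq_iff_ip_diff:
  assumes "f \<in> L2" "g \<in> L2"
  shows "L2_eq f g \<longleftrightarrow> ip (\<lambda>x. f x - g x) (\<lambda>x. f x - g x) = 0"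
  by (subst ip_self_eq_0_iff[OF L2_diff[OF assms]]) (simp add: L2_eq_def)

lemma ip_cong_L2_eq_left:
  assumes "L2_eq f f'" "f \<in> L2" "f' \<in> L2" "h \<in> L2"
  shows "ip f h = ip f' h"
  unfolding ip_def using assms
  by (intro integral_cong_AE borel_measurable_times L2_measurable) (auto simp: L2_eq_def)

lemma L2_eq_sym: "L2_eq f g \<Longrightarrow> L2_eq g f"
  by (auto simp: L2_eq_def)

lemma L2_Cauchy_Schwarz:
  assumes "f \<in> L2" "g \<in> L2"
  shows "\<bar>ip f g\<bar> \<le> L2_norm f * L2_norm g"
proof -
  have le: "2 * t * ip f g \<le> ip f f + t\<^sup>2 * ip g g" for t
  proof -
    have "0 \<le> ip (\<lambda>x. f x - t * g x) (\<lambda>x. f x - t * g x)"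
      by (rule ip_self_nonneg)
    also have "\<dots> = ip f f - 2 * t * ip f g + t\<^sup>2 * ip g g"
      using assms
      by (simp add: ip_diff_left ip_diff_right L2_diff L2_cmult ip_commute[of g f] power2_eq_square
          algebra_simps)
    finally show ?thesis by simp
  qed
  have "(ip f g)\<^sup>2 \<le> ip f f * ip g g"
  proof (cases "ip g g = 0")
    case True
    have "ip f g = 0"
    proof (rule ccontr)
      assume "ip f g \<noteq> 0"
      \<comment> \<open>With \<open>ip g g = 0\<close> the bound reads
        \<open>2 * t * ip f g \<le> ip f f\<close> for every \<open>t\<close>; this \<open>t\<close>
        makes the left side exceed the right side by one.\<close>
      then have "2 * ((ip f f + 1) / (2 * ip f g)) * ip f g = ip f f + 1" by simp
      then show False
        using le[of "(ip f f + 1) / (2 * ip f g)"] True by simp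
    qed
    then show ?thesis using True by simp
  next
    case False
    then have pos: "0 < ip g g" using ip_self_nonneg[of g] by linarith
    \<comment> \<open>The value of \<open>t\<close> at which the quadratic in \<open>t\<close> is
      smallest, so the bound is sharpest.\<close>
    show ?thesis using le[of "ip f g / ip g g"] pos
      by (simp add: field_simps power2_eq_square)
  qed
  then have "sqrt ((ip f g)\<^sup>2) \<le> sqrt (ip f f * ip g g)"
    by (rule real_sqrt_le_mono)
  then show ?thesis by (simp add: L2_norm_ip real_sqrt_mult)
qed

lemma L2_norm_triangle:
  assumes "f \<in> L2" "g \<in> L2"
  shows "L2_norm (\<lambda>x. f x + g x) \<le> L2_norm f + L2_norm g"
proof (rule power2_le_imp_le)
  have "(L2_norm (\<lambda>x. f x + g x))\<^sup>2 = ip f f + 2 * ip f g + ip g g"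
    using assms by (simp add: L2_norm_power2 ip_add_left ip_add_right L2_add ip_commute[of g f])
  also have "\<dots> \<le> ip f f + 2 * (L2_norm f * L2_norm g) + ip g g"
    using L2_Cauchy_Schwarz[OF assms] by linarith
  also have "\<dots> = (L2_norm f + L2_norm g)\<^sup>2"
    by (simp add: power2_sum L2_norm_power2)
  finally show "(L2_norm (\<lambda>x. f x + g x))\<^sup>2 \<le> (L2_norm f + L2_norm g)\<^sup>2" .
qed simp

lemma L2_norm_sum:
  assumes "\<And>i. i \<in> I \<Longrightarrow> f i \<in> L2"
  shows "L2_norm (\<lambda>x. \<Sum>i\<in>I. f i x) \<le> (\<Sum>i\<in>I. L2_norm (f i))"
  using assms
proof (induction I rule: infinite_finite_induct)
  case (insert i I)
  have "L2_norm (\<lambda>x. \<Sum>i\<in>insert i I. f i x) = L2_norm (\<lambda>x. f i x + (\<Sum>i\<in>I. f i x))"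
    using insert by simp
  also have "\<dots> \<le> L2_norm (f i) + L2_norm (\<lambda>x. \<Sum>i\<in>I. f i x)"
    using insert by (intro L2_norm_triangle L2_sum) auto
  finally show ?case using insert by simp
qed (auto simp: L2_norm_def)

lemma L2_norm_cmult: "L2_norm (\<lambda>x. c * f x) = \<bar>c\<bar> * L2_norm f"
  unfolding L2_norm_ip ip_cmult_left ip_cmult_right mult.assoc[symmetric]
  by (simp add: real_sqrt_mult)

lemma L2_abs: "f \<in> L2 \<Longrightarrow> (\<lambda>x. \<bar>f x\<bar>) \<in> L2"
  by (auto simp: L2_def)

lemma L2_norm_abs: "L2_norm (\<lambda>x. \<bar>f x\<bar>) = L2_norm f"
  by (simp add: L2_norm_def)

section \<open>Weak limits, the Riesz representation theorem and adjoints\<close>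

lemma nn_integral_square:
  assumes "f \<in> L2"
  shows "(\<integral>\<^sup>+x. ennreal ((f x)\<^sup>2) \<partial>cube_measure) = ennreal ((L2_norm f)\<^sup>2)"
  using nn_integral_eq_integral[OF L2_integrable_square[OF assms]]
  unfolding L2_norm_power2 ip_def by (simp add: power2_eq_square)

text \<open>The telescoping series of absolute differences dominates the sequence in \<open>L\<^sup>2\<close>, so that
  dominated convergence applies.\<close>

lemma L2_weak_limit:
  fixes f :: "nat \<Rightarrow> 'a::euclidean_space \<Rightarrow> real"
  assumes f: "\<And>n. f n \<in> L2"
    and fast: "\<And>n. L2_norm (\<lambda>x. f (Suc n) x - f n x) \<le> C * (1/2) ^ n"
  shows "\<exists>h\<in>L2. \<forall>g\<in>L2. (\<lambda>n. ip (f n) g) \<longlonglongrightarrow> ip h g"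
proof -
  define d where "d n x = \<bar>f (Suc n) x - f n x\<bar>" for n x
  define G where "G N x = \<bar>f 0 x\<bar> + (\<Sum>n<N. d n x)" for N x
  have dL2: "d n \<in> L2" for n
    unfolding d_def by (intro L2_abs L2_diff f)
  have GL2: "G N \<in> L2" for N
    unfolding G_def by (intro L2_add L2_sum L2_abs f dL2)
  have d_nonneg: "0 \<le> d n x" for n x by (simp add: d_def)
  have G_nonneg: "0 \<le> G N x" for N x
    unfolding G_def by (intro add_nonneg_nonneg sum_nonneg d_nonneg) simp
  define B where "B = L2_norm (f 0) + 2 * \<bar>C\<bar>"
  have B0: "0 \<le> B" by (simp add: B_def)
  have G_bound: "L2_norm (G N) \<le> B" for N
  proof -
    have "L2_norm (G N) \<le> L2_norm (\<lambda>x. \<bar>f 0 x\<bar>) + L2_norm (\<lambda>x. \<Sum>n<N. d n x)"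
      unfolding G_def by (intro L2_norm_triangle L2_sum L2_abs f dL2)
    also have "L2_norm (\<lambda>x. \<Sum>n<N. d n x) \<le> (\<Sum>n<N. L2_norm (d n))"
      by (intro L2_norm_sum dL2)
    also have "\<dots> \<le> (\<Sum>n<N. \<bar>C\<bar> * (1/2)^n)"
    proof (rule sum_mono)
      fix n
      have "L2_norm (d n) \<le> C * (1/2)^n" unfolding d_def L2_norm_abs by (rule fast)
      also have "\<dots> \<le> \<bar>C\<bar> * (1/2)^n" by (intro mult_right_mono) auto
      finally show "L2_norm (d n) \<le> \<bar>C\<bar> * (1/2)^n" .
    qed
    also have "\<dots> = \<bar>C\<bar> * (\<Sum>n<N. (1/2)^n)" by (simp add: sum_distrib_left)
    also have "\<dots> \<le> \<bar>C\<bar> * 2"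
      using sum_gp_strict[of "1/2::real" N] by (intro mult_left_mono) auto
    finally show ?thesis by (simp add: B_def L2_norm_abs)
  qed
  have G_mono: "G N x \<le> G (Suc N) x" for N x
    using d_nonneg by (simp add: G_def)
  \<comment> \<open>Monotone convergence turns the uniform bound \<open>B\<close> on the norms into
    finiteness of the supremum almost everywhere, which is summability of the differences.\<close>
  have "(\<integral>\<^sup>+x. (SUP N. ennreal ((G N x)\<^sup>2)) \<partial>cube_measure) = (SUP N. \<integral>\<^sup>+x. ennreal ((G N x)\<^sup>2) \<partial>cube_measure)"
  proof (rule nn_integral_monotone_convergence_SUP)
    show "incseq (\<lambda>N x. ennreal ((G N x)\<^sup>2))"
      using G_mono G_nonneg by (intro incseq_SucI le_funI ennreal_leI power_mono) auto
    show "(\<lambda>x. ennreal ((G N x)\<^sup>2)) \<in> borel_measurable cube_measure" for N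
      using L2_measurable[OF GL2[of N]] by measurable
  qed
  also have "\<dots> \<le> ennreal (B\<^sup>2)"
    using G_bound by (intro SUP_least) (simp add: nn_integral_square GL2 ennreal_leI power_mono)
  finally have nn: "(\<integral>\<^sup>+x. (SUP N. ennreal ((G N x)\<^sup>2)) \<partial>cube_measure) \<le> ennreal (B\<^sup>2)" .
  have "AE x in cube_measure. (SUP N. ennreal ((G N x)\<^sup>2)) \<noteq> \<infinity>"
  proof (rule nn_integral_PInf_AE)
    show "(\<lambda>x. SUP N. ennreal ((G N x)\<^sup>2)) \<in> borel_measurable cube_measure"
      using L2_measurable[OF GL2] by measurable
    show "(\<integral>\<^sup>+x. (SUP N. ennreal ((G N x)\<^sup>2)) \<partial>cube_measure) \<noteq> \<infinity>"
      using nn by (auto simp: top_unique)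
  qed
  then have summ: "AE x in cube_measure. summable (\<lambda>n. d n x)"
  proof eventually_elim
    case (elim x)
    then obtain K where K: "(SUP N. ennreal ((G N x)\<^sup>2)) = ennreal K" "0 \<le> K"
      by (cases "SUP N. ennreal ((G N x)\<^sup>2)") auto
    have "(G N x)\<^sup>2 \<le> K" for N
    proof -
      have "ennreal ((G N x)\<^sup>2) \<le> ennreal K"
        unfolding K(1)[symmetric] by (rule SUP_upper) simp
      then show ?thesis using K(2) by simp
    qed
    then have "G N x \<le> sqrt K" for N
      using real_le_rsqrt by blast
    then have "(\<Sum>n<N. d n x) \<le> sqrt K" for N
      using abs_ge_zero[of "f 0 x"] unfolding G_def by (meson add_increasing le_add_same_cancel2 order_trans)
    then show ?case
      by (intro summableI_nonneg_bounded d_nonneg)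
  qed
  \<comment> \<open>Where the sequence diverges, \<open>lim\<close> is an unspecified value; this
    happens on a null set only.\<close>
  define h where "h x = lim (\<lambda>n. f n x)" for x
  define D where "D x = \<bar>f 0 x\<bar> + (\<Sum>n. d n x)" for x
  have conv: "AE x in cube_measure. (\<lambda>n. f n x) \<longlonglongrightarrow> h x \<and> (\<lambda>N. G N x) \<longlonglongrightarrow> D x \<and> (\<forall>N. \<bar>f N x\<bar> \<le> D x)"
    using summ
  proof eventually_elim
    case (elim x)
    have "summable (\<lambda>n. f (Suc n) x - f n x)"
      using elim unfolding d_def by (rule summable_rabs_cancel)
    then have "(\<lambda>N. \<Sum>n<N. f (Suc n) x - f n x) \<longlonglongrightarrow> (\<Sum>n. f (Suc n) x - f n x)"
      by (rule summable_LIMSEQ)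
    then have "(\<lambda>N. f N x - f 0 x) \<longlonglongrightarrow> (\<Sum>n. f (Suc n) x - f n x)"
      by (simp only: sum_lessThan_telescope[of "\<lambda>n. f n x"])
    then have "(\<lambda>N. (f N x - f 0 x) + f 0 x) \<longlonglongrightarrow> (\<Sum>n. f (Suc n) x - f n x) + f 0 x"
      by (intro tendsto_add tendsto_const)
    then have "convergent (\<lambda>N. f N x)" by (auto simp: convergent_def)
    then have 1: "(\<lambda>n. f n x) \<longlonglongrightarrow> h x"
      unfolding h_def by (simp add: convergent_LIMSEQ_iff)
    have 2: "(\<lambda>N. G N x) \<longlonglongrightarrow> D x"
      unfolding G_def D_def by (intro tendsto_add tendsto_const summable_LIMSEQ elim)
    have "\<bar>f N x\<bar> \<le> G N x" for N
      by (induction N) (auto simp: G_def d_def)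
    moreover have "G N x \<le> D x" for N
      unfolding G_def D_def using sum_le_suminf[OF elim, of "{..<N}"] d_nonneg by simp
    ultimately show ?case using 1 2 by (meson order_trans)
  qed
  have h_meas [measurable]: "h \<in> borel_measurable cube_measure"
    unfolding h_def by (rule borel_measurable_lim_metric) (rule L2_measurable[OF f])
  have D_meas [measurable]: "D \<in> borel_measurable cube_measure"
    unfolding D_def
    by (intro borel_measurable_add borel_measurable_abs borel_measurable_suminf L2_measurable f dL2)
  have "(\<integral>\<^sup>+x. ennreal ((D x)\<^sup>2) \<partial>cube_measure) \<le> (\<integral>\<^sup>+x. (SUP N. ennreal ((G N x)\<^sup>2)) \<partial>cube_measure)"
  proof (rule nn_integral_mono_AE)
    show "AE x in cube_measure. ennreal ((D x)\<^sup>2) \<le> (SUP N. ennreal ((G N x)\<^sup>2))"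
      using conv
    proof eventually_elim
      case (elim x)
      then have "(\<lambda>N. ennreal ((G N x)\<^sup>2)) \<longlonglongrightarrow> ennreal ((D x)\<^sup>2)"
        by (intro tendsto_ennrealI tendsto_power) auto
      then show ?case
        by (rule LIMSEQ_le_const2) (auto intro!: SUP_upper exI[of _ 0])
    qed
  qed
  then have D_fin: "(\<integral>\<^sup>+x. ennreal ((D x)\<^sup>2) \<partial>cube_measure) < \<infinity>"
    using nn by (auto simp: top_unique less_top[symmetric] intro: order.strict_trans1)
  have DL2: "D \<in> L2"
    using D_fin by (intro L2_I integrableI_bounded) auto
  have hL2: "h \<in> L2"
  proof (rule L2_I[OF h_meas], rule Bochner_Integration.integrable_bound[OF L2_integrable_square[OF DL2]])
    show "AE x in cube_measure. norm ((h x)\<^sup>2) \<le> norm ((D x)\<^sup>2)"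
      using conv
    proof eventually_elim
      case (elim x)
      have "(\<lambda>n. \<bar>f n x\<bar>) \<longlonglongrightarrow> \<bar>h x\<bar>" using elim by (intro tendsto_rabs) auto
      then have "\<bar>h x\<bar> \<le> D x" using elim by (intro LIMSEQ_le_const2) auto
      then show ?case using abs_le_square_iff[of "h x" "D x"] by simp
    qed
  qed simp
  have "(\<lambda>n. ip (f n) g) \<longlonglongrightarrow> ip h g" if g: "g \<in> L2" for g
    unfolding ip_def
  proof (rule integral_dominated_convergence)
    show "(\<lambda>x. h x * g x) \<in> borel_measurable cube_measure"
      using L2_measurable[OF g] by measurable
    show "(\<lambda>x. f n x * g x) \<in> borel_measurable cube_measure" for n
      using L2_measurable[OF g] L2_measurable[OF f] by measurable
    show "integrable cube_measure (\<lambda>x. D x * \<bar>g x\<bar>)"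
      by (intro L2_integrable_mult DL2 L2_abs g)
    show "AE x in cube_measure. (\<lambda>n. f n x * g x) \<longlonglongrightarrow> h x * g x"
      using conv by eventually_elim (auto intro: tendsto_mult)
    show "AE x in cube_measure. norm (f n x * g x) \<le> D x * \<bar>g x\<bar>" for n
      using conv by eventually_elim (auto simp: abs_mult intro: mult_right_mono)
  qed
  then show ?thesis using hL2 by blast
qed

text \<open>The representing function minimises \<open>J f = \<parallel>f\<parallel>\<^sup>2 / 2 - \<Lambda> f\<close>.\<close>

lemma L2_Riesz:
  fixes \<Lambda> :: "('a::euclidean_space \<Rightarrow> real) \<Rightarrow> real"
  assumes add: "\<And>f g. f \<in> L2 \<Longrightarrow> g \<in> L2 \<Longrightarrow> \<Lambda> (\<lambda>x. f x + g x) = \<Lambda> f + \<Lambda> g"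
    and cmult: "\<And>f c. f \<in> L2 \<Longrightarrow> \<Lambda> (\<lambda>x. c * f x) = c * \<Lambda> f"
    and bound: "\<And>f. f \<in> L2 \<Longrightarrow> \<bar>\<Lambda> f\<bar> \<le> C * L2_norm f"
  shows "\<exists>h\<in>L2. \<forall>f\<in>L2. \<Lambda> f = ip f h"
proof -
  define J where "J f = ip f f / 2 - \<Lambda> f" for f
  define I where "I = Inf (J ` L2)"
  have lower: "- (C\<^sup>2 / 2) \<le> J f" if "f \<in> L2" for f
  proof -
    have "2 * \<Lambda> f \<le> 2 * (C * L2_norm f)" using bound[OF that] by linarith
    also have "\<dots> \<le> C\<^sup>2 + (L2_norm f)\<^sup>2"
      using sum_squares_bound[of C "L2_norm f"] by (simp add: mult.assoc)
    finally show ?thesis by (simp add: J_def L2_norm_power2)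
  qed
  have bdd: "bdd_below (J ` L2)" using lower by (auto simp: bdd_below_def)
  have I_le: "I \<le> J f" if "f \<in> L2" for f
    unfolding I_def using bdd that by (simp add: cINF_lower)
  \<comment> \<open>The tolerance decays like \<open>(1/4)^n\<close> so that the norms of the
    differences decay like \<open>(1/2)^n\<close>; the factor 32 leaves room in the parallelogram
    estimate below.\<close>
  have "\<exists>f\<in>L2. J f < I + (1/4)^n / 32" for n
  proof -
    have "Inf (J ` L2) < I + (1/4)^n / 32" unfolding I_def by simp
    moreover have "J ` L2 \<noteq> {}" using L2_zero by blast
    ultimately obtain y where "y \<in> J ` L2" "y < I + (1/4)^n / 32"
      by (meson cInf_lessD)
    then show ?thesis by blast
  qed
  then obtain f where f: "\<And>n. f n \<in> L2" and Jf: "\<And>n. J (f n) < I + (1/4)^n / 32"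
    by metis
  have "L2_norm (\<lambda>x. f (Suc n) x - f n x) \<le> 1 * (1/2) ^ n" for n
  proof (rule power2_le_imp_le)
    let ?a = "f (Suc n)" and ?b = "f n"
    \<comment> \<open>Parallelogram identity: the midpoint of two almost minimising functions cannot
      push \<open>J\<close> below \<open>I\<close>, so the two functions are close.\<close>
    define c where "c = (\<lambda>x. (1/2) * (?a x + ?b x))"
    have c: "c \<in> L2" unfolding c_def by (intro L2_cmult L2_add f)
    have "ip c c = (ip ?a ?a + 2 * ip ?a ?b + ip ?b ?b) / 4"
      unfolding c_def ip_cmult_left ip_cmult_right
      by (simp add: ip_add_left ip_add_right L2_add f ip_commute[of ?b ?a])
    moreover have "\<Lambda> c = (\<Lambda> ?a + \<Lambda> ?b) / 2"
      unfolding c_def by (subst cmult) (simp_all add: L2_add add f)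
    moreover have "(L2_norm (\<lambda>x. ?a x - ?b x))\<^sup>2 = ip ?a ?a - 2 * ip ?a ?b + ip ?b ?b"
      by (simp add: L2_norm_power2 ip_diff_left ip_diff_right L2_diff f ip_commute[of ?b ?a])
    ultimately have "(L2_norm (\<lambda>x. ?a x - ?b x))\<^sup>2 = 4 * J ?a + 4 * J ?b - 8 * J c"
      by (simp add: J_def field_simps)
    also have "\<dots> \<le> (1/4)^n"
    proof -
      define e :: real where "e = (1/4)^n"
      have "0 < e" by (simp add: e_def)
      then show ?thesis
        using Jf[of n] Jf[of "Suc n"] I_le[OF c] unfolding power_Suc e_def[symmetric] by argo
    qed
    also have "\<dots> = (1 * (1/2)^n)\<^sup>2"
      by (simp add: power2_eq_square flip: power_mult_distrib)
    finally show "(L2_norm (\<lambda>x. ?a x - ?b x))\<^sup>2 \<le> (1 * (1/2)^n)\<^sup>2" .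
  qed simp
  then obtain h where h: "h \<in> L2" and lim: "\<And>g. g \<in> L2 \<Longrightarrow> (\<lambda>n. ip (f n) g) \<longlonglongrightarrow> ip h g"
    using L2_weak_limit[of f 1] f by blast
  have "\<Lambda> g = ip g h" if g: "g \<in> L2" for g
  proof -
    define X where "X = ip h g - \<Lambda> g"
    define K where "K = ip g g / 2"
    \<comment> \<open>First variation: perturbing \<open>f n\<close> by a multiple of
      \<open>g\<close> cannot push \<open>J\<close> below \<open>I\<close>. Only pairings with
      \<open>g\<close> occur in the difference, so the weak limit is enough.\<close>
    have "0 \<le> t * X + t\<^sup>2 * K" for t
    proof (rule LIMSEQ_le)
      show "(\<lambda>n. - ((1/4)^n / 32)) \<longlonglongrightarrow> (0::real)"
        by (auto intro!: tendsto_eq_intros LIMSEQ_power_zero)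
      show "(\<lambda>n. t * (ip (f n) g - \<Lambda> g) + t\<^sup>2 * K) \<longlonglongrightarrow> t * X + t\<^sup>2 * K"
        unfolding X_def by (intro tendsto_intros lim g)
      have "- ((1/4)^n / 32) \<le> t * (ip (f n) g - \<Lambda> g) + t\<^sup>2 * K" for n
      proof -
        have "I \<le> J (\<lambda>x. f n x + t * g x)" by (intro I_le L2_add L2_cmult f g)
        also have "\<dots> = J (f n) + (t * (ip (f n) g - \<Lambda> g) + t\<^sup>2 * K)"
          by (simp add: J_def K_def add cmult ip_add_left ip_add_right L2_add L2_cmult f g
              ip_commute[of g "f n"] power2_eq_square field_simps)
        finally show ?thesis using Jf[of n] by linarith
      qed
      then show "\<exists>N. \<forall>n\<ge>N. - ((1/4)^n / 32) \<le> t * (ip (f n) g - \<Lambda> g) + t\<^sup>2 * K" by blast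
    qed
    note nonneg = this
    \<comment> \<open>Adding one keeps the denominator positive when \<open>K = 0\<close>. At
      \<open>- X * t\<close> the quadratic equals \<open>- ((t * X)\<^sup>2)\<close>, which forces
      \<open>X = 0\<close>.\<close>
    define t where "t = 1 / (K + 1)"
    have K: "0 \<le> K" using ip_self_nonneg[of g] by (simp add: K_def)
    then have t: "t * K = 1 - t" "0 < t" by (simp_all add: t_def field_simps)
    have "- X * t * X + (- X * t)\<^sup>2 * K = - X * t * X + X\<^sup>2 * t * (t * K)"
      by (simp add: power2_eq_square)
    also have "\<dots> = - ((t * X)\<^sup>2)"
      unfolding t(1) by (simp add: power2_eq_square algebra_simps)
    finally have "X = 0"
      using nonneg[of "- X * t"] t(2) by simp
    then show ?thesis by (simp add: X_def ip_commute)
  qed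
  then show ?thesis using h by blast
qed

lemma bounded_L2_op_L2: "bounded_L2_op T \<Longrightarrow> f \<in> L2 \<Longrightarrow> T f \<in> L2"
  by (simp add: bounded_L2_op_def)

text \<open>Linearity of \<open>T\<close> holds only up to null sets, but pairing with
  \<open>g\<close> does not see them, so the Riesz theorem applies to
  \<open>\<lambda>f. ip (T f) g\<close>.\<close>

lemma bounded_L2_op_adjoint:
  assumes T: "bounded_L2_op T" and g: "g \<in> L2"
  shows "\<exists>h\<in>L2. \<forall>f\<in>L2. ip (T f) g = ip f h"
proof -
  from T obtain C where C: "\<And>f. f \<in> L2 \<Longrightarrow> L2_norm (T f) \<le> C * L2_norm f"
    unfolding bounded_L2_op_def by blast
  show ?thesis
  proof (rule L2_Riesz[where C = "C * L2_norm g"])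
    fix f1 f2 :: "'a \<Rightarrow> real" assume f: "f1 \<in> L2" "f2 \<in> L2"
    have "ip (T (\<lambda>x. f1 x + f2 x)) g = ip (\<lambda>x. T f1 x + T f2 x) g"
      using T f g by (intro ip_cong_L2_eq_left) (auto simp: bounded_L2_op_def L2_add)
    then show "ip (T (\<lambda>x. f1 x + f2 x)) g = ip (T f1) g + ip (T f2) g"
      using T f g by (simp add: ip_add_left bounded_L2_op_L2)
  next
    fix f :: "'a \<Rightarrow> real" and c assume f: "f \<in> L2"
    have "ip (T (\<lambda>x. c * f x)) g = ip (\<lambda>x. c * T f x) g"
      using T f g by (intro ip_cong_L2_eq_left) (auto simp: bounded_L2_op_def L2_cmult)
    then show "ip (T (\<lambda>x. c * f x)) g = c * ip (T f) g" by simp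
  next
    fix f :: "'a \<Rightarrow> real" assume f: "f \<in> L2"
    have "\<bar>ip (T f) g\<bar> \<le> L2_norm (T f) * L2_norm g"
      by (rule L2_Cauchy_Schwarz[OF bounded_L2_op_L2[OF T f] g])
    also have "\<dots> \<le> (C * L2_norm f) * L2_norm g"
      using C[OF f] by (intro mult_right_mono) auto
    finally show "\<bar>ip (T f) g\<bar> \<le> C * L2_norm g * L2_norm f" by (simp add: ac_simps)
  qed
qed


section \<open>Tensor products and one-coordinate slices\<close>

text \<open>An intersection-stable generator of the trace sigma-algebra. The boxes are cut with the
  cube because \<open>cube_measure\<close> lives on the cube only. Two uniqueness principles rest on
  it, one for measures and one for square-integrable functions.\<close>

definition cube_boxes :: "'a::ordered_euclidean_space set set" where
  "cube_boxes = range (\<lambda>(a, b). cbox 0 One \<inter> cbox a b)"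

lemma sets_cube_measure:
  "sets (cube_measure :: 'a::ordered_euclidean_space measure) = sigma_sets (cbox 0 One) cube_boxes"
proof -
  have 1: "sets (borel :: 'a measure) = sigma_sets UNIV (range (\<lambda>(a, b). cbox a b))"
    unfolding borel_eq_atLeastAtMost interval_cbox by (rule sets_measure_of) simp
  have "sets (cube_measure :: 'a measure) = (\<inter>) (cbox 0 One) ` sets borel"
    by (simp add: cube_measure_def sets_restrict_space)
  also have "\<dots> = sigma_sets (cbox 0 One) ((\<inter>) (cbox 0 One) ` range (\<lambda>(a, b). cbox a b))"
    unfolding 1 by (rule sigma_sets_Int) (auto simp: 1[symmetric])
  also have "(\<inter>) (cbox 0 One) ` range (\<lambda>(a::'a, b). cbox a b) = cube_boxes"
    unfolding cube_boxes_def by (auto simp: image_image)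
  finally show ?thesis .
qed

lemma Int_stable_cube_boxes: "Int_stable cube_boxes"
proof (rule Int_stableI)
  fix A B :: "'a set" assume "A \<in> cube_boxes" "B \<in> cube_boxes"
  then obtain a b c d where AB: "A = cbox 0 One \<inter> cbox a b" "B = cbox 0 One \<inter> cbox c d"
    by (auto simp: cube_boxes_def)
  obtain u v where "cbox a b \<inter> cbox c d = cbox u v"
    using Int_interval by blast
  then have "A \<inter> B = cbox 0 One \<inter> cbox u v" using AB by auto
  then show "A \<inter> B \<in> cube_boxes" by (auto simp: cube_boxes_def)
qed

lemma cube_boxes_subset: "cube_boxes \<subseteq> Pow (cbox 0 One)"
  by (auto simp: cube_boxes_def)

lemma cube_boxes_sets: "A \<in> cube_boxes \<Longrightarrow> A \<in> sets cube_measure"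
  by (simp add: sets_cube_measure sigma_sets.Basic)

lemma cube_in_cube_boxes: "cbox 0 One \<in> cube_boxes"
  unfolding cube_boxes_def by (rule range_eqI[of _ _ "(0, One)"]) simp

lemma cube_measure_eqI:
  fixes N :: "'a::ordered_euclidean_space measure"
  assumes "sets N = sets cube_measure"
    and "\<And>A. A \<in> cube_boxes \<Longrightarrow> emeasure N A = emeasure cube_measure A"
  shows "N = cube_measure"
proof (rule measure_eqI_generator_eq[OF Int_stable_cube_boxes cube_boxes_subset assms(2),
      where A = "\<lambda>_. cbox 0 One"])
  show "emeasure N (cbox 0 One) \<noteq> \<infinity>" for i :: nat
    using assms(2)[OF cube_in_cube_boxes] by (simp add: emeasure_space_cube)
qed (use assms cube_in_cube_boxes in \<open>auto simp: sets_cube_measure\<close>)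

text \<open>The sets over which \<open>f\<close> integrates to zero are closed under complements
  (the cube itself is a box) and disjoint countable unions, so they include everything that the
  boxes generate. A function whose integral over every measurable set vanishes is zero almost
  everywhere.\<close>

lemma L2_eq_0_if_orthogonal_boxes:
  fixes f :: "'a::ordered_euclidean_space \<Rightarrow> real"
  assumes f: "f \<in> L2" and boxes: "\<And>a b. ip f (indicator (cbox a b)) = 0"
  shows "L2_eq f (\<lambda>x. 0)"
proof -
  have int: "integrable cube_measure f"
    using L2_integrable_mult[OF f L2_const[of 1]] by simp
  have int_ind: "integrable cube_measure (\<lambda>x. indicator A x * f x)" if "A \<in> sets cube_measure" for A
    using integrable_mult_indicator[OF that int] by simp
  have "(\<integral>x. indicator A x * f x \<partial>cube_measure) = 0" if "A \<in> sets cube_measure" for A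
    using Int_stable_cube_boxes cube_boxes_subset that[unfolded sets_cube_measure]
  proof (induction rule: sigma_sets_induct_disjoint)
    case (basic A)
    then obtain a b where A: "A = cbox 0 One \<inter> cbox a b" by (auto simp: cube_boxes_def)
    have "(\<integral>x. indicator A x * f x \<partial>cube_measure) = ip f (indicator (cbox a b))"
      unfolding ip_def by (rule Bochner_Integration.integral_cong) (auto simp: A indicator_def)
    then show ?case using boxes by simp
  next
    case empty
    show ?case by simp
  next
    case (compl A)
    then have A: "A \<in> sets cube_measure" by (simp add: sets_cube_measure)
    have "(\<integral>x. indicator (cbox 0 One - A) x * f x \<partial>cube_measure)
        = (\<integral>x. f x - indicator A x * f x \<partial>cube_measure)"
      by (rule Bochner_Integration.integral_cong) (auto simp: indicator_def)
    also have "\<dots> = (\<integral>x. f x \<partial>cube_measure)"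
      using compl by (simp add: Bochner_Integration.integral_diff[OF int int_ind[OF A]])
    also have "\<dots> = ip f (indicator (cbox 0 One))"
      unfolding ip_def by (rule Bochner_Integration.integral_cong) auto
    finally show ?case using boxes by simp
  next
    case (union A)
    then have A: "\<And>i. A i \<in> sets cube_measure" by (simp add: sets_cube_measure image_subset_iff)
    have "(\<integral>x. indicator (\<Union>i. A i) x * f x \<partial>cube_measure) = (LINT x:(\<Union>i. A i)|cube_measure. f x)"
      by (simp add: set_lebesgue_integral_def)
    also have "\<dots> = (\<Sum>i. LINT x:A i|cube_measure. f x)"
    proof (rule lebesgue_integral_countable_add)
      show "A i \<inter> A j = {}" if "i \<noteq> j" for i j
        using union.hyps(1) that by (auto simp: disjoint_family_on_def)
      have "(\<Union>i. A i) \<in> sets cube_measure" using A by auto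
      then show "set_integrable cube_measure (\<Union>i. A i) f"
        using int_ind by (simp add: set_integrable_def)
    qed (rule A)
    also have "\<dots> = 0"
      using union by (simp add: set_lebesgue_integral_def)
    finally show ?case .
  qed
  then have "AE x in cube_measure. f x = 0"
    by (intro cube.density_zero[OF int]) (simp add: set_lebesgue_integral_def)
  then show ?thesis by (simp add: L2_eq_def)
qed

section \<open>Integration in a single coordinate\<close>

lemma One_cart [simp]: "(\<Sum>b\<in>(Basis :: (real ^ 'n) set). b $ i) = 1"
proof -
  have "One \<bullet> (axis i 1 :: real ^ 'n) = 1"
    using inner_sum_left_Basis[of "axis i 1 :: real ^ 'n" "\<lambda>_. 1"] by (auto simp: Basis_vec_def)
  then show ?thesis by (simp add: inner_axis)
qed

definition upd :: "real ^ 'n \<Rightarrow> 'n \<Rightarrow> real \<Rightarrow> real ^ 'n" where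
  "upd x m t = (\<chi> j. if j = m then t else x $ j)"

lemma upd_nth [simp]: "upd x m t $ j = (if j = m then t else x $ j)"
  by (simp add: upd_def)

text \<open>Length zero for an empty interval makes the product formula hold for empty boxes as
  well.\<close>

definition ilen :: "real \<Rightarrow> real \<Rightarrow> ennreal" where
  "ilen a b = ennreal (if a \<le> b then b - a else 0)"

lemma emeasure_lborel_cbox_cart:
  "emeasure lborel (cbox a (b :: real ^ 'n)) = (\<Prod>i\<in>UNIV. ilen (a $ i) (b $ i))"
proof -
  have B: "(Basis :: (real ^ 'n) set) = (\<lambda>i. axis i 1) ` UNIV" by (auto simp: Basis_vec_def)
  have inj: "inj (\<lambda>i. axis i (1::real) :: real ^ 'n)" by (auto simp: inj_on_def axis_eq_axis)
  show ?thesis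
  proof (cases "\<forall>i. a $ i \<le> b $ i")
    case True
    then have "emeasure lborel (cbox a b) = ennreal (\<Prod>i\<in>UNIV. b $ i - a $ i)"
      by (simp add: emeasure_lborel_cbox_eq B inner_axis prod.reindex[OF inj] inner_diff_left)
    also have "\<dots> = (\<Prod>i\<in>UNIV. ennreal (b $ i - a $ i))"
      using True by (intro prod_ennreal[symmetric]) auto
    finally show ?thesis using True by (simp add: ilen_def)
  next
    case False
    then have "emeasure lborel (cbox a b) = 0"
      by (auto simp: emeasure_lborel_cbox_eq B inner_axis)
    moreover have "(\<Prod>i\<in>UNIV. ilen (a $ i) (b $ i)) = 0"
      using False by (auto simp: ilen_def)
    ultimately show ?thesis by simp
  qed
qed

lemma emeasure_cube_cbox_cart:
  "emeasure cube_measure (cbox 0 One \<inter> cbox a (b :: real ^ 'n)) =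
     (\<Prod>i\<in>UNIV. ilen (max 0 (a $ i)) (min 1 (b $ i)))"
proof -
  have "emeasure cube_measure (cbox 0 One \<inter> cbox a b) = emeasure lborel (cbox 0 One \<inter> cbox a b)"
    by (simp add: cube_measure_def emeasure_restrict_space)
  then show ?thesis
    by (simp add: Int_interval_cart interval_cbox_cart emeasure_lborel_cbox_cart)
qed

lemma emeasure_cube_cbox_real:
  "emeasure cube_measure (cbox 0 1 \<inter> cbox a (b :: real)) = ilen (max 0 a) (min 1 b)"
  by (simp add: cube_measure_def emeasure_restrict_space Int_atLeastAtMost max_def min_def ilen_def)

lemma measurable_to_cube:
  "f \<in> measurable M borel \<Longrightarrow> (\<And>x. x \<in> space M \<Longrightarrow> f x \<in> cbox 0 One) \<Longrightarrow> f \<in> measurable M cube_measure"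
  unfolding cube_measure_def by (rule measurable_restrict_space2) auto

lemma measurable_cube_id: "(\<lambda>x. x) \<in> measurable cube_measure borel"
  by (rule borel_measurable_cube) simp

lemma mem_cube_cart: "x \<in> cbox 0 (One :: real ^ 'n) \<longleftrightarrow> (\<forall>i. 0 \<le> x $ i \<and> x $ i \<le> 1)"
  by (simp add: mem_box_cart)

lemma measurable_cube_nth [measurable]:
  "(\<lambda>x. x $ m) \<in> measurable (cube_measure :: (real ^ 'n) measure) cube_measure"
proof (rule measurable_to_cube)
  show "(\<lambda>x. x $ m) \<in> borel_measurable (cube_measure :: (real ^ 'n) measure)"
    by (intro borel_measurable_cube borel_measurable_continuous_onI continuous_intros)
qed (auto simp: mem_cube_cart)

lemma measurable_upd [measurable]:
  "(\<lambda>(x, t). upd x m t) \<in> measurable (cube_measure \<Otimes>\<^sub>M cube_measure) (cube_measure :: (real ^ 'n) measure)"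
proof (rule measurable_to_cube)
  have "continuous_on UNIV (\<lambda>(x, t). upd x m t :: real ^ 'n)"
    unfolding upd_def case_prod_beta
  proof (intro continuous_on_vec_lambda)
    show "continuous_on UNIV (\<lambda>p. if j = m then snd p else fst p $ j :: real)" for j
      by (cases "j = m") (auto intro!: continuous_intros)
  qed
  then have 1: "(\<lambda>(x, t). upd x m t :: real ^ 'n) \<in> borel_measurable (borel \<Otimes>\<^sub>M borel)"
    unfolding borel_prod by (rule borel_measurable_continuous_onI)
  have "(\<lambda>(x, t). (x, t)) \<in> measurable (cube_measure \<Otimes>\<^sub>M cube_measure) ((borel :: (real^'n) measure) \<Otimes>\<^sub>M (borel :: real measure))"
    unfolding case_prod_beta
    by (intro measurable_Pair measurable_compose[OF measurable_fst] measurable_compose[OF measurable_snd] measurable_cube_id)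
  from measurable_compose[OF this 1]
  show "(\<lambda>(x, t). upd x m t :: real ^ 'n) \<in> borel_measurable (cube_measure \<Otimes>\<^sub>M cube_measure)"
    by (simp add: case_prod_beta)
qed (auto simp: space_pair_measure mem_cube_cart)

text \<open>Resampling one coordinate independently keeps the uniform distribution. This yields
  iterated integration in direction \<open>m\<close> without identifying the cube with a product
  over the remaining coordinates: the overwritten coordinate simply integrates to one.\<close>

lemma distr_upd:
  "distr (cube_measure \<Otimes>\<^sub>M cube_measure) cube_measure (\<lambda>(x, t). upd x m t)
     = (cube_measure :: (real ^ 'n) measure)"
proof (rule cube_measure_eqI)
  fix A :: "(real ^ 'n) set" assume A: "A \<in> cube_boxes"
  then obtain a b where Aab: "A = cbox 0 One \<inter> cbox a b" by (auto simp: cube_boxes_def)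
  \<comment> \<open>The side in direction \<open>m\<close> is widened to \<open>[0, 1]\<close>,
    since the old value of that coordinate is discarded.\<close>
  define a' where "a' = upd a m 0"
  define b' where "b' = upd b m 1"
  define l where "l i = ilen (max 0 (a $ i)) (min 1 (b $ i))" for i
  have pre: "(\<lambda>(x, t). upd x m t) -` A \<inter> space (cube_measure \<Otimes>\<^sub>M cube_measure)
     = (cbox 0 One \<inter> cbox a' b') \<times> (cbox 0 1 \<inter> cbox (a $ m) (b $ m))" (is "?L = ?R")
  proof (intro set_eqI iffI)
    fix p assume "p \<in> ?L"
    then show "p \<in> ?R"
      by (cases p) (auto simp: Aab space_pair_measure mem_box_cart a'_def b'_def split: if_splits)
  next
    fix p assume p: "p \<in> ?R"
    obtain x t where pxt: "p = (x, t)" by fastforce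
    have "0 \<le> x $ i" "x $ i \<le> 1" "i \<noteq> m \<Longrightarrow> a $ i \<le> x $ i" "i \<noteq> m \<Longrightarrow> x $ i \<le> b $ i" for i
      using p unfolding pxt a'_def b'_def by (force simp: mem_box_cart split: if_splits)+
    then show "p \<in> ?L"
      using p by (auto simp: pxt Aab space_pair_measure mem_box_cart)
  qed
  have 1: "cbox 0 One \<inter> cbox a' b' \<in> sets (cube_measure :: (real ^ 'n) measure)"
    by (rule cube_boxes_sets) (auto simp: cube_boxes_def)
  have 2: "cbox 0 1 \<inter> cbox (a $ m) (b $ m) \<in> sets (cube_measure :: real measure)"
    using cube_boxes_sets[where 'a = real] by (auto simp: cube_boxes_def)
  have "emeasure (distr (cube_measure \<Otimes>\<^sub>M cube_measure) cube_measure (\<lambda>(x, t). upd x m t)) A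
     = emeasure (cube_measure \<Otimes>\<^sub>M cube_measure)
         ((cbox 0 One \<inter> cbox a' b') \<times> (cbox 0 1 \<inter> cbox (a $ m) (b $ m)))"
    unfolding pre[symmetric] by (rule emeasure_distr[OF measurable_upd cube_boxes_sets[OF A]])
  also have "\<dots> = (\<Prod>i\<in>UNIV. ilen (max 0 (a' $ i)) (min 1 (b' $ i))) * l m"
    using cube.emeasure_pair_measure_Times[OF 1 2]
    by (simp only: emeasure_cube_cbox_cart emeasure_cube_cbox_real l_def)
  also have "(\<Prod>i\<in>UNIV. ilen (max 0 (a' $ i)) (min 1 (b' $ i)))
     = (\<Prod>i\<in>insert m (UNIV - {m}). ilen (max 0 (a' $ i)) (min 1 (b' $ i)))"
    by (simp add: insert_absorb)
  also have "\<dots> = (\<Prod>i\<in>UNIV - {m}. l i)"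
    by (subst prod.insert) (auto simp: a'_def b'_def l_def ilen_def intro!: prod.cong)
  also have "\<dots> * l m = (\<Prod>i\<in>UNIV. l i)"
    by (simp add: prod.remove[of UNIV m] mult.commute)
  also have "\<dots> = emeasure cube_measure A"
    by (simp add: Aab emeasure_cube_cbox_cart l_def)
  finally show "emeasure (distr (cube_measure \<Otimes>\<^sub>M cube_measure) cube_measure (\<lambda>(x, t). upd x m t)) A
     = emeasure cube_measure A" .
qed simp

interpretation cube_pair: pair_sigma_finite
  "cube_measure :: (real ^ 'n) measure" "cube_measure :: real measure" ..

lemma integrable_upd_iff:
  fixes F :: "real ^ 'n \<Rightarrow> real"
  assumes "F \<in> borel_measurable cube_measure"
  shows "integrable (cube_measure \<Otimes>\<^sub>M cube_measure) (\<lambda>p. F (upd (fst p) m (snd p))) \<longleftrightarrow>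
    integrable cube_measure F"
  using integrable_distr_eq[OF measurable_upd assms, of m] by (simp add: distr_upd case_prod_beta)

lemma integral_upd:
  fixes F :: "real ^ 'n \<Rightarrow> real"
  assumes "integrable cube_measure F"
  shows "(\<integral>x. F x \<partial>cube_measure) = (\<integral>x. \<integral>t. F (upd x m t) \<partial>cube_measure \<partial>cube_measure)"
proof -
  have "(\<integral>x. F x \<partial>cube_measure) = (\<integral>p. F (upd (fst p) m (snd p)) \<partial>(cube_measure \<Otimes>\<^sub>M cube_measure))"
    using integral_distr[OF measurable_upd, of F m] assms by (simp add: distr_upd case_prod_beta)
  also have "\<dots> = (\<integral>x. \<integral>t. F (upd x m t) \<partial>cube_measure \<partial>cube_measure)"
    using cube_pair.integral_fst'[of "\<lambda>p. F (upd (fst p) m (snd p))"] assms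
    by (simp add: integrable_upd_iff)
  finally show ?thesis .
qed

text \<open>The induction runs over the set \<open>A\<close> of factors while all functions stay on
  the full cube; a new factor then costs one application of \<open>integral_upd\<close>.\<close>

lemma tensor_product_integral_aux:
  fixes f :: "'n::finite \<Rightarrow> real \<Rightarrow> real"
  assumes f: "\<And>m. integrable cube_measure (f m)"
  shows "integrable cube_measure (\<lambda>x. \<Prod>j\<in>A. f j (x $ j)) \<and>
    (\<integral>x. (\<Prod>j\<in>A. f j (x $ j)) \<partial>cube_measure) = (\<Prod>j\<in>A. \<integral>t. f j t \<partial>cube_measure)"
  using finite[of A]
proof (induction A rule: finite_induct)
  case empty
  have "measure cube_measure (cbox 0 (One :: real ^ 'n)) = 1"
    by (simp add: measure_def emeasure_space_cube)
  then show ?case by simp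
next
  case (insert m A)
  let ?G = "\<lambda>x. \<Prod>j\<in>A. f j (x $ j)" and ?F = "\<lambda>x. \<Prod>j\<in>insert m A. f j (x $ j)"
  have meas [measurable]: "(\<lambda>x. f j (x $ j)) \<in> borel_measurable cube_measure" for j
    using f by (intro measurable_compose[OF measurable_cube_nth]) auto
  have F: "?F (upd x m t) = ?G x * f m t" for x t
    using insert.hyps by (simp add: mult.commute) (intro disjI2 prod.cong, auto)
  have F_meas: "?F \<in> borel_measurable cube_measure" by measurable
  have "integrable (cube_measure \<Otimes>\<^sub>M cube_measure) (\<lambda>p. ?G (fst p) * f m (snd p))"
  proof (rule cube_pair.Fubini_integrable)
    show "(\<lambda>p. ?G (fst p) * f m (snd p)) \<in> borel_measurable (cube_measure \<Otimes>\<^sub>M cube_measure)"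
      using f by measurable
    show "integrable cube_measure (\<lambda>x. \<integral>t. norm (?G (fst (x, t)) * f m (snd (x, t))) \<partial>cube_measure)"
      using insert.IH f by (simp add: abs_mult)
    show "AE x in cube_measure. integrable cube_measure (\<lambda>t. ?G (fst (x, t)) * f m (snd (x, t)))"
      using f by simp
  qed
  then have int: "integrable cube_measure ?F"
    using integrable_upd_iff[OF F_meas, of m] unfolding F by simp
  have "(\<integral>x. ?F x \<partial>cube_measure) = (\<integral>x. \<integral>t. ?G x * f m t \<partial>cube_measure \<partial>cube_measure)"
    by (subst integral_upd[OF int, of m]) (simp only: F)
  also have "\<dots> = (\<integral>x. ?G x \<partial>cube_measure) * (\<integral>t. f m t \<partial>cube_measure)" by simp
  also have "\<dots> = (\<Prod>j\<in>insert m A. \<integral>t. f j t \<partial>cube_measure)"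
    using insert by simp
  finally show ?case using int by blast
qed

lemma integrable_tensor_fun:
  "(\<And>m. integrable cube_measure (f m)) \<Longrightarrow> integrable cube_measure (tensor_fun f)"
  using tensor_product_integral_aux[of f UNIV] unfolding tensor_fun_def by blast

lemma integral_tensor_fun:
  "(\<And>m. integrable cube_measure (f m)) \<Longrightarrow>
    (\<integral>x. tensor_fun f x \<partial>cube_measure) = (\<Prod>m\<in>UNIV. \<integral>t. f m t \<partial>cube_measure)"
  using tensor_product_integral_aux[of f UNIV] unfolding tensor_fun_def by blast

lemma L2_tensor_fun:
  assumes "\<And>m. f m \<in> L2"
  shows "tensor_fun f \<in> L2"
proof (rule L2_I)
  show "tensor_fun f \<in> borel_measurable cube_measure"
    unfolding tensor_fun_def
    by (intro borel_measurable_prod measurable_compose[OF measurable_cube_nth] L2_measurable assms)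
  have "(\<lambda>x. (tensor_fun f x)\<^sup>2) = tensor_fun (\<lambda>m t. (f m t)\<^sup>2)"
    by (auto simp: tensor_fun_def prod_power_distrib)
  then show "integrable cube_measure (\<lambda>x. (tensor_fun f x)\<^sup>2)"
    by (simp add: integrable_tensor_fun L2_integrable_square assms)
qed

lemma ip_tensor_fun:
  assumes "\<And>m. f m \<in> L2" "\<And>m. g m \<in> L2"
  shows "ip (tensor_fun f) (tensor_fun g) = (\<Prod>m\<in>UNIV. ip (f m) (g m))"
proof -
  have "(\<lambda>x. tensor_fun f x * tensor_fun g x) = tensor_fun (\<lambda>m t. f m t * g m t)"
    by (auto simp: tensor_fun_def prod.distrib)
  then show ?thesis
    by (simp add: ip_def integral_tensor_fun L2_integrable_mult assms)
qed

lemma L2_norm_tensor_fun: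
  assumes "\<And>m. f m \<in> L2"
  shows "L2_norm (tensor_fun f) = (\<Prod>m\<in>UNIV. L2_norm (f m))"
proof -
  have "sqrt (\<Prod>m\<in>A. g m) = (\<Prod>m\<in>A. sqrt (g m))" for g :: "'n \<Rightarrow> real" and A
    by (induction A rule: infinite_finite_induct) (auto simp: real_sqrt_mult)
  then show ?thesis by (simp add: L2_norm_ip ip_tensor_fun[OF assms assms])
qed

lemma tensor_fun_split:
  fixes f :: "'n::finite \<Rightarrow> real \<Rightarrow> real"
  shows "tensor_fun f x = f m (x $ m) * (\<Prod>j\<in>UNIV - {m}. f j (x $ j))"
  unfolding tensor_fun_def by (rule prod.remove) auto

lemma tensor_fun_update:
  fixes f :: "'n::finite \<Rightarrow> real \<Rightarrow> real"
  shows "tensor_fun (f(m := h)) x = h (x $ m) * (\<Prod>j\<in>UNIV - {m}. f j (x $ j))"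
  by (subst tensor_fun_split[of _ _ m]) (auto intro!: prod.cong)

lemma tensor_fun_update_add:
  "tensor_fun (f(m := (\<lambda>t. g t + h t))) x = tensor_fun (f(m := g)) x + tensor_fun (f(m := h)) x"
  by (simp add: tensor_fun_update distrib_right)

lemma tensor_fun_update_cmult:
  "tensor_fun (f(m := (\<lambda>t. c * g t))) x = c * tensor_fun (f(m := g)) x"
  by (simp add: tensor_fun_update)

text \<open>Indicators of boxes are themselves tensor products.\<close>

lemma L2_eq_0_if_orthogonal_tensors:
  fixes f :: "real ^ 'n \<Rightarrow> real"
  assumes f: "f \<in> L2" and orth: "\<And>w. (\<And>m. w m \<in> L2) \<Longrightarrow> ip f (tensor_fun w) = 0"
  shows "L2_eq f (\<lambda>x. 0)"
proof (rule L2_eq_0_if_orthogonal_boxes[OF f])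
  fix a b :: "real ^ 'n"
  have "indicator (cbox a b) = tensor_fun (\<lambda>m. indicator (cbox (a $ m) (b $ m)) :: real \<Rightarrow> real)"
    by (auto simp: tensor_fun_def indicator_def mem_box_cart)
  moreover have "indicator (cbox (a $ m) (b $ m)) \<in> (L2 :: (real \<Rightarrow> real) set)" for m
    by (rule L2_bounded[of _ 1]) (auto intro!: borel_measurable_cube simp: indicator_def)
  ultimately show "ip f (indicator (cbox a b)) = 0" using orth by simp
qed


section \<open>Test functions\<close>

text \<open>The recursion differentiates first and then asks for one order less, so closure under
  products or affine substitutions follows by induction on the order, for all functions at
  once.\<close>

fun k_smooth :: "nat \<Rightarrow> ('a::euclidean_space \<Rightarrow> real) \<Rightarrow> bool" where
  "k_smooth 0 f \<longleftrightarrow> True"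
| "k_smooth (Suc n) f \<longleftrightarrow> (\<forall>x. f differentiable (at x)) \<and> (\<forall>b\<in>Basis. k_smooth n (partial b f))"

lemma smooth_fun_differentiable: "smooth_fun f \<Longrightarrow> f differentiable (at x)"
  unfolding smooth_fun_def by (drule bspec[of _ _ "[]"]) auto

lemma smooth_fun_partial: "smooth_fun f \<Longrightarrow> b \<in> Basis \<Longrightarrow> smooth_fun (partial b f)"
  unfolding smooth_fun_def
proof (intro ballI)
  fix bs :: "'a list" assume s: "\<forall>bs\<in>lists Basis. \<forall>x. foldr partial bs f differentiable at x"
    and "b \<in> Basis" "bs \<in> lists Basis"
  then have "bs @ [b] \<in> lists Basis" by simp
  from bspec[OF s this] show "\<forall>x. foldr partial bs (partial b f) differentiable at x" by simp
qed

lemma smooth_fun_iff_k_smooth: "smooth_fun f \<longleftrightarrow> (\<forall>n. k_smooth n f)"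
proof
  assume "smooth_fun f"
  then have "k_smooth n f" for n
    by (induction n arbitrary: f) (auto intro: smooth_fun_differentiable smooth_fun_partial)
  then show "\<forall>n. k_smooth n f" by blast
next
  assume a: "\<forall>n. k_smooth n f"
  have "foldr partial bs f differentiable (at x)"
    if "k_smooth (Suc (length bs)) f" "bs \<in> lists Basis" for bs x
    using that by (induction bs arbitrary: f rule: rev_induct) auto
  then show "smooth_fun f" using a unfolding smooth_fun_def by blast
qed

lemma partial_eqI: "(f has_derivative f') (at x) \<Longrightarrow> partial b f x = f' b"
  unfolding partial_def using frechet_derivative_at by metis

lemma has_derivative_partial:
  "f differentiable (at x) \<Longrightarrow> (f has_derivative frechet_derivative f (at x)) (at x)"
  by (simp add: frechet_derivative_works)

lemma partial_add:
  "f differentiable (at x) \<Longrightarrow> g differentiable (at x) \<Longrightarrow>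
    partial b (\<lambda>x. f x + g x) x = partial b f x + partial b g x"
  by (subst partial_eqI[OF has_derivative_add[OF has_derivative_partial has_derivative_partial]])
    (auto simp: partial_def)

lemma partial_mult:
  assumes "f differentiable (at x)" "g differentiable (at x)"
  shows "partial b (\<lambda>x. f x * g x) x = f x * partial b g x + partial b f x * g x"
  by (subst partial_eqI[OF has_derivative_mult[OF has_derivative_partial[OF assms(1)] has_derivative_partial[OF assms(2)]]])
    (auto simp: partial_def)

lemma partial_const [simp]: "partial b (\<lambda>x. c) x = 0"
  by (rule partial_eqI[OF has_derivative_const])

lemma k_smooth_antimono: "k_smooth (Suc n) f \<Longrightarrow> k_smooth n f"
  by (induction n arbitrary: f) auto

lemma k_smooth_const: "k_smooth n (\<lambda>x. c)"
proof (induction n arbitrary: c)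
  case (Suc n)
  have "partial b (\<lambda>x. c) = (\<lambda>x. 0)" for b :: 'a by auto
  with Suc show ?case by simp
qed simp

lemma k_smooth_add: "k_smooth n f \<Longrightarrow> k_smooth n g \<Longrightarrow> k_smooth n (\<lambda>x. f x + g x)"
proof (induction n arbitrary: f g)
  case (Suc n)
  then have "partial b (\<lambda>x. f x + g x) = (\<lambda>x. partial b f x + partial b g x)" for b
    by (auto simp: partial_add)
  with Suc show ?case by auto
qed simp

lemma k_smooth_mult: "k_smooth n f \<Longrightarrow> k_smooth n g \<Longrightarrow> k_smooth n (\<lambda>x. f x * g x)"
proof (induction n arbitrary: f g)
  case (Suc n)
  then have "partial b (\<lambda>x. f x * g x) = (\<lambda>x. f x * partial b g x + partial b f x * g x)" for b
    by (auto simp: partial_mult)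
  moreover have "k_smooth n f" "k_smooth n g" using Suc.prems k_smooth_antimono by blast+
  ultimately show ?case using Suc by (auto intro!: k_smooth_add)
qed simp

lemma k_smooth_prod: "(\<And>i. i \<in> I \<Longrightarrow> k_smooth n (f i)) \<Longrightarrow> k_smooth n (\<lambda>x. \<Prod>i\<in>I. f i x)"
  by (induction I rule: infinite_finite_induct) (auto intro: k_smooth_const k_smooth_mult)

lemma differentiable_affine:
  fixes L :: "'a::euclidean_space \<Rightarrow> 'b::euclidean_space"
  assumes "linear L" "f differentiable (at (L x + d))"
  shows "((\<lambda>x. f (L x + d)) has_derivative (\<lambda>h. frechet_derivative f (at (L x + d)) (L h))) (at x)"
proof -
  have "((\<lambda>x. L x + d) has_derivative L) (at x)"
    using assms(1) by (auto intro!: derivative_eq_intros linear_imp_has_derivative)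
  from has_derivative_compose[OF this has_derivative_partial[OF assms(2)]] show ?thesis .
qed

lemma partial_affine:
  fixes L :: "'a::euclidean_space \<Rightarrow> 'b::euclidean_space"
  assumes "linear L" "f differentiable (at (L x + d))" "L b = c *\<^sub>R b'"
  shows "partial b (\<lambda>x. f (L x + d)) x = c * partial b' f (L x + d)"
proof -
  have "linear (frechet_derivative f (at (L x + d)))"
    using assms(2) by (rule linear_frechet_derivative)
  then show ?thesis
    by (subst partial_eqI[OF differentiable_affine[OF assms(1,2)]])
      (simp add: assms(3) linear_scale partial_def)
qed

text \<open>The hypothesis on \<open>L\<close> holds for coordinate projections, for the inclusion of a coordinate
  line and for one-dimensional scalings.\<close>

lemma k_smooth_affine:
  fixes L :: "'a::euclidean_space \<Rightarrow> 'b::euclidean_space"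
  assumes "linear L" "\<forall>b\<in>Basis. \<exists>c. \<exists>b'\<in>Basis. L b = c *\<^sub>R b'"
  shows "k_smooth n f \<Longrightarrow> k_smooth n (\<lambda>x. f (L x + d))"
proof (induction n arbitrary: f)
  case (Suc n)
  have "k_smooth n (partial b (\<lambda>x. f (L x + d)))" if b: "b \<in> Basis" for b
  proof -
    obtain c b' where c: "b' \<in> Basis" "L b = c *\<^sub>R b'" using assms(2) b by blast
    have "partial b (\<lambda>x. f (L x + d)) = (\<lambda>x. c * partial b' f (L x + d))"
      using Suc.prems by (intro ext partial_affine assms(1) c) auto
    moreover have "k_smooth n (\<lambda>x. partial b' f (L x + d))"
      using Suc c by auto
    ultimately show ?thesis by (auto intro: k_smooth_mult k_smooth_const)
  qed
  moreover have "(\<lambda>x. f (L x + d)) differentiable (at x)" for x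
  proof -
    have "f differentiable (at (L x + d))" using Suc.prems by simp
    from differentiable_affine[OF assms(1) this] show ?thesis by (rule differentiableI)
  qed
  ultimately show ?case by simp
qed simp

section \<open>Derivatives on the line and an explicit flat function\<close>

lemma partial_real_eqI: "(f has_real_derivative D) (at x) \<Longrightarrow> partial 1 f x = D"
  using partial_eqI[of f "\<lambda>h. h * D" x 1] by (simp add: has_field_derivative_def mult_commute_abs)

lemma has_real_derivative_partial:
  fixes f :: "real \<Rightarrow> real"
  assumes "f differentiable (at x)"
  shows "(f has_real_derivative partial 1 f x) (at x)"
proof -
  obtain D where "(f has_real_derivative D) (at x)"
    using assms by (auto simp: real_differentiable_def)
  with partial_real_eqI show ?thesis by blast
qed

text \<open>The polynomial in \<open>1 / x\<close> makes the family closed under differentiation;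
  \<open>q = 1\<close> is the classical smooth function that is flat at zero.\<close>

definition exp_bump :: "real poly \<Rightarrow> real \<Rightarrow> real" where
  "exp_bump q x = (if 0 < x then poly q (1 / x) * exp (- (1 / x)) else 0)"

lemma poly_times_exp_minus_tendsto_0:
  "((\<lambda>y::real. poly q y * exp (- y)) \<longlongrightarrow> 0) at_top"
proof -
  have "((\<lambda>y::real. \<Sum>i\<le>degree q. coeff q i * (y ^ i / exp y)) \<longlongrightarrow> (\<Sum>i\<le>degree q. coeff q i * 0)) at_top"
    by (intro tendsto_intros tendsto_power_div_exp_0)
  then show ?thesis
    by (simp add: poly_altdef exp_minus sum_distrib_right divide_inverse mult.assoc)
qed

text \<open>With \<open>y = 1 / x\<close>, the derivative of \<open>poly q y * exp (- y)\<close>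
  with respect to \<open>x\<close> is \<open>y\<^sup>2 * poly (q - pderiv q) y * exp (- y)\<close>;
  the factor \<open>[:0, 0, 1:]\<close> is this square.\<close>

lemma exp_bump_has_derivative:
  "(exp_bump q has_real_derivative exp_bump ([:0, 0, 1:] * (q - pderiv q)) x) (at x)"
proof -
  consider "0 < x" | "x < 0" | "x = 0" by linarith
  then show ?thesis
  proof cases
    case 1
    have "((\<lambda>x. poly q (1 / x) * exp (- (1 / x))) has_real_derivative
        exp_bump ([:0, 0, 1:] * (q - pderiv q)) x) (at x)"
      using 1 unfolding exp_bump_def
      by (auto intro!: derivative_eq_intros DERIV_chain'[OF _ poly_DERIV] simp: field_simps power2_eq_square)
    then show ?thesis
      by (rule has_field_derivative_transform_within_open[of _ _ _ "{0<..}"]) (auto simp: 1 exp_bump_def)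
  next
    case 2
    have "((\<lambda>x. 0) has_real_derivative 0) (at x)" by simp
    then have "(exp_bump q has_real_derivative 0) (at x)"
      by (rule has_field_derivative_transform_within_open[of _ _ _ "{..<0}"]) (auto simp: 2 exp_bump_def)
    then show ?thesis using 2 by (simp add: exp_bump_def)
  next
    case 3
    have "((\<lambda>h. exp_bump q h / h) \<longlongrightarrow> 0) (at_left 0)"
      by (rule tendsto_eventually) (auto simp: exp_bump_def eventually_at_filter)
    \<comment> \<open>The difference quotient at zero is of the same kind, with \<open>q\<close>
      multiplied by its variable \<open>1 / h\<close>, and the exponential decay wins.\<close>
    moreover have "((\<lambda>h. exp_bump q h / h) \<longlongrightarrow> 0) (at_right 0)"
    proof (rule Lim_transform_eventually)
      show "((\<lambda>h. poly (pCons 0 q) (inverse h) * exp (- inverse h)) \<longlongrightarrow> 0) (at_right (0::real))"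
        by (rule filterlim_compose[OF poly_times_exp_minus_tendsto_0 filterlim_inverse_at_top_right])
      show "\<forall>\<^sub>F h in at_right 0. poly (pCons 0 q) (inverse h) * exp (- inverse h) = exp_bump q h / h"
        by (auto simp: eventually_at_filter exp_bump_def field_simps)
    qed
    ultimately have "((\<lambda>h. exp_bump q h / h) \<longlongrightarrow> 0) (at 0)"
      by (simp add: filterlim_at_split)
    then show ?thesis using 3 by (simp add: has_field_derivative_iff exp_bump_def)
  qed
qed

lemma k_smooth_exp_bump: "k_smooth n (exp_bump q)"
proof (induction n arbitrary: q)
  case (Suc n)
  have "partial 1 (exp_bump q) = exp_bump ([:0, 0, 1:] * (q - pderiv q))"
    using partial_real_eqI[OF exp_bump_has_derivative] by (rule ext)
  moreover have "exp_bump q differentiable (at x)" for x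
    using exp_bump_has_derivative real_differentiable_def by blast
  ultimately show ?case using Suc by simp
qed simp

section \<open>Closure properties of test functions\<close>

lemma test_funs_differentiable: "\<phi> \<in> test_funs \<Longrightarrow> \<phi> differentiable (at x)"
  by (auto simp: test_funs_def smooth_fun_differentiable)

lemma test_funs_continuous: "\<phi> \<in> test_funs \<Longrightarrow> continuous_on S \<phi>"
  by (intro continuous_at_imp_continuous_on ballI differentiable_imp_continuous_within
      test_funs_differentiable)

lemma test_funs_L2: "\<phi> \<in> test_funs \<Longrightarrow> \<phi> \<in> L2"
proof -
  assume \<phi>: "\<phi> \<in> test_funs"
  have "compact (\<phi> ` cbox 0 One)"
    by (intro compact_continuous_image test_funs_continuous \<phi> compact_cbox)
  then obtain C where "\<forall>x\<in>cbox 0 One. norm (\<phi> x) \<le> C"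
    using compact_imp_bounded[of "\<phi> ` cbox 0 One"] by (auto simp: bounded_iff)
  then show "\<phi> \<in> L2"
    by (intro L2_bounded[of _ C] borel_measurable_cube borel_measurable_continuous_onI
        test_funs_continuous \<phi>) auto
qed

lemma test_funs_I:
  assumes "\<And>n. k_smooth n \<phi>" "closed K" "\<And>x. \<phi> x \<noteq> 0 \<Longrightarrow> x \<in> K" "K \<subseteq> box 0 One"
  shows "\<phi> \<in> test_funs"
proof -
  have "closure {x. \<phi> x \<noteq> 0} \<subseteq> K" using assms(2,3) by (intro closure_minimal) auto
  then show ?thesis using assms by (auto simp: test_funs_def smooth_fun_iff_k_smooth)
qed

lemma test_funs_support:
  "\<phi> \<in> test_funs \<Longrightarrow> \<exists>K. closed K \<and> (\<forall>x. \<phi> x \<noteq> 0 \<longrightarrow> x \<in> K) \<and> K \<subseteq> box 0 One"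
  by (intro exI[of _ "closure {x. \<phi> x \<noteq> 0}"])
    (auto simp: test_funs_def intro: closure_subset[THEN subsetD])

lemma test_funs_k_smooth: "\<phi> \<in> test_funs \<Longrightarrow> k_smooth n \<phi>"
  by (simp add: test_funs_def smooth_fun_iff_k_smooth)

lemma test_funs_partial:
  assumes "\<phi> \<in> test_funs" "b \<in> Basis"
  shows "partial b \<phi> \<in> test_funs"
proof -
  obtain K where K: "closed K" "\<And>x. \<phi> x \<noteq> 0 \<Longrightarrow> x \<in> K" "K \<subseteq> box 0 One"
    using test_funs_support[OF assms(1)] by blast
  show ?thesis
  proof (rule test_funs_I[OF _ K(1) _ K(3)])
    show "k_smooth n (partial b \<phi>)" for n
      using test_funs_k_smooth[OF assms(1), of "Suc n"] assms(2) by simp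
    fix x assume "partial b \<phi> x \<noteq> 0"
    show "x \<in> K"
    proof (rule ccontr)
      assume "x \<notin> K"
      have "((\<lambda>x. 0) has_derivative (\<lambda>h. 0)) (at x)" by simp
      then have "(\<phi> has_derivative (\<lambda>h. 0)) (at x)"
        by (rule has_derivative_transform_within_open[of _ _ _ _ "- K"])
          (use K(1,2) \<open>x \<notin> K\<close> in auto)
      from partial_eqI[OF this] show False using \<open>partial b \<phi> x \<noteq> 0\<close> by simp
    qed
  qed
qed

lemma test_funs_add:
  assumes "\<phi> \<in> test_funs" "\<psi> \<in> test_funs"
  shows "(\<lambda>x. \<phi> x + \<psi> x) \<in> test_funs"
proof -
  obtain K where K: "closed K" "\<And>x. \<phi> x \<noteq> 0 \<Longrightarrow> x \<in> K" "K \<subseteq> box 0 One"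
    using test_funs_support[OF assms(1)] by blast
  obtain K' where K': "closed K'" "\<And>x. \<psi> x \<noteq> 0 \<Longrightarrow> x \<in> K'" "K' \<subseteq> box 0 One"
    using test_funs_support[OF assms(2)] by blast
  show ?thesis
  proof (rule test_funs_I)
    show "k_smooth n (\<lambda>x. \<phi> x + \<psi> x)" for n
      by (intro k_smooth_add test_funs_k_smooth assms)
    show "closed (K \<union> K')" by (rule closed_Un[OF K(1) K'(1)])
    show "x \<in> K \<union> K'" if "\<phi> x + \<psi> x \<noteq> 0" for x
      using that K(2)[of x] K'(2)[of x] by force
  qed (use K(3) K'(3) in auto)
qed

lemma test_funs_cmult:
  assumes "\<phi> \<in> test_funs"
  shows "(\<lambda>x. c * \<phi> x) \<in> test_funs"
proof -
  obtain K where K: "closed K" "\<And>x. \<phi> x \<noteq> 0 \<Longrightarrow> x \<in> K" "K \<subseteq> box 0 One"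
    using test_funs_support[OF assms(1)] by blast
  show ?thesis
  proof (rule test_funs_I[OF _ K(1) _ K(3)])
    show "k_smooth n (\<lambda>x. c * \<phi> x)" for n
      by (intro k_smooth_mult k_smooth_const test_funs_k_smooth assms)
  qed (use K(2) in auto)
qed

lemma Basis_cart_cases: "b \<in> (Basis :: (real ^ 'n) set) \<Longrightarrow> (\<And>j. b = axis j 1 \<Longrightarrow> P) \<Longrightarrow> P"
  by (auto simp: Basis_vec_def)

lemma axis_Basis [simp]: "axis j 1 \<in> (Basis :: (real ^ 'n) set)"
  by (auto simp: Basis_vec_def)

lemma linear_nth: "linear (\<lambda>x :: real ^ 'n. x $ m)"
  by (rule linearI) auto

lemma upd_eq_affine: "upd x m t = t *\<^sub>R axis m 1 + upd x m 0"
  by (auto simp: vec_eq_iff axis_def)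

lemma mem_box_cube_cart: "x \<in> box 0 (One :: real ^ 'n) \<longleftrightarrow> (\<forall>i. 0 < x $ i \<and> x $ i < 1)"
  by (simp add: mem_box_cart)

lemma test_funs_tensor_fun:
  fixes \<psi> :: "'n::finite \<Rightarrow> real \<Rightarrow> real"
  assumes "\<And>m. \<psi> m \<in> test_funs"
  shows "tensor_fun \<psi> \<in> test_funs"
proof -
  obtain K where K: "\<And>m. closed (K m)" "\<And>m x. \<psi> m x \<noteq> 0 \<Longrightarrow> x \<in> K m" "\<And>m. K m \<subseteq> box 0 One"
    using test_funs_support[OF assms] by metis
  show ?thesis
  proof (rule test_funs_I)
    have "k_smooth n (\<lambda>x. \<psi> m (x $ m + 0))" for m n
    proof (rule k_smooth_affine[OF linear_nth])
      show "\<forall>b\<in>(Basis :: (real ^ 'n) set). \<exists>c. \<exists>b'\<in>Basis. b $ m = c *\<^sub>R b'"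
        by (auto simp: Basis_vec_def)
    qed (rule test_funs_k_smooth[OF assms])
    then show "k_smooth n (tensor_fun \<psi>)" for n
      unfolding tensor_fun_def by (auto intro: k_smooth_prod)
    show "closed (\<Inter>m. (\<lambda>x. x $ m) -` K m)"
      by (intro closed_INT ballI continuous_closed_vimage K(1) continuous_intros)
    show "x \<in> (\<Inter>m. (\<lambda>x. x $ m) -` K m)" if "tensor_fun \<psi> x \<noteq> 0" for x
      using that K(2) by (auto simp: tensor_fun_def)
    show "(\<Inter>m. (\<lambda>x. x $ m) -` K m) \<subseteq> box 0 One"
      using K(3) by (fastforce simp: mem_box_cube_cart)
  qed
qed

lemma partial_tensor_fun:
  fixes \<psi> :: "'n::finite \<Rightarrow> real \<Rightarrow> real"
  assumes "\<And>m. \<psi> m \<in> test_funs"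
  shows "partial (axis m 1) (tensor_fun \<psi>) = tensor_fun (\<psi>(m := partial 1 (\<psi> m)))"
proof
  fix x :: "real ^ 'n"
  have d: "\<psi> j differentiable at (x $ j)" for j
    by (rule test_funs_differentiable[OF assms])
  have "((\<lambda>x. \<psi> j (x $ j)) has_derivative (\<lambda>h. h $ j * partial 1 (\<psi> j) (x $ j))) (at x)" for j
  proof -
    have "((\<lambda>x. x $ j) has_derivative (\<lambda>h. h $ j)) (at x)"
      by (rule linear_imp_has_derivative[OF linear_nth])
    then show ?thesis
      using has_derivative_compose[of "\<lambda>x. x $ j" "\<lambda>h. h $ j" x UNIV "\<psi> j" "\<lambda>h. h * partial 1 (\<psi> j) (x $ j)"]
        has_real_derivative_partial[OF d] by (simp add: has_field_derivative_def mult_commute_abs)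
  qed
  from has_derivative_prod[of UNIV "\<lambda>j x. \<psi> j (x $ j)", OF this]
  have "(tensor_fun \<psi> has_derivative
     (\<lambda>h. \<Sum>j\<in>UNIV. h $ j * partial 1 (\<psi> j) (x $ j) * (\<Prod>i\<in>UNIV - {j}. \<psi> i (x $ i)))) (at x)"
    unfolding tensor_fun_def .
  from partial_eqI[OF this, of "axis m 1"]
  have "partial (axis m 1) (tensor_fun \<psi>) x
      = (\<Sum>j\<in>UNIV. axis m 1 $ j * partial 1 (\<psi> j) (x $ j) * (\<Prod>i\<in>UNIV - {j}. \<psi> i (x $ i)))" .
  also have "\<dots> = (\<Sum>j\<in>UNIV. if j = m then partial 1 (\<psi> m) (x $ m) * (\<Prod>i\<in>UNIV - {m}. \<psi> i (x $ i)) else 0)"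
    by (rule sum.cong) (auto simp: axis_def)
  finally show "partial (axis m 1) (tensor_fun \<psi>) x = tensor_fun (\<psi>(m := partial 1 (\<psi> m))) x"
    by (simp add: tensor_fun_update)
qed

lemma test_funs_slice:
  fixes \<phi> :: "real ^ 'n \<Rightarrow> real"
  assumes \<phi>: "\<phi> \<in> test_funs"
  shows "(\<lambda>t. \<phi> (upd x m t)) \<in> test_funs"
    and "partial 1 (\<lambda>t. \<phi> (upd x m t)) t = partial (axis m 1) \<phi> (upd x m t)"
proof -
  let ?L = "\<lambda>t::real. t *\<^sub>R (axis m 1 :: real ^ 'n)"
  have L: "linear ?L" by (rule linearI) (auto simp: algebra_simps)
  have line: "(\<lambda>t. \<phi> (upd x m t)) = (\<lambda>t. \<phi> (?L t + upd x m 0))"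
    using upd_eq_affine[of x m] by metis
  obtain K where K: "closed K" "\<And>x. \<phi> x \<noteq> 0 \<Longrightarrow> x \<in> K" "K \<subseteq> box 0 One"
    using test_funs_support[OF \<phi>] by blast
  show "(\<lambda>t. \<phi> (upd x m t)) \<in> test_funs"
  proof (rule test_funs_I)
    show "k_smooth n (\<lambda>t. \<phi> (upd x m t))" for n
      unfolding line
      by (rule k_smooth_affine[OF L _ test_funs_k_smooth[OF \<phi>]]) (auto intro!: exI[of _ 1])
    have "continuous_on UNIV (\<lambda>t. ?L t + upd x m 0)" by (intro continuous_intros)
    then have "continuous_on UNIV (\<lambda>t. upd x m t)"
      by (rule continuous_on_eq) (rule upd_eq_affine[symmetric])
    then show "closed ((\<lambda>t. upd x m t) -` K)"
      using K(1) by (simp add: continuous_on_closed_vimage)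
    show "t \<in> (\<lambda>t. upd x m t) -` K" if "\<phi> (upd x m t) \<noteq> 0" for t
      using that K(2) by simp
    show "(\<lambda>t. upd x m t) -` K \<subseteq> box 0 One"
      using K(3) by (force simp: mem_box_cube_cart split: if_splits)
  qed
  show "partial 1 (\<lambda>t. \<phi> (upd x m t)) t = partial (axis m 1) \<phi> (upd x m t)"
    using partial_affine[OF L test_funs_differentiable[OF \<phi>],
        where x = t and d = "upd x m 0" and b = 1 and c = 1 and b' = "axis m 1"]
    unfolding line upd_eq_affine[of x m t] by simp
qed

text \<open>With the other coordinates fixed, \<open>\<phi>\<close> is a test function of the
  coordinate \<open>m\<close>, so the weak derivative of \<open>f m\<close> applies inside the
  iterated integral. It matters that \<open>\<phi>\<close> need not be a product: this is how
  interpolants are differentiated against all test functions.\<close>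

lemma weak_deriv_tensor_fun:
  fixes f :: "'n::finite \<Rightarrow> real \<Rightarrow> real" and m :: 'n
  assumes f: "\<And>j. f j \<in> L2" and g: "g \<in> L2" "weak_deriv (f m) g" and \<phi>: "\<phi> \<in> test_funs"
  shows "ip (tensor_fun f) (partial (axis m 1) \<phi>) = - ip (tensor_fun (f(m := g))) \<phi>"
proof -
  have fg: "(f(m := g)) j \<in> L2" for j using f g by simp
  have \<phi>': "partial (axis m 1) \<phi> \<in> test_funs" by (rule test_funs_partial[OF \<phi>]) simp
  let ?R = "\<lambda>x :: real ^ 'n. \<Prod>j\<in>UNIV - {m}. f j (x $ j)"
  have R: "?R (upd x m t) = ?R x" for x t by (rule prod.cong) auto
  have "ip (tensor_fun f) (partial (axis m 1) \<phi>)
     = (\<integral>x. \<integral>t. ?R x * (f m t * partial 1 (\<lambda>t. \<phi> (upd x m t)) t) \<partial>cube_measure \<partial>cube_measure)"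
    unfolding ip_def
    by (subst integral_upd[OF L2_integrable_mult[OF L2_tensor_fun[of f, OF f] test_funs_L2[OF \<phi>']], of m])
      (simp add: tensor_fun_split[of f _ m] R test_funs_slice(2)[OF \<phi>] ac_simps)
  also have "\<dots> = (\<integral>x. ?R x * - (\<integral>t. g t * \<phi> (upd x m t) \<partial>cube_measure) \<partial>cube_measure)"
    using g(2) test_funs_slice(1)[OF \<phi>] by (simp add: weak_deriv_def)
  also have "\<dots> = - (\<integral>x. \<integral>t. ?R x * (g t * \<phi> (upd x m t)) \<partial>cube_measure \<partial>cube_measure)"
    by simp
  also have "(\<integral>x. \<integral>t. ?R x * (g t * \<phi> (upd x m t)) \<partial>cube_measure \<partial>cube_measure) = ip (tensor_fun (f(m := g))) \<phi>"
    unfolding ip_def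
    by (subst integral_upd[OF L2_integrable_mult[OF L2_tensor_fun[of "f(m := g)", OF fg] test_funs_L2[OF \<phi>]], of m])
      (simp add: tensor_fun_update R ac_simps)
  finally show ?thesis .
qed

section \<open>Antiderivatives and totality of test functions on the line\<close>

lemma compact_in_unit_interval:
  assumes "closed K" "K \<subseteq> {0<..<1::real}"
  shows "\<exists>a b. 0 < a \<and> a < b \<and> b < 1 \<and> K \<subseteq> {a<..<b}"
proof (cases "K = {}")
  case True
  then show ?thesis by (intro exI[of _ "1/3"] exI[of _ "2/3"]) auto
next
  case False
  have "bounded K" using assms(2) by (intro bounded_subset[OF bounded_closed_interval[of "0::real" 1]]) auto
  then have "compact K" using assms(1) by (simp add: compact_eq_bounded_closed)
  obtain a where a: "a \<in> K" "\<And>x. x \<in> K \<Longrightarrow> a \<le> x" using compact_attains_inf[OF \<open>compact K\<close> False] by blast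
  obtain b where b: "b \<in> K" "\<And>x. x \<in> K \<Longrightarrow> x \<le> b" using compact_attains_sup[OF \<open>compact K\<close> False] by blast
  have "0 < a" "b < 1" "a \<le> b" using a b assms(2) by auto
  then show ?thesis
    using a(2) b(2) by (intro exI[of _ "a/2"] exI[of _ "(1+b)/2"]) force
qed

lemma integral_cube_eq_integral:
  fixes f :: "real \<Rightarrow> real"
  assumes "continuous_on {0..1} f"
  shows "(\<integral>x. f x \<partial>cube_measure) = integral {0..1} f"
proof -
  have int: "set_integrable lborel {0..1} f"
    by (rule borel_integrable_compact[OF compact_Icc assms, folded set_integrable_def]) 
  have "(\<integral>x. f x \<partial>cube_measure) = (LINT x:{0..1}|lborel. f x)"
    unfolding cube_measure_def set_lebesgue_integral_def
    by (subst integral_restrict_space) auto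
  also have "\<dots> = integral {0..1} f"
    by (rule set_borel_integral_eq_integral(2)[OF int])
  finally show ?thesis .
qed

text \<open>The zero mean brings the primitive back to zero on the right of the support, so its
  support is again compact in the open interval.\<close>

lemma test_funs_antiderivative:
  fixes \<theta> :: "real \<Rightarrow> real"
  assumes \<theta>: "\<theta> \<in> test_funs" and zero: "(\<integral>x. \<theta> x \<partial>cube_measure) = 0"
  shows "\<exists>\<psi>\<in>test_funs. partial 1 \<psi> = \<theta>"
proof -
  obtain K where K: "closed K" "\<And>x. \<theta> x \<noteq> 0 \<Longrightarrow> x \<in> K" "K \<subseteq> box 0 One"
    using test_funs_support[OF \<theta>] by blast
  then obtain a b where ab: "0 < a" "a < b" "b < 1" "K \<subseteq> {a<..<b}"
    using compact_in_unit_interval[of K] by auto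
  have vanish: "\<theta> x = 0" if "x \<le> a \<or> b \<le> x" for x
    using that K(2) ab(4) by force
  define \<psi> where "\<psi> x = integral {-1..x} \<theta>" for x
  have cont: "continuous_on S \<theta>" for S by (rule test_funs_continuous[OF \<theta>])
  have int: "\<theta> integrable_on {c..d}" for c d by (rule integrable_continuous_real[OF cont])
  have int_zero: "integral {c..d} \<theta> = 0" if "\<And>x. x \<in> {c..d} \<Longrightarrow> \<theta> x = 0" for c d
    using Henstock_Kurzweil_Integration.integral_cong[of "{c..d}" \<theta> "\<lambda>_. 0"] that by simp
  have left: "\<psi> x = 0" if "x \<le> a" for x
    unfolding \<psi>_def using that by (intro int_zero vanish) auto
  have "integral {-1..0} \<theta> + integral {0..1} \<theta> = integral {-1..1} \<theta>"
    by (rule Henstock_Kurzweil_Integration.integral_combine[OF _ _ int]) auto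
  moreover have "integral {0..1} \<theta> = 0" using integral_cube_eq_integral[OF cont] zero by simp
  ultimately have psi1: "\<psi> 1 = 0" using left[of 0] ab(1) by (simp add: \<psi>_def)
  have right: "\<psi> x = 0" if "b \<le> x" for x
  proof -
    have "\<psi> y = \<psi> b" if "b \<le> y" for y
    proof -
      have "integral {-1..b} \<theta> + integral {b..y} \<theta> = integral {-1..y} \<theta>"
        using ab that by (intro Henstock_Kurzweil_Integration.integral_combine[OF _ _ int]) auto
      moreover have "integral {b..y} \<theta> = 0" by (intro int_zero vanish) auto
      ultimately show ?thesis by (simp add: \<psi>_def)
    qed
    from this[of x] this[of 1] psi1 that ab show ?thesis by simp
  qed
  have deriv: "(\<psi> has_real_derivative \<theta> x) (at x)" for x
  proof (cases "x < a")
    case True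
    have "((\<lambda>x. 0) has_real_derivative 0) (at x)" by simp
    then have "(\<psi> has_real_derivative 0) (at x)"
      by (rule has_field_derivative_transform_within_open[of _ _ _ "{..<a}"]) (auto simp: True left)
    then show ?thesis using True by (simp add: vanish)
  next
    case False
    have "(\<psi> has_real_derivative \<theta> x) (at x within {-1..x+1})"
      unfolding \<psi>_def by (rule integral_has_real_derivative[OF cont]) (use False ab in auto)
    moreover have "at x within {-1..x+1} = at x"
      using False ab by (intro at_within_interior) auto
    ultimately show ?thesis by simp
  qed
  have partial: "partial 1 \<psi> = \<theta>" by (rule ext) (rule partial_real_eqI[OF deriv])
  have "k_smooth n \<psi>" for n
  proof (cases n)
    case (Suc n)
    have "\<psi> differentiable (at x)" for x using deriv real_differentiable_def by blast
    then show ?thesis using test_funs_k_smooth[OF \<theta>] by (simp add: Suc partial)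
  qed simp
  then have "\<psi> \<in> test_funs"
  proof (rule test_funs_I[of _ "{a..b}"])
    show "x \<in> {a..b}" if "\<psi> x \<noteq> 0" for x using left[of x] right[of x] that by force
  qed (use ab in auto)
  then show ?thesis using partial by blast
qed

lemma AE_cube_neq: "AE x in cube_measure. x \<noteq> (c :: real)"
proof -
  have "AE x in lborel. x \<noteq> c" by (rule AE_lborel_singleton)
  then show ?thesis
    unfolding cube_measure_def by (subst AE_restrict_space_iff) (auto elim: eventually_mono)
qed

text \<open>Two facing copies of the flat function, shifted so that the support is inside
  \<open>[c + 1/k, d - 1/k]\<close>. As \<open>k\<close> grows the flanks steepen, while all values
  stay between zero and one.\<close>

definition interval_bump :: "real \<Rightarrow> real \<Rightarrow> nat \<Rightarrow> real \<Rightarrow> real" where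
  "interval_bump c d k x = exp_bump 1 (real k * (x - c) - 1) * exp_bump 1 (real k * (d - x) - 1)"

lemma exp_bump_1_bounds: "0 \<le> exp_bump 1 x" "exp_bump 1 x \<le> 1"
  by (auto simp: exp_bump_def)

lemma interval_bump_test_fun:
  assumes "0 \<le> c" "d \<le> 1" "0 < k"
  shows "interval_bump c d k \<in> test_funs"
proof (rule test_funs_I)
  have "k_smooth n (\<lambda>x. exp_bump 1 (a * x + b))" for n a b
    by (rule k_smooth_affine[OF _ _ k_smooth_exp_bump]) (auto intro: linear_times)
  from k_smooth_mult[OF this[of _ "real k" "- real k * c - 1"] this[of _ "- real k" "real k * d - 1"]]
  show "k_smooth n (interval_bump c d k)" for n
    unfolding interval_bump_def by (simp add: algebra_simps)
  show "closed {c + 1 / real k..d - 1 / real k}" by simp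
  show "x \<in> {c + 1 / real k..d - 1 / real k}" if "interval_bump c d k x \<noteq> 0" for x
    using that assms(3) by (auto simp: interval_bump_def exp_bump_def field_simps split: if_splits)
  show "{c + 1 / real k..d - 1 / real k} \<subseteq> box 0 One"
  proof
    fix x assume x: "x \<in> {c + 1 / real k..d - 1 / real k}"
    have "0 < 1 / real k" using assms(3) by simp
    then have "0 < x" "x < 1" using x assms unfolding atLeastAtMost_iff by linarith+
    then show "x \<in> box 0 One" by simp
  qed
qed

lemma exp_bump_tendsto:
  assumes "0 < t"
  shows "(\<lambda>k. exp_bump 1 (real k * t - 1)) \<longlonglongrightarrow> 1"
proof -
  have lim: "filterlim (\<lambda>k. real k * t - 1) at_top sequentially"
    using assms by real_asymp
  have "(\<lambda>k. exp (- (1 / (real k * t - 1)))) \<longlonglongrightarrow> 1"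
    using assms by real_asymp
  moreover have "\<forall>\<^sub>F k in sequentially. exp (- (1 / (real k * t - 1))) = exp_bump 1 (real k * t - 1)"
    using filterlim_at_top_dense[THEN iffD1, OF lim, rule_format, of 0]
    by eventually_elim (simp add: exp_bump_def)
  ultimately show ?thesis by (rule Lim_transform_eventually)
qed

lemma interval_bump_tendsto:
  "(\<lambda>k. interval_bump c d k x) \<longlonglongrightarrow> indicator {c<..<d} x"
proof (cases "x \<in> {c<..<d}")
  case True
  then have "(\<lambda>k. interval_bump c d k x) \<longlonglongrightarrow> 1 * 1"
    unfolding interval_bump_def by (intro tendsto_mult exp_bump_tendsto) auto
  then show ?thesis using True by simp
next
  case False
  have "interval_bump c d k x = 0" for k
  proof -
    have "real k * (x - c) \<le> 0 \<or> real k * (d - x) \<le> 0"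
      using False by (auto simp: mult_le_0_iff)
    then show ?thesis by (auto simp: interval_bump_def exp_bump_def)
  qed
  then show ?thesis using False by simp
qed

text \<open>Indicators of intervals are limits of test functions under a common bound. The interval
  is clipped to \<open>[0, 1]\<close> first, because the bumps must be supported there, and its end
  points are null sets.\<close>

lemma L2_eq_0_if_orthogonal_tests:
  fixes f :: "real \<Rightarrow> real"
  assumes f: "f \<in> L2" and orth: "\<And>\<psi>. \<psi> \<in> test_funs \<Longrightarrow> ip f \<psi> = 0"
  shows "L2_eq f (\<lambda>x. 0)"
proof (rule L2_eq_0_if_orthogonal_boxes[OF f])
  fix a b :: real
  define c where "c = max a 0"
  define d where "d = min b 1"
  have cd: "0 \<le> c" "d \<le> 1" by (auto simp: c_def d_def)
  have int: "integrable cube_measure f"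
    using L2_integrable_mult[OF f L2_const[of 1]] by simp
  have meas: "f \<in> borel_measurable cube_measure" by (rule L2_measurable[OF f])
  have meas_b: "interval_bump c d (Suc k) \<in> borel_measurable cube_measure" for k
    by (intro L2_measurable test_funs_L2 interval_bump_test_fun cd) simp
  have meas_i: "indicat_real {c<..<d} \<in> borel_measurable cube_measure"
    by (rule borel_measurable_cube) simp
  have "(\<lambda>k. ip f (interval_bump c d (Suc k))) \<longlonglongrightarrow> ip f (indicator {c<..<d})"
    unfolding ip_def
  proof (rule integral_dominated_convergence)
    show "(\<lambda>x. f x * indicator {c<..<d} x) \<in> borel_measurable cube_measure"
      by (intro borel_measurable_times meas meas_i)
    show "(\<lambda>x. f x * interval_bump c d (Suc k) x) \<in> borel_measurable cube_measure" for k
      by (intro borel_measurable_times meas meas_b)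
    show "integrable cube_measure (\<lambda>x. \<bar>f x\<bar>)" using int by simp
    show "AE x in cube_measure. (\<lambda>k. f x * interval_bump c d (Suc k) x) \<longlonglongrightarrow> f x * indicator {c<..<d} x"
      by (intro AE_I2 tendsto_mult tendsto_const LIMSEQ_Suc interval_bump_tendsto)
    have "\<bar>interval_bump c d k x\<bar> \<le> 1" for k x
      using exp_bump_1_bounds by (simp add: interval_bump_def abs_mult mult_le_one)
    then show "AE x in cube_measure. norm (f x * interval_bump c d (Suc k) x) \<le> \<bar>f x\<bar>" for k
      by (intro AE_I2) (simp add: abs_mult mult_left_le)
  qed
  moreover have "ip f (interval_bump c d (Suc k)) = 0" for k
    by (intro orth interval_bump_test_fun cd) simp
  ultimately have "ip f (indicator {c<..<d}) = 0"
    by (simp add: LIMSEQ_const_iff)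
  moreover have "ip f (indicator {c<..<d}) = ip f (indicator (cbox a b))"
    unfolding ip_def
  proof (rule integral_cong_AE)
    show "(\<lambda>x. f x * indicator {c<..<d} x) \<in> borel_measurable cube_measure"
      by (intro borel_measurable_times meas meas_i)
    show "(\<lambda>x. f x * indicator (cbox a b) x) \<in> borel_measurable cube_measure"
      by (intro borel_measurable_times meas borel_measurable_cube) simp
    show "AE x in cube_measure. f x * indicator {c<..<d} x = f x * indicator (cbox a b) x"
      using AE_cube_neq[of c] AE_cube_neq[of d] AE_space
    proof eventually_elim
      case (elim x)
      then have "x \<in> {c<..<d} \<longleftrightarrow> x \<in> cbox a b" by (auto simp: c_def d_def)
      then show ?case by (simp add: indicator_def)
    qed
  qed
  ultimately show "ip f (indicator (cbox a b)) = 0" by simp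
qed


section \<open>Weak derivatives of one-dimensional functions\<close>

lemma weak_deriv_iff: "weak_deriv f g \<longleftrightarrow> (\<forall>\<phi>\<in>test_funs. ip f (partial 1 \<phi>) = - ip g \<phi>)"
  by (simp add: weak_deriv_def ip_def)

lemma test_funs_deriv: "\<psi> \<in> test_funs \<Longrightarrow> partial 1 \<psi> \<in> (test_funs :: (real \<Rightarrow> real) set)"
  by (rule test_funs_partial) (simp_all add: Basis_real_def)

lemma test_funs_derivs: "\<psi> \<in> test_funs \<Longrightarrow> (partial 1 ^^ j) \<psi> \<in> (test_funs :: (real \<Rightarrow> real) set)"
  by (induction j) (auto intro: test_funs_deriv)

lemma ip_const_1_1: "ip (\<lambda>x::real. 1) (\<lambda>x. 1) = 1"
  by (simp add: ip_def measure_def emeasure_space_cube[where 'a = real, simplified])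

text \<open>If every test function had mean zero, the constant one would be orthogonal to all of
  them and hence vanish.\<close>

lemma test_fun_unit_integral: "\<exists>\<eta>\<in>test_funs. ip (\<lambda>x::real. 1) \<eta> = 1"
proof -
  have "\<not> L2_eq (\<lambda>x::real. 1) (\<lambda>x. 0)"
    using ip_self_eq_0_iff[OF L2_const[of "1::real"], where 'a = real] ip_const_1_1 by simp
  then obtain \<psi> :: "real \<Rightarrow> real" where \<psi>: "\<psi> \<in> test_funs" "ip (\<lambda>x. 1) \<psi> \<noteq> 0"
    using L2_eq_0_if_orthogonal_tests[OF L2_const] by blast
  then show ?thesis
    by (intro bexI[of _ "\<lambda>x. (1 / ip (\<lambda>x. 1) \<psi>) * \<psi> x"] test_funs_cmult)
      (simp_all only: ip_cmult_right, simp)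
qed

text \<open>The primitive that vanishes at zero, written as a pairing so that linearity and the norm
  bound come from \<open>ip\<close>.\<close>

definition volterra :: "(real \<Rightarrow> real) \<Rightarrow> real \<Rightarrow> real" where
  "volterra f x = ip f (indicator {..x})"

lemma indicator_L2: "A \<in> sets borel \<Longrightarrow> indicator A \<in> L2"
  by (rule L2_bounded[of _ 1]) (auto intro!: borel_measurable_cube simp: indicator_def)

lemma volterra_bound:
  assumes "f \<in> L2"
  shows "\<bar>volterra f x\<bar> \<le> L2_norm f"
proof -
  have i: "indicat_real {..x} \<in> L2" by (rule indicator_L2) simp
  have "ip (indicat_real {..x}) (indicat_real {..x}) \<le> ip (\<lambda>x::real. 1) (\<lambda>x. 1)"
    unfolding ip_def
  proof (rule Bochner_Integration.integral_mono)
    show "integrable cube_measure (\<lambda>y. indicat_real {..x} y * indicat_real {..x} y)"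
      by (rule L2_integrable_mult[OF i i])
  qed (auto simp: indicator_def)
  then have "L2_norm (indicat_real {..x}) \<le> 1"
    unfolding L2_norm_ip ip_const_1_1 by simp
  then have "L2_norm f * L2_norm (indicat_real {..x}) \<le> L2_norm f"
    by (intro mult_left_le) auto
  with L2_Cauchy_Schwarz[OF assms i] show ?thesis unfolding volterra_def by linarith
qed

lemma volterra_measurable:
  assumes "f \<in> L2"
  shows "volterra f \<in> borel_measurable cube_measure"
proof -
  have [measurable]: "f \<in> borel_measurable cube_measure" by (rule L2_measurable[OF assms])
  have [measurable]: "(\<lambda>x. x) \<in> borel_measurable (cube_measure :: real measure)" by (rule measurable_cube_id)
  have "(\<lambda>x. \<integral>y. (if y \<le> x then f y else 0) \<partial>cube_measure) \<in> borel_measurable cube_measure"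
    by measurable
  also have "(\<lambda>x. \<integral>y. (if y \<le> x then f y else 0) \<partial>cube_measure) = volterra f"
    unfolding volterra_def ip_def
    by (intro ext Bochner_Integration.integral_cong) (auto simp: indicator_def)
  finally show ?thesis .
qed

lemma volterra_L2: "f \<in> L2 \<Longrightarrow> volterra f \<in> L2"
  by (rule L2_bounded[OF volterra_measurable volterra_bound])

lemma volterra_norm:
  assumes "f \<in> L2"
  shows "L2_norm (volterra f) \<le> L2_norm f"
proof (rule power2_le_imp_le)
  have "(L2_norm (volterra f))\<^sup>2 = (\<integral>x. (volterra f x)\<^sup>2 \<partial>cube_measure)"
    unfolding L2_norm_power2 ip_def by (simp add: power2_eq_square)
  also have "\<dots> \<le> (\<integral>x. (L2_norm f)\<^sup>2 \<partial>(cube_measure :: real measure))"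
  proof (rule Bochner_Integration.integral_mono)
    show "integrable cube_measure (\<lambda>x. (volterra f x)\<^sup>2)"
      by (intro L2_integrable_square volterra_L2 assms)
    show "(volterra f x)\<^sup>2 \<le> (L2_norm f)\<^sup>2" for x
      using power_mono[OF volterra_bound[OF assms, of x], of 2] by simp
  qed simp
  also have "\<dots> = (L2_norm f)\<^sup>2"
    by (simp add: measure_def emeasure_space_cube[where 'a = real, simplified])
  finally show "(L2_norm (volterra f))\<^sup>2 \<le> (L2_norm f)\<^sup>2" .
qed simp

lemma volterra_deriv:
  assumes "\<psi> \<in> test_funs" "0 \<le> x" "x \<le> 1"
  shows "volterra (partial 1 \<psi>) x = \<psi> x"
proof -
  obtain K where K: "closed K" "\<And>x. \<psi> x \<noteq> 0 \<Longrightarrow> x \<in> K" "K \<subseteq> box 0 One"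
    using test_funs_support[OF assms(1)] by blast
  then have psi0: "\<psi> 0 = 0" by force
  have cont: "continuous_on S (partial 1 \<psi>)" for S
    by (intro test_funs_continuous test_funs_deriv assms)
  have "volterra (partial 1 \<psi>) x = (LINT y:{0..x}|lborel. partial 1 \<psi> y)"
    unfolding volterra_def ip_def cube_measure_def set_lebesgue_integral_def
    using assms(2,3)
    by (subst integral_restrict_space)
      (auto intro!: Bochner_Integration.integral_cong simp: indicator_def)
  also have "\<dots> = integral {0..x} (partial 1 \<psi>)"
    by (rule set_borel_integral_eq_integral(2))
      (rule borel_integrable_compact[OF compact_Icc cont, folded set_integrable_def])
  also have "\<dots> = \<psi> x - \<psi> 0"
  proof (rule integral_unique, rule fundamental_theorem_of_calculus[OF assms(2)])
    fix y
    have "(\<psi> has_real_derivative partial 1 \<psi> y) (at y)"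
      by (intro has_real_derivative_partial test_funs_differentiable assms)
    then show "(\<psi> has_vector_derivative partial 1 \<psi> y) (at y within {0..x})"
      by (auto intro: has_vector_derivative_at_within
          simp: has_real_derivative_iff_has_vector_derivative)
  qed
  finally show ?thesis by (simp add: psi0)
qed

text \<open>The primitive is found by duality: Riesz represents \<open>- ip a (volterra f)\<close>
  as \<open>ip f A\<close>, and for \<open>f = partial 1 \<psi>\<close> the left side is
  \<open>- ip a \<psi>\<close>, because \<open>volterra\<close> undoes the derivative of a test
  function.\<close>

lemma weak_antiderivative:
  assumes a: "a \<in> L2"
  shows "\<exists>A\<in>L2. weak_deriv A a"
proof -
  have "\<exists>A\<in>L2. \<forall>f\<in>L2. - ip a (volterra f) = ip f A"
  proof (rule L2_Riesz[where C = "L2_norm a"])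
    fix f g :: "real \<Rightarrow> real" assume fg: "f \<in> L2" "g \<in> L2"
    have "volterra (\<lambda>x. f x + g x) = (\<lambda>x. volterra f x + volterra g x)"
      unfolding volterra_def using fg by (intro ext ip_add_left indicator_L2) auto
    then show "- ip a (volterra (\<lambda>x. f x + g x)) = - ip a (volterra f) + - ip a (volterra g)"
      using a fg by (simp add: ip_add_right volterra_L2)
  next
    fix f :: "real \<Rightarrow> real" and c assume f: "f \<in> L2"
    have "volterra (\<lambda>x. c * f x) = (\<lambda>x. c * volterra f x)"
      unfolding volterra_def by simp
    then show "- ip a (volterra (\<lambda>x. c * f x)) = c * - ip a (volterra f)" by simp
  next
    fix f :: "real \<Rightarrow> real" assume f: "f \<in> L2"
    have "\<bar>ip a (volterra f)\<bar> \<le> L2_norm a * L2_norm (volterra f)"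
      by (intro L2_Cauchy_Schwarz a volterra_L2 f)
    also have "\<dots> \<le> L2_norm a * L2_norm f"
      by (intro mult_left_mono volterra_norm f) simp
    finally show "\<bar>- ip a (volterra f)\<bar> \<le> L2_norm a * L2_norm f" by simp
  qed
  then obtain A where A: "A \<in> L2" "\<And>f. f \<in> L2 \<Longrightarrow> - ip a (volterra f) = ip f A" by blast
  have "ip A (partial 1 \<psi>) = - ip a \<psi>" if \<psi>: "\<psi> \<in> test_funs" for \<psi>
  proof -
    have "ip a (volterra (partial 1 \<psi>)) = ip a \<psi>"
      unfolding ip_def by (rule Bochner_Integration.integral_cong) (auto simp: volterra_deriv[OF \<psi>])
    then show ?thesis
      using A(2)[OF test_funs_L2[OF test_funs_deriv[OF \<psi>]]] by (simp add: ip_commute)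
  qed
  then show ?thesis using A(1) by (auto simp: weak_deriv_iff)
qed

lemma ip_const_deriv:
  assumes "\<psi> \<in> test_funs"
  shows "ip (\<lambda>x::real. 1) (partial 1 \<psi>) = 0"
proof -
  obtain K where K: "closed K" "\<And>x. \<psi> x \<noteq> 0 \<Longrightarrow> x \<in> K" "K \<subseteq> box 0 One"
    using test_funs_support[OF assms] by blast
  then have "\<psi> 1 = 0" by force
  moreover have "volterra (partial 1 \<psi>) 1 = ip (\<lambda>x. 1) (partial 1 \<psi>)"
    unfolding volterra_def ip_def
    by (rule Bochner_Integration.integral_cong) (auto simp: indicator_def)
  ultimately show ?thesis using volterra_deriv[OF assms, of 1] by simp
qed

text \<open>The hypothesis says \<open>a\<^sub>0 - a\<^sub>1' + a\<^sub>2'' = 0\<close> in the sense of distributions, and \<open>A\<close> is \<open>a\<^sub>1 - a\<^sub>2'\<close>.\<close>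

lemma second_order_regularity:
  assumes a: "a0 \<in> L2" "a1 \<in> L2" "a2 \<in> L2"
    and zero: "\<And>\<psi>. \<psi> \<in> test_funs \<Longrightarrow>
      ip a0 \<psi> + ip a1 (partial 1 \<psi>) + ip a2 (partial 1 (partial 1 \<psi>)) = 0"
  shows "\<exists>A\<in>L2. weak_deriv A a0 \<and> weak_deriv a2 (\<lambda>x. a1 x - A x)"
proof -
  obtain A0 where A0: "A0 \<in> L2" "weak_deriv A0 a0" using weak_antiderivative[OF a(1)] by blast
  obtain \<eta> where \<eta>: "\<eta> \<in> test_funs" "ip (\<lambda>x::real. 1) \<eta> = 1" using test_fun_unit_integral by blast
  define b where "b x = a1 x - A0 x" for x
  have b: "b \<in> L2" unfolding b_def by (intro L2_diff a A0)
  \<comment> \<open>The constant of integration. A weak primitive of \<open>a0\<close> is free up to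
    a constant, and testing with \<open>\<eta>\<close>, the one direction not reached by derivatives
    of test functions, fixes it.\<close>
  define C where "C = ip a2 (partial 1 \<eta>) + ip b \<eta>"
  define A where "A x = A0 x + C * 1" for x
  have A: "A \<in> L2" unfolding A_def by (intro L2_add A0 L2_const)
  have "weak_deriv A a0"
    unfolding weak_deriv_iff
  proof
    fix \<psi> :: "real \<Rightarrow> real" assume \<psi>: "\<psi> \<in> test_funs"
    have "ip A (partial 1 \<psi>) = ip A0 (partial 1 \<psi>) + ip (\<lambda>x. C * 1) (partial 1 \<psi>)"
      unfolding A_def by (intro ip_add_left A0 L2_const test_funs_L2 test_funs_deriv \<psi>)
    also have "ip (\<lambda>x. C * 1) (partial 1 \<psi>) = 0"
      unfolding ip_cmult_left using ip_const_deriv[OF \<psi>] by simp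
    finally show "ip A (partial 1 \<psi>) = - ip a0 \<psi>"
      using A0(2) \<psi> by (simp add: weak_deriv_iff)
  qed
  moreover have "ip a2 (partial 1 \<theta>) = - ip (\<lambda>x. a1 x - A x) \<theta>" if \<theta>: "\<theta> \<in> test_funs" for \<theta>
  proof -
    define I where "I = ip (\<lambda>x. 1) \<theta>"
    \<comment> \<open>Subtracting the mean times \<open>\<eta>\<close> leaves mean zero, hence the
      derivative of a test function \<open>\<psi>\<close>; the hypothesis is then applied to
      \<open>\<psi>\<close>.\<close>
    define \<theta>0 where "\<theta>0 x = \<theta> x + (- I) * \<eta> x" for x
    have \<theta>0: "\<theta>0 \<in> test_funs" unfolding \<theta>0_def by (intro test_funs_add test_funs_cmult \<theta> \<eta>)
    have split: "ip f \<theta>0 = ip f \<theta> - I * ip f \<eta>" if "f \<in> L2" for f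
    proof -
      have "ip f \<theta>0 = ip f \<theta> + ip f (\<lambda>x. (- I) * \<eta> x)"
        unfolding \<theta>0_def by (intro ip_add_right that L2_cmult test_funs_L2 \<theta> \<eta>)
      then show ?thesis unfolding ip_cmult_right by simp
    qed
    have dsplit: "ip f (partial 1 \<theta>0) = ip f (partial 1 \<theta>) - I * ip f (partial 1 \<eta>)" if "f \<in> L2" for f
    proof -
      have "partial 1 \<theta>0 = (\<lambda>x. partial 1 \<theta> x + (- I) * partial 1 \<eta> x)"
      proof
        fix x
        have "partial 1 (\<lambda>x. (- I) * \<eta> x) x = (- I) * partial 1 \<eta> x"
          using \<eta>(1) by (subst partial_mult) (auto intro: test_funs_differentiable)
        then show "partial 1 \<theta>0 x = partial 1 \<theta> x + (- I) * partial 1 \<eta> x"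
          unfolding \<theta>0_def
          by (subst partial_add) (auto intro!: test_funs_differentiable \<theta> test_funs_cmult[of \<eta> "- I", simplified] \<eta>)
      qed
      then have "ip f (partial 1 \<theta>0) = ip f (partial 1 \<theta>) + ip f (\<lambda>x. (- I) * partial 1 \<eta> x)"
        using that \<theta> \<eta>(1) by (simp only: ip_add_right L2_cmult test_funs_L2 test_funs_deriv)
      then show ?thesis unfolding ip_cmult_right by simp
    qed
    have "(\<integral>x. \<theta>0 x \<partial>cube_measure) = ip (\<lambda>x. 1) \<theta>0" by (simp add: ip_def)
    also have "\<dots> = 0" using split[OF L2_const] \<eta>(2) by (simp add: I_def)
    finally obtain \<psi> where \<psi>: "\<psi> \<in> test_funs" "partial 1 \<psi> = \<theta>0"
      using test_funs_antiderivative[OF \<theta>0] by blast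
    have "ip b \<theta>0 = ip a1 \<theta>0 - ip A0 \<theta>0"
      unfolding b_def by (intro ip_diff_left a A0 test_funs_L2 \<theta>0)
    moreover have "ip A0 \<theta>0 = - ip a0 \<psi>" using A0(2) \<psi> by (auto simp: weak_deriv_iff)
    ultimately have "ip a2 (partial 1 \<theta>0) + ip b \<theta>0 = 0"
      using zero[OF \<psi>(1)] by (simp add: \<psi>(2))
    then have "ip a2 (partial 1 \<theta>) + ip b \<theta> = C * I"
      unfolding dsplit[OF a(3)] split[OF b] C_def by (simp add: algebra_simps)
    moreover have "ip (\<lambda>x. a1 x - A x) \<theta> = ip b \<theta> - ip (\<lambda>x. C * 1) \<theta>"
    proof -
      have "(\<lambda>x. a1 x - A x) = (\<lambda>x. b x - C * 1)" by (auto simp: A_def b_def)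
      then show ?thesis using b \<theta> by (simp only: ip_diff_left L2_const test_funs_L2)
    qed
    ultimately show ?thesis unfolding ip_cmult_left I_def[symmetric] by simp
  qed
  ultimately show ?thesis using A by (auto simp: weak_deriv_iff)
qed

text \<open>The functions \<open>w 0, \<dots>, w a\<close> behave like \<open>w\<close> and its derivatives up to order \<open>a\<close>, where \<open>w\<close>
  vanishes to order \<open>a\<close> at both end points.\<close>

definition deriv_chain :: "nat \<Rightarrow> (nat \<Rightarrow> real \<Rightarrow> real) \<Rightarrow> bool" where
  "deriv_chain a w \<longleftrightarrow> (\<forall>j\<le>a. w j \<in> L2) \<and>
     (\<forall>j<a. \<forall>u\<in>L2. \<forall>u'\<in>L2. weak_deriv u u' \<longrightarrow> ip u' (w j) = - ip u (w (Suc j)))"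

lemma deriv_chain_test: "\<psi> \<in> test_funs \<Longrightarrow> deriv_chain a (\<lambda>j. (partial 1 ^^ j) \<psi>)"
  by (auto simp: deriv_chain_def weak_deriv_iff test_funs_L2 test_funs_derivs)

text \<open>Tested with \<open>\<psi>\<close>, the identity is a differential equation for the
  \<open>b j\<close>. It makes suitable combinations of them weakly differentiable, and each weak
  derivative obtained in this way can be moved onto the chain, where no boundary term
  appears.\<close>

lemma deriv_chain_annihilated:
  assumes a: "a \<le> 2" and b: "\<And>j. j \<le> a \<Longrightarrow> b j \<in> L2"
    and zero: "\<And>\<psi>. \<psi> \<in> test_funs \<Longrightarrow> (\<Sum>j\<le>a. ip (b j) ((partial 1 ^^ j) \<psi>)) = 0"
    and w: "deriv_chain a w"
  shows "(\<Sum>j\<le>a. ip (b j) (w j)) = 0"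
proof -
  have wL2: "j \<le> a \<Longrightarrow> w j \<in> L2" for j using w by (simp add: deriv_chain_def)
  have wd: "ip u' (w j) = - ip u (w (Suc j))" if "j < a" "u \<in> L2" "u' \<in> L2" "weak_deriv u u'" for j u u'
    using w that by (auto simp: deriv_chain_def)
  consider "a = 0" | "a = 1" | "a = 2" using a by linarith
  then show ?thesis
  proof cases
    case 1
    have "L2_eq (b 0) (\<lambda>x. 0)"
      using zero 1 b by (intro L2_eq_0_if_orthogonal_tests) auto
    then have "ip (b 0) (w 0) = ip (\<lambda>x. 0) (w 0)"
      using b wL2 by (intro ip_cong_L2_eq_left) auto
    then show ?thesis using 1 by simp
  next
    case 2
    have "weak_deriv (b 1) (b 0)"
      unfolding weak_deriv_iff
    proof
      fix \<psi> :: "real \<Rightarrow> real" assume "\<psi> \<in> test_funs"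
      from zero[OF this] show "ip (b 1) (partial 1 \<psi>) = - ip (b 0) \<psi>" using 2 by simp
    qed
    from wd[OF _ _ _ this, of 0] show ?thesis using 2 b by simp
  next
    case 3
    have "ip (b 0) \<psi> + ip (b 1) (partial 1 \<psi>) + ip (b 2) (partial 1 (partial 1 \<psi>)) = 0"
      if "\<psi> \<in> test_funs" for \<psi>
      using zero[OF that] 3 by (simp add: numeral_2_eq_2)
    \<comment> \<open>The equation of second order splits into two of first order:
      \<open>b 0\<close> is the derivative of \<open>A\<close>, and \<open>b 1 - A\<close> is that
      of \<open>b 2\<close>. Integrating them by parts against \<open>w 0\<close> and
      \<open>w 1\<close> cancels the whole sum.\<close>
    from second_order_regularity[OF _ _ _ this]
    obtain A where A: "A \<in> L2" "weak_deriv A (b 0)" "weak_deriv (b 2) (\<lambda>x. b 1 x - A x)"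
      using b 3 by auto
    have "ip (b 0) (w 0) = - ip A (w 1)"
      using wd[OF _ _ _ A(2), of 0] 3 A b by simp
    moreover have "ip (\<lambda>x. b 1 x - A x) (w 1) = - ip (b 2) (w 2)"
      using wd[OF _ _ _ A(3), of 1] 3 A b by (simp add: L2_diff numeral_2_eq_2)
    moreover have "ip (\<lambda>x. b 1 x - A x) (w 1) = ip (b 1) (w 1) - ip A (w 1)"
      using 3 b wL2 A by (intro ip_diff_left) auto
    ultimately show ?thesis using 3 by (simp add: numeral_2_eq_2)
  qed
qed

text \<open>Integrating \<open>u\<close> against all factors but the one in direction
  \<open>m\<close> leaves a function of one variable. Riesz produces it from the norm bound alone,
  so no measurability of partial integrals is at stake.\<close>

lemma slot_functional:
  fixes w :: "'n::finite \<Rightarrow> real \<Rightarrow> real"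
  assumes u: "u \<in> L2" and w: "\<And>j. j \<noteq> m \<Longrightarrow> w j \<in> L2"
  shows "\<exists>b\<in>L2. \<forall>f\<in>L2. ip u (tensor_fun (w(m := f))) = ip f b"
proof -
  have wf: "(w(m := f)) j \<in> L2" if "f \<in> L2" for f j using w that by auto
  have L2f: "tensor_fun (w(m := f)) \<in> L2" if "f \<in> L2" for f
    by (rule L2_tensor_fun[OF wf[OF that]])
  show ?thesis
  proof (rule L2_Riesz[where C = "L2_norm u * (\<Prod>j\<in>UNIV - {m}. L2_norm (w j))"])
    fix f g :: "real \<Rightarrow> real" assume "f \<in> L2" "g \<in> L2"
    then show "ip u (tensor_fun (w(m := (\<lambda>x. f x + g x)))) =
        ip u (tensor_fun (w(m := f))) + ip u (tensor_fun (w(m := g)))"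
      unfolding tensor_fun_update_add[abs_def] by (intro ip_add_right L2f u)
  next
    fix f :: "real \<Rightarrow> real" and c
    show "ip u (tensor_fun (w(m := (\<lambda>x. c * f x)))) = c * ip u (tensor_fun (w(m := f)))"
      unfolding tensor_fun_update_cmult[abs_def] by simp
  next
    fix f :: "real \<Rightarrow> real" assume f: "f \<in> L2"
    have "\<bar>ip u (tensor_fun (w(m := f)))\<bar> \<le> L2_norm u * L2_norm (tensor_fun (w(m := f)))"
      by (intro L2_Cauchy_Schwarz u L2f f)
    also have "L2_norm (tensor_fun (w(m := f))) = (\<Prod>j\<in>UNIV. L2_norm ((w(m := f)) j))"
      by (rule L2_norm_tensor_fun[OF wf[OF f]])
    also have "\<dots> = L2_norm f * (\<Prod>j\<in>UNIV - {m}. L2_norm (w j))"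
      by (subst prod.remove[of _ m]) (auto intro!: prod.cong)
    finally show "\<bar>ip u (tensor_fun (w(m := f)))\<bar> \<le>
        L2_norm u * (\<Prod>j\<in>UNIV - {m}. L2_norm (w j)) * L2_norm f"
      by (simp only: ac_simps)
  qed
qed

text \<open>The test functions are replaced by derivative chains one direction at a time; in the
  direction at hand the identity is a one-dimensional one.\<close>

lemma tensor_deriv_chain_annihilated:
  fixes \<alpha> :: "'n::finite \<Rightarrow> nat" and u :: "'t \<Rightarrow> real ^ 'n \<Rightarrow> real"
  assumes \<alpha>: "\<And>m. \<alpha> m \<le> 2" and T: "finite T"
    and u: "\<And>t. t \<in> T \<Longrightarrow> u t \<in> L2" and \<gamma>: "\<And>t m. t \<in> T \<Longrightarrow> \<gamma> t m \<le> \<alpha> m"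
    and zero: "\<And>\<psi>. (\<And>m. \<psi> m \<in> test_funs) \<Longrightarrow>
      (\<Sum>t\<in>T. c t * ip (u t) (tensor_fun (\<lambda>m. (partial 1 ^^ \<gamma> t m) (\<psi> m)))) = 0"
    and W: "\<And>m. deriv_chain (\<alpha> m) (W m)"
  shows "(\<Sum>t\<in>T. c t * ip (u t) (tensor_fun (\<lambda>m. W m (\<gamma> t m)))) = 0"
proof -
  \<comment> \<open>Induction over the set \<open>I\<close> of directions in which the chain is
    arbitrary; outside \<open>I\<close> it consists of the derivatives of a test function.\<close>
  have "(\<Sum>t\<in>T. c t * ip (u t) (tensor_fun (\<lambda>m. W m (\<gamma> t m)))) = 0"
    if "\<And>m. deriv_chain (\<alpha> m) (W m)"
      "\<And>m. m \<notin> I \<Longrightarrow> \<exists>\<psi>\<in>test_funs. W m = (\<lambda>j. (partial 1 ^^ j) \<psi>)" for I W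
    using finite[of I] that
  proof (induction I arbitrary: W rule: finite_induct)
    case empty
    then obtain \<psi> where \<psi>: "\<And>m. \<psi> m \<in> test_funs" "\<And>m. W m = (\<lambda>j. (partial 1 ^^ j) (\<psi> m))"
      by (metis empty_iff)
    show ?case using zero[of \<psi>] \<psi> by simp
  next
    case (insert m I)
    let ?w = "\<lambda>t j. W j (\<gamma> t j)"
    have wL2: "?w t j \<in> L2" if "t \<in> T" for t j
      using insert.prems(1)[of j] \<gamma>[OF that, of j] by (simp add: deriv_chain_def)
    have "\<forall>t\<in>T. \<exists>b\<in>L2. \<forall>f\<in>L2. ip (u t) (tensor_fun ((?w t)(m := f))) = ip f b"
      by (intro ballI slot_functional u wL2)
    then obtain b where b: "\<And>t. t \<in> T \<Longrightarrow> b t \<in> L2"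
      "\<And>t f. t \<in> T \<Longrightarrow> f \<in> L2 \<Longrightarrow> ip (u t) (tensor_fun ((?w t)(m := f))) = ip f (b t)"
      by metis
    \<comment> \<open>Terms are collected by their order \<open>j\<close> in direction
      \<open>m\<close>, which leaves a one-dimensional identity with one function for each
      order.\<close>
    define B where "B j x = (\<Sum>t\<in>{t \<in> T. \<gamma> t m = j}. c t * b t x)" for j x
    have BL2: "B j \<in> L2" for j unfolding B_def by (intro L2_sum L2_cmult b) auto
    have key: "(\<Sum>t\<in>T. c t * ip (u t) (tensor_fun ((?w t)(m := v (\<gamma> t m))))) = (\<Sum>j\<le>\<alpha> m. ip (B j) (v j))"
      if v: "\<And>j. j \<le> \<alpha> m \<Longrightarrow> v j \<in> L2" for v
    proof -
      have "(\<Sum>t\<in>T. c t * ip (u t) (tensor_fun ((?w t)(m := v (\<gamma> t m))))) = (\<Sum>t\<in>T. c t * ip (b t) (v (\<gamma> t m)))"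
        using b v \<gamma> by (intro sum.cong) (auto simp: ip_commute)
      also have "\<dots> = (\<Sum>j\<le>\<alpha> m. \<Sum>t\<in>{t \<in> T. \<gamma> t m = j}. c t * ip (b t) (v (\<gamma> t m)))"
        using T \<gamma> by (intro sum.group[symmetric]) auto
      also have "\<dots> = (\<Sum>j\<le>\<alpha> m. ip (B j) (v j))"
      proof (rule sum.cong[OF refl])
        fix j assume j: "j \<in> {..\<alpha> m}"
        have "ip (B j) (v j) = (\<Sum>t\<in>{t \<in> T. \<gamma> t m = j}. ip (\<lambda>x. c t * b t x) (v j))"
          unfolding B_def using b v j by (intro ip_sum_left L2_cmult) auto
        then show "(\<Sum>t\<in>{t \<in> T. \<gamma> t m = j}. c t * ip (b t) (v (\<gamma> t m))) = ip (B j) (v j)"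
          by (auto intro!: sum.cong)
      qed
      finally show ?thesis .
    qed
    \<comment> \<open>With the derivatives of \<open>\<psi>\<close> in slot \<open>m\<close>, only
      the directions in \<open>I\<close> are arbitrary, so the induction hypothesis supplies the
      identity for test functions.\<close>
    have "(\<Sum>j\<le>\<alpha> m. ip (B j) ((partial 1 ^^ j) \<psi>)) = 0" if \<psi>: "\<psi> \<in> test_funs" for \<psi>
    proof -
      let ?W = "W(m := (\<lambda>j. (partial 1 ^^ j) \<psi>))"
      have "(\<Sum>t\<in>T. c t * ip (u t) (tensor_fun (\<lambda>i. ?W i (\<gamma> t i)))) = 0"
        using insert.prems \<psi> by (intro insert.IH) (auto intro: deriv_chain_test)
      moreover have "(\<lambda>i. ?W i (\<gamma> t i)) = (?w t)(m := (partial 1 ^^ \<gamma> t m) \<psi>)" for t by auto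
      ultimately show ?thesis
        using key[of "\<lambda>j. (partial 1 ^^ j) \<psi>"] \<psi> by (simp add: test_funs_L2 test_funs_derivs)
    qed
    from deriv_chain_annihilated[OF \<alpha> BL2 this insert.prems(1)]
    have "(\<Sum>j\<le>\<alpha> m. ip (B j) (W m j)) = 0" .
    moreover have "(?w t)(m := W m (\<gamma> t m)) = ?w t" for t by auto
    ultimately show ?case
      using key[of "W m"] insert.prems(1)[of m] by (simp add: deriv_chain_def)
  qed
  from this[of W UNIV] show ?thesis using W by simp
qed


section \<open>Tensor product operators\<close>

definition L2_span :: "('a::euclidean_space \<Rightarrow> real) set \<Rightarrow> ('a \<Rightarrow> real) set" where
  "L2_span B = {f \<in> L2. \<exists>c. L2_eq f (\<lambda>x. \<Sum>b\<in>B. c b * b x)}"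

lemma L2_span_add:
  assumes "f \<in> L2_span B" "g \<in> L2_span B"
  shows "(\<lambda>x. f x + g x) \<in> L2_span B"
proof -
  obtain c d where "L2_eq f (\<lambda>x. \<Sum>b\<in>B. c b * b x)" "L2_eq g (\<lambda>x. \<Sum>b\<in>B. d b * b x)"
    using assms by (auto simp: L2_span_def)
  then have "L2_eq (\<lambda>x. f x + g x) (\<lambda>x. \<Sum>b\<in>B. (c b + d b) * b x)"
    unfolding L2_eq_def by eventually_elim (simp add: distrib_right sum.distrib)
  moreover have "(\<lambda>x. f x + g x) \<in> L2" using assms by (auto simp: L2_span_def intro: L2_add)
  ultimately show ?thesis unfolding L2_span_def
    by (auto intro!: exI[of _ "\<lambda>b. c b + d b"])
qed

lemma L2_span_cmult:
  assumes "f \<in> L2_span B"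
  shows "(\<lambda>x. a * f x) \<in> L2_span B"
proof -
  obtain c where "L2_eq f (\<lambda>x. \<Sum>b\<in>B. c b * b x)"
    using assms by (auto simp: L2_span_def)
  then have "L2_eq (\<lambda>x. a * f x) (\<lambda>x. \<Sum>b\<in>B. (a * c b) * b x)"
    unfolding L2_eq_def by eventually_elim (simp add: sum_distrib_left mult.assoc)
  moreover have "(\<lambda>x. a * f x) \<in> L2" using assms by (auto simp: L2_span_def intro: L2_cmult)
  ultimately show ?thesis unfolding L2_span_def
    by (auto intro!: exI[of _ "\<lambda>b. a * c b"])
qed

lemma L2_span_zero: "(\<lambda>x. 0) \<in> L2_span B"
  unfolding L2_span_def by (auto intro!: exI[of _ "\<lambda>b. 0"] simp: L2_eq_def)

lemma L2_span_sum: "(\<And>i. i \<in> I \<Longrightarrow> f i \<in> L2_span B) \<Longrightarrow> (\<lambda>x. \<Sum>i\<in>I. f i x) \<in> L2_span B"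
  by (induction I rule: infinite_finite_induct) (auto intro: L2_span_zero L2_span_add)

lemma L2_span_insert_mono:
  assumes "finite B" "b \<notin> B" "f \<in> L2_span B"
  shows "f \<in> L2_span (insert b B)"
proof -
  obtain c where c: "L2_eq f (\<lambda>x. \<Sum>b\<in>B. c b * b x)" using assms by (auto simp: L2_span_def)
  have "(\<Sum>b\<in>B. c b * b x) = (\<Sum>b'\<in>insert b B. (c(b := 0)) b' * b' x)" for x
    using assms(1,2) by (auto intro!: sum.cong)
  with c show ?thesis using assms(3) unfolding L2_span_def by (auto intro!: exI[of _ "c(b := 0)"])
qed

lemma L2_span_base:
  assumes "finite B" "b \<in> B" "b \<in> L2"
  shows "b \<in> L2_span B"
proof -
  have "(\<Sum>b'\<in>B. (if b' = b then 1 else 0) * b' x) = b x" for x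
  proof -
    have "(\<Sum>b'\<in>B. (if b' = b then 1 else 0) * b' x) = (\<Sum>b'\<in>B. if b' = b then b x else 0)"
      by (rule sum.cong) auto
    then show ?thesis using assms by simp
  qed
  then show ?thesis using assms(3) unfolding L2_span_def
    by (auto intro!: exI[of _ "\<lambda>b'. if b' = b then 1 else 0"] simp: L2_eq_def)
qed

lemma L2_span_subset_L2: "f \<in> L2_span B \<Longrightarrow> f \<in> L2"
  by (simp add: L2_span_def)

text \<open>The functions \<open>h i\<close> give the coefficients with respect to the \<open>e i\<close>; the residual \<open>r\<close> of a
  new spanning function \<open>b\<close> becomes the next \<open>e i\<close>.\<close>

lemma L2_span_dual_family:
  assumes "finite B" "B \<subseteq> L2"
  shows "\<exists>N e h. (\<forall>i<N. e i \<in> L2_span B \<and> h i \<in> L2) \<and>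
    (\<forall>f\<in>L2_span B. L2_eq f (\<lambda>x. \<Sum>i<(N::nat). ip f (h i) * e i x))"
  using assms
proof (induction B rule: finite_induct)
  case empty
  show ?case
    by (rule exI[of _ 0]) (auto simp: L2_span_def)
next
  case (insert b B)
  then have "\<exists>N e h. (\<forall>i<N. e i \<in> L2_span B \<and> h i \<in> L2) \<and>
      (\<forall>f\<in>L2_span B. L2_eq f (\<lambda>x. \<Sum>i<(N::nat). ip f (h i) * e i x))" by auto
  then obtain N e h where eh0: "\<forall>i<N. e i \<in> L2_span B \<and> h i \<in> L2"
    and rep0: "\<forall>f\<in>L2_span B. L2_eq f (\<lambda>x. \<Sum>i<(N::nat). ip f (h i) * e i x)"
    by (elim exE conjE)
  have eh: "\<And>i. i < N \<Longrightarrow> e i \<in> L2_span B" "\<And>i. i < N \<Longrightarrow> h i \<in> L2"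
    and rep: "\<And>f. f \<in> L2_span B \<Longrightarrow> L2_eq f (\<lambda>x. \<Sum>i<N. ip f (h i) * e i x)"
    using eh0 rep0 by auto
  have b: "b \<in> L2" using insert by simp
  have e': "\<And>i. i < N \<Longrightarrow> e i \<in> L2_span (insert b B)"
    using eh(1) insert by (intro L2_span_insert_mono)
  have eL2: "\<And>i. i < N \<Longrightarrow> e i \<in> L2" using eh(1) L2_span_subset_L2 by blast
  \<comment> \<open>The part of \<open>f\<close> that the pairs \<open>e i\<close>,
    \<open>h i\<close> found so far do not reproduce.\<close>
  define R where "R f x = f x - (\<Sum>i<N. ip f (h i) * e i x)" for f x
  have R_L2: "R f \<in> L2" if "f \<in> L2" for f
    unfolding R_def by (intro L2_diff that L2_sum L2_cmult eL2) simp
  have R_span: "L2_eq (R f) (\<lambda>x. 0)" if "f \<in> L2_span B" for f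
    using rep[OF that] by (simp add: R_def L2_eq_def)
  define r where "r = R b"
  have r_span: "r \<in> L2_span (insert b B)"
  proof -
    have "r = (\<lambda>x. b x + (-1) * (\<Sum>i<N. ip b (h i) * e i x))" by (auto simp: r_def R_def)
    also have "\<dots> \<in> L2_span (insert b B)"
      using insert by (intro L2_span_add L2_span_cmult L2_span_sum e' L2_span_base) auto
    finally show ?thesis .
  qed
  have r_L2: "r \<in> L2" using r_span L2_span_subset_L2 by blast
  \<comment> \<open>Modulo the old span, the enlarged one consists of multiples of \<open>b\<close>;
    residuals of the old span vanish, so every new residual is a multiple of
    \<open>r\<close>.\<close>
  have residual: "\<exists>c. L2_eq (R f) (\<lambda>x. c * r x)" if f: "f \<in> L2_span (insert b B)" for f
  proof -
    obtain c where c: "L2_eq f (\<lambda>x. \<Sum>b\<in>insert b B. c b * b x)" and fL2: "f \<in> L2"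
      using f by (auto simp: L2_span_def)
    define f0 where "f0 x = f x - c b * b x" for x
    have f0L2: "f0 \<in> L2" unfolding f0_def by (intro L2_diff fL2 L2_cmult b)
    have "L2_eq f0 (\<lambda>x. \<Sum>b\<in>B. c b * b x)"
      using c insert.hyps unfolding L2_eq_def f0_def by (auto elim!: eventually_mono)
    then have f0: "f0 \<in> L2_span B" using f0L2 by (auto simp: L2_span_def)
    have ip0: "ip f0 (h i) = ip f (h i) - c b * ip b (h i)" if "i < N" for i
    proof -
      have "ip f0 (h i) = ip f (h i) - ip (\<lambda>x. c b * b x) (h i)"
        unfolding f0_def by (intro ip_diff_left fL2 L2_cmult b eh(2) that)
      then show ?thesis by simp
    qed
    have "R f x = R f0 x + c b * r x" for x
    proof -
      have "(\<Sum>i<N. ip f0 (h i) * e i x) = (\<Sum>i<N. ip f (h i) * e i x - c b * (ip b (h i) * e i x))"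
        by (intro sum.cong) (auto simp: ip0 algebra_simps)
      then show ?thesis
        by (simp add: R_def r_def f0_def sum_subtractf sum_distrib_left algebra_simps)
    qed
    then show ?thesis using R_span[OF f0] by (intro exI[of _ "c b"]) (auto simp: L2_eq_def)
  qed
  show ?case
  proof (cases "ip r r = 0")
    case True
    then have r0: "L2_eq r (\<lambda>x. 0)" using ip_self_eq_0_iff[OF r_L2] by simp
    have "L2_eq f (\<lambda>x. \<Sum>i<N. ip f (h i) * e i x)" if f: "f \<in> L2_span (insert b B)" for f
    proof -
      obtain c where "L2_eq (R f) (\<lambda>x. c * r x)" using residual[OF f] by blast
      then show ?thesis using r0 unfolding L2_eq_def R_def by eventually_elim auto
    qed
    then show ?thesis using e' eh(2) by blast
  next
    case False
    \<comment> \<open>The adjoint of \<open>R\<close> applied to \<open>r\<close> and normalised: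
      pairing \<open>f\<close> with \<open>k\<close> reads off which multiple of \<open>r\<close>
      the residual of \<open>f\<close> is.\<close>
    define k where "k x = (1 / ip r r) * (r x - (\<Sum>i<N. ip (e i) r * h i x))" for x
    have sL2: "(\<lambda>x. \<Sum>i<N. ip (e i) r * h i x) \<in> L2"
      by (intro L2_sum L2_cmult eh(2)) simp
    have kL2: "k \<in> L2" unfolding k_def by (intro L2_cmult L2_diff r_L2 sL2)
    have ipk: "ip f k = ip (R f) r / ip r r" if f: "f \<in> L2" for f
    proof -
      have "ip f k = (1 / ip r r) * ip f (\<lambda>x. r x - (\<Sum>i<N. ip (e i) r * h i x))"
        unfolding k_def ip_cmult_right ..
      also have "ip f (\<lambda>x. r x - (\<Sum>i<N. ip (e i) r * h i x)) = ip f r - ip (\<lambda>x. \<Sum>i<N. ip (e i) r * h i x) f"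
        unfolding ip_commute[of _ f] by (intro ip_diff_right r_L2 sL2 f)
      also have "ip (\<lambda>x. \<Sum>i<N. ip (e i) r * h i x) f = (\<Sum>i<N. ip (e i) r * ip (h i) f)"
        using f eh(2) by (subst ip_sum_left) (auto intro: L2_cmult)
      also have "ip f r - \<dots> = ip (R f) r"
      proof -
        have s: "(\<lambda>x. \<Sum>i<N. ip f (h i) * e i x) \<in> L2" by (intro L2_sum L2_cmult eL2) simp
        have "ip (R f) r = ip f r - ip (\<lambda>x. \<Sum>i<N. ip f (h i) * e i x) r"
          unfolding R_def by (rule ip_diff_left[OF f s r_L2])
        also have "ip (\<lambda>x. \<Sum>i<N. ip f (h i) * e i x) r = (\<Sum>i<N. ip (\<lambda>x. ip f (h i) * e i x) r)"
          by (intro ip_sum_left L2_cmult eL2 r_L2) simp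
        also have "\<dots> = (\<Sum>i<N. ip (e i) r * ip (h i) f)"
          unfolding ip_cmult_left by (intro sum.cong) (auto simp: ip_commute[of f])
        finally show ?thesis by simp
      qed
      finally show ?thesis by simp
    qed
    let ?e = "e(N := r)" and ?h = "h(N := k)"
    have "L2_eq f (\<lambda>x. \<Sum>i<Suc N. ip f (?h i) * ?e i x)" if f: "f \<in> L2_span (insert b B)" for f
    proof -
      have fL2: "f \<in> L2" using f L2_span_subset_L2 by blast
      obtain c where c: "L2_eq (R f) (\<lambda>x. c * r x)" using residual[OF f] by blast
      have "ip (R f) r = ip (\<lambda>x. c * r x) r"
        by (intro ip_cong_L2_eq_left c R_L2 fL2 L2_cmult r_L2)
      then have "ip f k = c" using False by (simp add: ipk[OF fL2])
      then show ?thesis using c unfolding L2_eq_def R_def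
        by (auto elim!: eventually_mono simp: algebra_simps)
    qed
    moreover have "?e i \<in> L2_span (insert b B) \<and> ?h i \<in> L2" if "i < Suc N" for i
      using that e' eh(2) r_span kL2 by (auto simp: less_Suc_eq)
    ultimately show ?thesis by blast
  qed
qed

text \<open>The coefficients of \<open>T f\<close> in its range are pairings of \<open>T f\<close>
  with fixed functions; adjoints turn them into pairings of \<open>f\<close> itself.\<close>

lemma finite_rank_representation:
  assumes V: "fin_dim_L2_subspace V" and T: "bounded_L2_op T" "\<And>f. f \<in> L2 \<Longrightarrow> T f \<in> V"
  shows "\<exists>N e h. (\<forall>i<N. e i \<in> V \<and> h i \<in> L2) \<and>
    (\<forall>f\<in>L2. L2_eq (T f) (\<lambda>x. \<Sum>i<(N::nat). ip f (h i) * e i x))"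
proof -
  obtain B where B: "finite B" "B \<subseteq> L2" "V = L2_span B"
    using V unfolding fin_dim_L2_subspace_def L2_span_def by blast
  obtain N e h where eh0: "\<forall>i<N. e i \<in> V \<and> h i \<in> L2"
    and rep0: "\<forall>f\<in>V. L2_eq f (\<lambda>x. \<Sum>i<(N::nat). ip f (h i) * e i x)"
    using L2_span_dual_family[OF B(1,2)] unfolding B(3) by (elim exE conjE)
  have eh: "\<And>i. i < N \<Longrightarrow> e i \<in> V" "\<And>i. i < N \<Longrightarrow> h i \<in> L2"
    and rep: "\<And>f. f \<in> V \<Longrightarrow> L2_eq f (\<lambda>x. \<Sum>i<N. ip f (h i) * e i x)"
    using eh0 rep0 by auto
  have "\<forall>i\<in>{..<N}. \<exists>k\<in>L2. \<forall>f\<in>L2. ip (T f) (h i) = ip f k"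
    using bounded_L2_op_adjoint[OF T(1)] eh(2) by auto
  then obtain k where k: "\<And>i. i < N \<Longrightarrow> k i \<in> L2"
    "\<And>i f. i < N \<Longrightarrow> f \<in> L2 \<Longrightarrow> ip (T f) (h i) = ip f (k i)"
    by (metis lessThan_iff)
  have "L2_eq (T f) (\<lambda>x. \<Sum>i<N. ip f (k i) * e i x)" if "f \<in> L2" for f
    using rep[OF T(2)[OF that]] k(2)[OF _ that] by simp
  then show ?thesis using eh(1) k(1) by blast
qed

text \<open>The squared distance is a combination of inner products that factor over the
  coordinates, so no null sets have to be lifted from the line to the cube.\<close>

lemma L2_eq_tensor_fun:
  fixes a b :: "'n::finite \<Rightarrow> real \<Rightarrow> real"
  assumes a: "\<And>m. a m \<in> L2" and b: "\<And>m. b m \<in> L2" and eq: "\<And>m. L2_eq (a m) (b m)"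
  shows "L2_eq (tensor_fun a) (tensor_fun b)"
proof -
  have "ip (a m) (b m) = ip (b m) (b m)" "ip (a m) (a m) = ip (b m) (b m)" for m
    using ip_cong_L2_eq_left[OF eq a b b, of m] ip_cong_L2_eq_left[OF eq a b a, of m]
    by (simp_all add: ip_commute)
  then have "ip (tensor_fun a) (tensor_fun b) = ip (tensor_fun b) (tensor_fun b)"
    "ip (tensor_fun a) (tensor_fun a) = ip (tensor_fun b) (tensor_fun b)"
    by (simp_all add: ip_tensor_fun a b)
  moreover have "tensor_fun a \<in> L2" "tensor_fun b \<in> L2" using L2_tensor_fun a b by blast+
  ultimately show ?thesis
    by (simp add: L2_eq_iff_ip_diff ip_diff_left ip_diff_right L2_diff ip_commute[of "tensor_fun b" "tensor_fun a"])
qed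

text \<open>The tensor product of operators of the form
  \<open>\<lambda>f x. \<Sum>i<N m. ip f (h m i) * e m i x\<close>, multiplied out: the multi-index
  \<open>\<iota>\<close> selects one rank-one summand in every direction.\<close>

definition kernel_op :: "('n::finite \<Rightarrow> nat) \<Rightarrow> ('n \<Rightarrow> nat \<Rightarrow> real \<Rightarrow> real) \<Rightarrow> ('n \<Rightarrow> nat \<Rightarrow> real \<Rightarrow> real)
    \<Rightarrow> (real ^ 'n \<Rightarrow> real) \<Rightarrow> real ^ 'n \<Rightarrow> real" where
  "kernel_op N e h u x = (\<Sum>\<iota>\<in>PiE UNIV (\<lambda>m. {..<N m}).
     ip u (tensor_fun (\<lambda>m. h m (\<iota> m))) * tensor_fun (\<lambda>m. e m (\<iota> m)) x)"

text \<open>This supplies the existence of tensor product operators. A finite sum of rank-one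
  operators is bounded, and on a product function the sum over multi-indices factors by
  distributivity.\<close>

lemma is_tensor_op_kernel_op:
  fixes N :: "'n::finite \<Rightarrow> nat"
  assumes e: "\<And>m i. i < N m \<Longrightarrow> e m i \<in> L2" and h: "\<And>m i. i < N m \<Longrightarrow> h m i \<in> L2"
    and A: "\<And>m f. f \<in> L2 \<Longrightarrow> A m f \<in> L2"
    and rep: "\<And>m f. f \<in> L2 \<Longrightarrow> L2_eq (A m f) (\<lambda>x. \<Sum>i<N m. ip f (h m i) * e m i x)"
  shows "is_tensor_op A (kernel_op N e h)"
proof -
  let ?P = "PiE UNIV (\<lambda>m. {..<N m})"
  let ?E = "\<lambda>\<iota>. tensor_fun (\<lambda>m. e m (\<iota> m))" and ?H = "\<lambda>\<iota>. tensor_fun (\<lambda>m. h m (\<iota> m))"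
  have fin: "finite ?P" by (simp add: finite_PiE)
  have E: "?E \<iota> \<in> L2" and H: "?H \<iota> \<in> L2" if "\<iota> \<in> ?P" for \<iota>
    using that by (auto intro!: L2_tensor_fun e h)
  have KL2: "kernel_op N e h u \<in> L2" for u
    unfolding kernel_op_def by (intro L2_sum L2_cmult E)
  have "kernel_op N e h (\<lambda>x. f x + g x) = (\<lambda>x. kernel_op N e h f x + kernel_op N e h g x)"
    if "f \<in> L2" "g \<in> L2" for f g
    unfolding kernel_op_def sum.distrib[symmetric]
    by (intro ext sum.cong) (auto simp: ip_add_left that H distrib_right)
  moreover have "kernel_op N e h (\<lambda>x. c * f x) = (\<lambda>x. c * kernel_op N e h f x)" for f c
    unfolding kernel_op_def by (simp add: sum_distrib_left mult.assoc)
  moreover have "L2_norm (kernel_op N e h f) \<le> (\<Sum>\<iota>\<in>?P. L2_norm (?H \<iota>) * L2_norm (?E \<iota>)) * L2_norm f"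
    if f: "f \<in> L2" for f
  proof -
    have "L2_norm (kernel_op N e h f) \<le> (\<Sum>\<iota>\<in>?P. L2_norm (\<lambda>x. ip f (?H \<iota>) * ?E \<iota> x))"
      unfolding kernel_op_def by (intro L2_norm_sum L2_cmult E)
    also have "\<dots> \<le> (\<Sum>\<iota>\<in>?P. L2_norm (?H \<iota>) * L2_norm (?E \<iota>) * L2_norm f)"
    proof (rule sum_mono)
      fix \<iota> assume "\<iota> \<in> ?P"
      then have "\<bar>ip f (?H \<iota>)\<bar> * L2_norm (?E \<iota>) \<le> (L2_norm f * L2_norm (?H \<iota>)) * L2_norm (?E \<iota>)"
        by (intro mult_right_mono L2_Cauchy_Schwarz f H) auto
      then show "L2_norm (\<lambda>x. ip f (?H \<iota>) * ?E \<iota> x) \<le> L2_norm (?H \<iota>) * L2_norm (?E \<iota>) * L2_norm f"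
        unfolding L2_norm_cmult by (simp only: ac_simps)
    qed
    finally show ?thesis by (simp add: sum_distrib_right)
  qed
  ultimately have "bounded_L2_op (kernel_op N e h)"
    unfolding bounded_L2_op_def using KL2
    by (intro conjI ballI allI
        exI[of _ "\<Sum>\<iota>\<in>?P. L2_norm (?H \<iota>) * L2_norm (?E \<iota>)"]) (simp_all add: L2_eq_def)
  moreover have "L2_eq (kernel_op N e h (tensor_fun f)) (tensor_fun (\<lambda>m. A m (f m)))"
    if f: "\<And>m. f m \<in> L2" for f
  proof -
    have "kernel_op N e h (tensor_fun f) x = tensor_fun (\<lambda>m t. \<Sum>i<N m. ip (f m) (h m i) * e m i t) x" for x
    proof -
      have "kernel_op N e h (tensor_fun f) x
          = (\<Sum>\<iota>\<in>?P. \<Prod>m\<in>UNIV. ip (f m) (h m (\<iota> m)) * e m (\<iota> m) (x $ m))"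
        unfolding kernel_op_def
      proof (rule sum.cong[OF refl])
        fix \<iota> assume "\<iota> \<in> ?P"
        then have "ip (tensor_fun f) (?H \<iota>) = (\<Prod>m\<in>UNIV. ip (f m) (h m (\<iota> m)))"
          by (intro ip_tensor_fun f h) auto
        then show "ip (tensor_fun f) (?H \<iota>) * ?E \<iota> x = (\<Prod>m\<in>UNIV. ip (f m) (h m (\<iota> m)) * e m (\<iota> m) (x $ m))"
          by (simp add: prod.distrib tensor_fun_def)
      qed
      also have "\<dots> = (\<Prod>m\<in>UNIV. \<Sum>i<N m. ip (f m) (h m i) * e m i (x $ m))"
        by (rule prod_sum_PiE[symmetric]) auto
      finally show ?thesis by (simp add: tensor_fun_def)
    qed
    then have *: "kernel_op N e h (tensor_fun f) = tensor_fun (\<lambda>m t. \<Sum>i<N m. ip (f m) (h m i) * e m i t)"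
      by (rule ext)
    show ?thesis unfolding *
      using rep f A e by (intro L2_eq_tensor_fun L2_sum L2_cmult) (auto intro: L2_eq_sym)
  qed
  ultimately show ?thesis unfolding is_tensor_op_def by blast
qed

text \<open>The adjoint of a tensor product operator maps a product to the product of the adjoints.
  On product arguments this is a computation; as the products are total, it determines the adjoint
  function and so covers every \<open>u\<close>.\<close>

lemma tensor_op_pairing:
  fixes A :: "'n::finite \<Rightarrow> (real \<Rightarrow> real) \<Rightarrow> real \<Rightarrow> real"
  assumes T: "is_tensor_op A T" and A: "\<And>m f. f \<in> L2 \<Longrightarrow> A m f \<in> L2"
    and \<psi>: "\<And>m. \<psi> m \<in> L2" and w: "\<And>m. w m \<in> L2"
    and adj: "\<And>m f. f \<in> L2 \<Longrightarrow> ip (A m f) (\<psi> m) = ip f (w m)" and u: "u \<in> L2"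
  shows "ip (T u) (tensor_fun \<psi>) = ip u (tensor_fun w)"
proof -
  have bT: "bounded_L2_op T" and
    tT: "\<And>f. (\<And>m. f m \<in> L2) \<Longrightarrow> L2_eq (T (tensor_fun f)) (tensor_fun (\<lambda>m. A m (f m)))"
    using T by (auto simp: is_tensor_op_def)
  note \<psi>L2 = L2_tensor_fun[of \<psi>, OF \<psi>] and wL2 = L2_tensor_fun[of w, OF w]
  obtain h where h: "h \<in> L2" "\<And>f. f \<in> L2 \<Longrightarrow> ip (T f) (tensor_fun \<psi>) = ip f h"
    using bounded_L2_op_adjoint[OF bT \<psi>L2] by blast
  have "L2_eq (\<lambda>x. h x - tensor_fun w x) (\<lambda>x. 0)"
  proof (rule L2_eq_0_if_orthogonal_tensors)
    show "(\<lambda>x. h x - tensor_fun w x) \<in> L2" by (intro L2_diff h wL2)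
    fix f :: "'n \<Rightarrow> real \<Rightarrow> real" assume f: "\<And>m. f m \<in> L2"
    note fL2 = L2_tensor_fun[of f, OF f]
    have "ip (tensor_fun f) h = ip (T (tensor_fun f)) (tensor_fun \<psi>)" using h(2)[OF fL2] by simp
    also have "\<dots> = ip (tensor_fun (\<lambda>m. A m (f m))) (tensor_fun \<psi>)"
      by (rule ip_cong_L2_eq_left[OF tT[of f, OF f] bounded_L2_op_L2[OF bT fL2]
            L2_tensor_fun[of "\<lambda>m. A m (f m)", OF A[OF f]] \<psi>L2])
    also have "\<dots> = ip (tensor_fun f) (tensor_fun w)"
      by (simp add: ip_tensor_fun A f \<psi> w adj)
    finally show "ip (\<lambda>x. h x - tensor_fun w x) (tensor_fun f) = 0"
      using ip_diff_left[OF h(1) wL2 fL2] by (simp add: ip_commute[of _ "tensor_fun f"])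
  qed
  then have "L2_eq h (tensor_fun w)" by (simp add: L2_eq_def)
  then have "ip h u = ip (tensor_fun w) u" by (intro ip_cong_L2_eq_left h wL2 u)
  then show ?thesis using h(2)[OF u] by (simp add: ip_commute)
qed

text \<open>Lets the operator selected by \<open>tensor_op\<close> be exchanged for an explicit
  \<open>kernel_op\<close>.\<close>

lemma is_tensor_op_unique:
  fixes A :: "'n::finite \<Rightarrow> (real \<Rightarrow> real) \<Rightarrow> real \<Rightarrow> real"
  assumes T: "is_tensor_op A T" and T': "is_tensor_op A T'" and A: "\<And>m. bounded_L2_op (A m)"
    and u: "u \<in> L2"
  shows "L2_eq (T u) (T' u)"
proof -
  have b: "T u \<in> L2" "T' u \<in> L2"
    using T T' u by (auto simp: is_tensor_op_def intro: bounded_L2_op_L2)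
  have "L2_eq (\<lambda>x. T u x - T' u x) (\<lambda>x. 0)"
  proof (rule L2_eq_0_if_orthogonal_tensors)
    show "(\<lambda>x. T u x - T' u x) \<in> L2" by (intro L2_diff b)
    fix \<psi> :: "'n \<Rightarrow> real \<Rightarrow> real" assume \<psi>: "\<And>m. \<psi> m \<in> L2"
    have "\<forall>m. \<exists>w\<in>L2. \<forall>f\<in>L2. ip (A m f) (\<psi> m) = ip f w"
      using bounded_L2_op_adjoint A \<psi> by blast
    then obtain w where w: "\<And>m. w m \<in> L2" "\<And>m f. f \<in> L2 \<Longrightarrow> ip (A m f) (\<psi> m) = ip f (w m)"
      by metis
    note pair = tensor_op_pairing[OF _ bounded_L2_op_L2[OF A] \<psi> w u]
    show "ip (\<lambda>x. T u x - T' u x) (tensor_fun \<psi>) = 0"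
      using b L2_tensor_fun[of \<psi>, OF \<psi>] by (simp add: ip_diff_left pair[OF T] pair[OF T'])
  qed
  then show ?thesis by (simp add: L2_eq_def)
qed

section \<open>Repeated weak derivatives of tensor products\<close>

abbreviation partials :: "'n list \<Rightarrow> (real ^ 'n \<Rightarrow> real) \<Rightarrow> real ^ 'n \<Rightarrow> real" where
  "partials ms \<equiv> foldr partial (map (\<lambda>m. axis m 1) ms)"

lemma test_funs_partials: "\<phi> \<in> test_funs \<Longrightarrow> partials ms \<phi> \<in> test_funs"
  by (induction ms) (auto intro: test_funs_partial)

lemma partials_tensor_fun:
  fixes \<psi> :: "'n::finite \<Rightarrow> real \<Rightarrow> real"
  assumes "\<And>m. \<psi> m \<in> test_funs"
  shows "partials ms (tensor_fun \<psi>) = tensor_fun (\<lambda>m. (partial 1 ^^ count_list ms m) (\<psi> m))"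
proof (induction ms)
  case (Cons m ms)
  have "partials (m # ms) (tensor_fun \<psi>)
      = partial (axis m 1) (tensor_fun (\<lambda>m. (partial 1 ^^ count_list ms m) (\<psi> m)))"
    by (simp add: Cons.IH)
  also have "\<dots> = tensor_fun ((\<lambda>m. (partial 1 ^^ count_list ms m) (\<psi> m))
      (m := partial 1 ((partial 1 ^^ count_list ms m) (\<psi> m))))"
    by (rule partial_tensor_fun) (intro test_funs_derivs assms)
  also have "\<dots> = tensor_fun (\<lambda>j. (partial 1 ^^ count_list (m # ms) j) (\<psi> j))"
    by (rule arg_cong[of _ _ tensor_fun]) auto
  finally show ?case .
qed simp

fun weakly_diff :: "nat \<Rightarrow> (real \<Rightarrow> real) \<Rightarrow> bool" where
  "weakly_diff 0 f \<longleftrightarrow> f \<in> L2"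
| "weakly_diff (Suc k) f \<longleftrightarrow> f \<in> L2 \<and> (\<exists>g. weak_deriv f g \<and> weakly_diff k g)"

lemma weakly_diff_L2: "weakly_diff k f \<Longrightarrow> f \<in> L2"
  by (cases k) auto

text \<open>The head of the list is the outermost derivative of \<open>\<phi>\<close>, hence the
  first to be moved onto its factor of \<open>f\<close>. The signs are absorbed in
  \<open>g\<close>.\<close>

lemma weak_partials_tensor_fun:
  fixes f :: "'n::finite \<Rightarrow> real \<Rightarrow> real"
  assumes "\<And>m. weakly_diff (count_list ms m) (f m)"
  shows "\<exists>g\<in>L2. \<forall>\<phi>\<in>test_funs. ip (tensor_fun f) (partials ms \<phi>) = ip g \<phi>"
  using assms
proof (induction ms arbitrary: f)
  case Nil
  then show ?case by (auto intro!: L2_tensor_fun)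
next
  case (Cons m ms)
  have fL2: "f j \<in> L2" for j using Cons.prems weakly_diff_L2 by blast
  obtain g where g: "weak_deriv (f m) g" "weakly_diff (count_list ms m) g"
    using Cons.prems[of m] by auto
  have "weakly_diff (count_list ms j) ((f(m := g)) j)" for j
    using g(2) Cons.prems[of j] by auto
  from Cons.IH[OF this] obtain k where k: "k \<in> L2"
    "\<And>\<phi>. \<phi> \<in> test_funs \<Longrightarrow> ip (tensor_fun (f(m := g))) (partials ms \<phi>) = ip k \<phi>" by blast
  have "ip (tensor_fun f) (partials (m # ms) \<phi>) = ip (\<lambda>x. (-1) * k x) \<phi>" if \<phi>: "\<phi> \<in> test_funs" for \<phi>
    using weak_deriv_tensor_fun[of f g m "partials ms \<phi>"] fL2 g weakly_diff_L2[OF g(2)]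
      test_funs_partials[OF \<phi>] k(2)[OF \<phi>]
    unfolding ip_cmult_left by simp
  then show ?case using L2_cmult[OF k(1)] by blast
qed

section \<open>The quasi-interpolation operators and their commutation by weights\<close>

locale quasi_interpolation =
  fixes S :: "'n::{finite,linorder} \<Rightarrow> nat \<Rightarrow> (real \<Rightarrow> real) set"
    and p :: "'n \<Rightarrow> nat \<Rightarrow> nat \<Rightarrow> (real \<Rightarrow> real) \<Rightarrow> (real \<Rightarrow> real)"
  assumes fin_dim: "\<And>m a. a \<le> 2 \<Longrightarrow> fin_dim_L2_subspace (S m a)"
    and S_deriv: "\<And>m a f. a \<le> 1 \<Longrightarrow> f \<in> S m a \<Longrightarrow> \<exists>g \<in> S m (a + 1). weak_deriv f g"
    and p_bounded: "\<And>m i j. i \<le> 1 \<Longrightarrow> j \<le> 1 \<Longrightarrow> bounded_L2_op (p m i j)"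
    and p_S: "\<And>m i j f. i \<le> 1 \<Longrightarrow> j \<le> 1 \<Longrightarrow> f \<in> L2 \<Longrightarrow> p m i j f \<in> S m (i + j)"
    and p_commute: "\<And>m j u u'. j \<le> 1 \<Longrightarrow> u \<in> L2 \<Longrightarrow> u' \<in> L2 \<Longrightarrow> weak_deriv u u' \<Longrightarrow>
           weak_deriv (p m 0 j u) (p m 1 j u')"
    and p_sym: "\<And>m f. f \<in> L2 \<Longrightarrow> L2_eq (p m 0 1 f) (p m 1 0 f)"
begin

abbreviation interp :: "'n set \<Rightarrow> 'n set \<Rightarrow> ((real, 'n) vec \<Rightarrow> real) \<Rightarrow> (real, 'n) vec \<Rightarrow> real" where
  "interp \<sigma> \<tau> \<equiv> tensor_op (\<lambda>m. p m (chi m \<sigma>) (chi m \<tau>))"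

lemma chi_le_1 [simp]: "chi m \<sigma> \<le> 1"
  by (simp add: chi_def)

text \<open>Each derivative moves one step along the scale of spaces, which ends at index
  two.\<close>

lemma S_weakly_diff:
  assumes "f \<in> S m a" "a + k \<le> 2"
  shows "weakly_diff k f"
  using assms
proof (induction k arbitrary: f a)
  case 0
  then show ?case using fin_dim[of a m] by (auto simp: fin_dim_L2_subspace_def)
next
  case (Suc k)
  then obtain g where "g \<in> S m (a + 1)" "weak_deriv f g" using S_deriv[of a f m] by auto
  then show ?case using Suc.IH[of g "a + 1"] Suc.prems fin_dim[of a m]
    by (auto simp: fin_dim_L2_subspace_def)
qed

text \<open>One representation per direction, glued into a kernel operator. That the factors
  \<open>e m i\<close> lie in the given spaces is the source of the smoothness of
  interpolants.\<close>

lemma interp_representation: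
  "\<exists>N e h. (\<forall>m. \<forall>i<N m. e m i \<in> S m (chi m \<sigma> + chi m \<tau>) \<and> h m i \<in> L2) \<and>
    is_tensor_op (\<lambda>m. p m (chi m \<sigma>) (chi m \<tau>)) (kernel_op N e h)"
proof -
  have le2: "chi m \<sigma> + chi m \<tau> \<le> 2" for m
    using chi_le_1[of m \<sigma>] chi_le_1[of m \<tau>] by linarith
  have "\<forall>m. \<exists>N e h. (\<forall>i<N. e i \<in> S m (chi m \<sigma> + chi m \<tau>) \<and> h i \<in> L2) \<and>
    (\<forall>f\<in>L2. L2_eq (p m (chi m \<sigma>) (chi m \<tau>) f) (\<lambda>x. \<Sum>i<(N::nat). ip f (h i) * e i x))"
    by (intro allI finite_rank_representation fin_dim le2 p_bounded chi_le_1 p_S)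
  then obtain N e h where "\<forall>m. (\<forall>i<N m. e m i \<in> S m (chi m \<sigma> + chi m \<tau>) \<and> h m i \<in> L2) \<and>
    (\<forall>f\<in>L2. L2_eq (p m (chi m \<sigma>) (chi m \<tau>) f) (\<lambda>x. \<Sum>i<(N m::nat). ip f (h m i) * e m i x))"
    unfolding choice_iff by blast
  then have eh: "\<And>m i. i < N m \<Longrightarrow> e m i \<in> S m (chi m \<sigma> + chi m \<tau>)"
      "\<And>m i. i < N m \<Longrightarrow> h m i \<in> L2"
    and rep: "\<And>m f. f \<in> L2 \<Longrightarrow>
      L2_eq (p m (chi m \<sigma>) (chi m \<tau>) f) (\<lambda>x. \<Sum>i<(N m::nat). ip f (h m i) * e m i x)"
    by auto
  have "is_tensor_op (\<lambda>m. p m (chi m \<sigma>) (chi m \<tau>)) (kernel_op N e h)"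
  proof (rule is_tensor_op_kernel_op)
    show "e m i \<in> L2" if "i < N m" for m i
      using eh(1)[OF that] fin_dim[OF le2] by (auto simp: fin_dim_L2_subspace_def)
    show "p m (chi m \<sigma>) (chi m \<tau>) f \<in> L2" if "f \<in> L2" for m f
      by (intro bounded_L2_op_L2[OF p_bounded] chi_le_1 that)
  qed (use eh rep in auto)
  then show ?thesis using eh by blast
qed

text \<open>The choice behind \<open>tensor_op\<close> has a candidate, hence the chosen operator
  has the required property.\<close>

lemma is_tensor_op_interp: "is_tensor_op (\<lambda>m. p m (chi m \<sigma>) (chi m \<tau>)) (interp \<sigma> \<tau>)"
  unfolding tensor_op_def using interp_representation[of \<sigma> \<tau>] by (metis someI_ex)

lemma interp_L2: "u \<in> L2 \<Longrightarrow> interp \<sigma> \<tau> u \<in> L2"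
  using is_tensor_op_interp[of \<sigma> \<tau>] by (auto simp: is_tensor_op_def intro: bounded_L2_op_L2)

text \<open>The weight of the interpolated coefficient and the order of differentiation draw on the
  same budget of two: functions in \<open>S m a\<close> have \<open>2 - a\<close> weak
  derivatives.\<close>

lemma interp_weak_partials:
  assumes u: "u \<in> L2" and ms: "\<And>m. chi m \<sigma> + chi m \<tau> + count_list ms m \<le> 2"
  shows "\<exists>g\<in>L2. \<forall>\<phi>\<in>test_funs. ip (interp \<sigma> \<tau> u) (partials ms \<phi>) = ip g \<phi>"
proof -
  obtain N e h where eh: "\<And>m i. i < N m \<Longrightarrow> e m i \<in> S m (chi m \<sigma> + chi m \<tau>)"
      "\<And>m i. i < N m \<Longrightarrow> h m i \<in> L2"
    and K: "is_tensor_op (\<lambda>m. p m (chi m \<sigma>) (chi m \<tau>)) (kernel_op N e h)"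
    using interp_representation[of \<sigma> \<tau>] by blast
  let ?P = "PiE UNIV (\<lambda>m. {..<N m})"
  let ?E = "\<lambda>\<iota>. tensor_fun (\<lambda>m. e m (\<iota> m))" and ?c = "\<lambda>\<iota>. ip u (tensor_fun (\<lambda>m. h m (\<iota> m)))"
  have wd: "weakly_diff (count_list ms m) (e m (\<iota> m))" if "\<iota> \<in> ?P" for m \<iota>
    using that eh(1)[of "\<iota> m" m] ms[of m] by (intro S_weakly_diff[of _ m "chi m \<sigma> + chi m \<tau>"]) auto
  have EL2: "?E \<iota> \<in> L2" if "\<iota> \<in> ?P" for \<iota>
    using wd[OF that] weakly_diff_L2 by (intro L2_tensor_fun) blast
  have "\<forall>\<iota>\<in>?P. \<exists>g\<in>L2. \<forall>\<phi>\<in>test_funs. ip (?E \<iota>) (partials ms \<phi>) = ip g \<phi>"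
    by (intro ballI weak_partials_tensor_fun wd)
  then obtain g where g: "\<And>\<iota>. \<iota> \<in> ?P \<Longrightarrow> g \<iota> \<in> L2"
    "\<And>\<iota> \<phi>. \<iota> \<in> ?P \<Longrightarrow> \<phi> \<in> test_funs \<Longrightarrow> ip (?E \<iota>) (partials ms \<phi>) = ip (g \<iota>) \<phi>"
    by metis
  define G where "G x = (\<Sum>\<iota>\<in>?P. ?c \<iota> * g \<iota> x)" for x
  have "ip (interp \<sigma> \<tau> u) (partials ms \<phi>) = ip G \<phi>" if \<phi>: "\<phi> \<in> test_funs" for \<phi>
  proof -
    have \<phi>L2: "partials ms \<phi> \<in> L2" "\<phi> \<in> L2" by (intro test_funs_L2 test_funs_partials \<phi>)+
    have "L2_eq (interp \<sigma> \<tau> u) (kernel_op N e h u)"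
      by (intro is_tensor_op_unique[OF is_tensor_op_interp K] p_bounded chi_le_1 u)
    moreover have KL2: "kernel_op N e h u \<in> L2"
      unfolding kernel_op_def by (intro L2_sum L2_cmult EL2)
    ultimately have "ip (interp \<sigma> \<tau> u) (partials ms \<phi>) = ip (kernel_op N e h u) (partials ms \<phi>)"
      by (intro ip_cong_L2_eq_left interp_L2 u \<phi>L2)
    also have "\<dots> = (\<Sum>\<iota>\<in>?P. ip (\<lambda>x. ?c \<iota> * ?E \<iota> x) (partials ms \<phi>))"
      unfolding kernel_op_def by (intro ip_sum_left L2_cmult EL2 \<phi>L2)
    also have "\<dots> = (\<Sum>\<iota>\<in>?P. ip (\<lambda>x. ?c \<iota> * g \<iota> x) \<phi>)"
      unfolding ip_cmult_left by (intro sum.cong) (auto simp: g(2)[OF _ \<phi>])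
    also have "\<dots> = ip G \<phi>"
      unfolding G_def by (intro ip_sum_left[symmetric] L2_cmult g \<phi>L2)
    finally show ?thesis .
  qed
  moreover have "G \<in> L2" unfolding G_def by (intro L2_sum L2_cmult g)
  ultimately show ?thesis by blast
qed

text \<open>By \<open>p_commute\<close>, one derivative passes from \<open>u\<close> to
  \<open>\<psi>\<close> while the operator loses one unit of weight. No boundary term arises because
  \<open>\<psi>\<close> has compact support, whatever \<open>u\<close> does at the end points; this
  property of the pairing is inherited by the adjoint functions \<open>w j\<close>.\<close>

lemma adjoint_deriv_chain:
  assumes a: "a \<le> 2" and \<psi>: "\<psi> \<in> test_funs"
  shows "\<exists>w. deriv_chain a w \<and> (\<forall>j\<le>a. \<forall>i\<le>1. \<forall>i'\<le>1. i + i' + j = a \<longrightarrow>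
    (\<forall>f\<in>L2. ip (p m i i' f) ((partial 1 ^^ j) \<psi>) = ip f (w j)))"
proof -
  \<comment> \<open>One operator for each weight: \<open>b = 0, 1, 2\<close> gives the index pairs
    \<open>(0, 0)\<close>, \<open>(0, 1)\<close> and \<open>(1, 1)\<close>, and \<open>p_sym\<close>
    identifies \<open>(1, 0)\<close> with \<open>(0, 1)\<close>.\<close>
  define q where "q b = p m (b div 2) (if b = 0 then 0 else 1)" for b :: nat
  have q_p: "ip (p m i i' f) g = ip (q (i + i') f) g"
    if ii': "i \<le> 1" "i' \<le> 1" and f: "f \<in> L2" and g: "g \<in> L2" for i i' f g
  proof -
    consider "i = 0" "i' = 0" | "i = 0" "i' = 1" | "i = 1" "i' = 0" | "i = 1" "i' = 1"
      using ii' by linarith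
    then show ?thesis
    proof cases
      case 3
      have "ip (p m 1 0 f) g = ip (p m 0 1 f) g"
        using f g by (intro ip_cong_L2_eq_left L2_eq_sym[OF p_sym] bounded_L2_op_L2[OF p_bounded]) auto
      then show ?thesis using 3 by (simp add: q_def)
    qed (auto simp: q_def)
  qed
  have q_bounded: "bounded_L2_op (q (a - j))" for j
    unfolding q_def using a by (intro p_bounded) auto
  have "\<forall>j. \<exists>w\<in>L2. \<forall>f\<in>L2. ip (q (a - j) f) ((partial 1 ^^ j) \<psi>) = ip f w"
    by (intro allI bounded_L2_op_adjoint q_bounded test_funs_L2 test_funs_derivs \<psi>)
  then obtain w where w: "\<And>j. w j \<in> L2"
    "\<And>j f. f \<in> L2 \<Longrightarrow> ip (q (a - j) f) ((partial 1 ^^ j) \<psi>) = ip f (w j)"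
    by metis
  have "ip u' (w j) = - ip u (w (Suc j))"
    if j: "j < a" and u: "u \<in> L2" "u' \<in> L2" "weak_deriv u u'" for j u u'
  proof -
    \<comment> \<open>The weights \<open>1 + ?i\<close> and \<open>0 + ?i\<close> are those used at
      \<open>j\<close> and \<open>Suc j\<close>, so the commuting pair with second index
      \<open>?i\<close> connects the two.\<close>
    let ?i = "a - Suc j"
    have i: "?i \<le> 1" "Suc ?i = a - j" using j a by auto
    have d: "weak_deriv (p m 0 ?i u) (p m 1 ?i u')" by (intro p_commute i u)
    have L: "(partial 1 ^^ j) \<psi> \<in> L2" "(partial 1 ^^ Suc j) \<psi> \<in> L2"
      by (intro test_funs_L2 test_funs_derivs \<psi>)+
    have "ip u' (w j) = ip (q (a - j) u') ((partial 1 ^^ j) \<psi>)" by (rule w(2)[OF u(2), symmetric])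
    also have "\<dots> = ip (p m 1 ?i u') ((partial 1 ^^ j) \<psi>)"
      using q_p[of 1 ?i u', OF _ i(1) u(2) L(1)] i by simp
    also have "\<dots> = - ip (p m 0 ?i u) ((partial 1 ^^ Suc j) \<psi>)"
      using d test_funs_derivs[OF \<psi>, of j] by (simp add: weak_deriv_iff)
    also have "ip (p m 0 ?i u) ((partial 1 ^^ Suc j) \<psi>) = ip u (w (Suc j))"
      using q_p[of 0 ?i u, OF _ i(1) u(1) L(2)] w(2)[OF u(1), of "Suc j"] by simp
    finally show ?thesis .
  qed
  then have "deriv_chain a w" using w(1) by (simp add: deriv_chain_def)
  moreover have "ip (p m i i' f) ((partial 1 ^^ j) \<psi>) = ip f (w j)"
    if "i \<le> 1" "i' \<le> 1" "i + i' + j = a" "f \<in> L2" for i i' j f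
  proof -
    have "i + i' = a - j" using that by simp
    then show ?thesis
      using q_p[OF that(1,2,4) test_funs_L2[OF test_funs_derivs[OF \<psi>]], of j] w(2)[OF that(4), of j] by simp
  qed
  ultimately show ?thesis by blast
qed

text \<open>In every term the weight of the operator and the number of derivatives add up to the
  target weight. One chain per direction therefore serves all terms and \<open>g\<close> alike, and
  the identity for \<open>g\<close> can be transported through it.\<close>

lemma interp_commutes_weighted:
  fixes u :: "'t \<Rightarrow> (real, 'n) vec \<Rightarrow> real"
  assumes T: "finite T" and u: "\<And>t. t \<in> T \<Longrightarrow> u t \<in> L2" and g: "g \<in> L2"
    and weight: "\<And>t m. t \<in> T \<Longrightarrow>
      chi m (\<sigma> t) + chi m (\<tau> t) + count_list (ms t) m = chi m \<sigma>0 + chi m \<tau>0"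
    and eq: "\<And>\<phi>. \<phi> \<in> test_funs \<Longrightarrow> ip g \<phi> = (\<Sum>t\<in>T. c t * ip (u t) (partials (ms t) \<phi>))"
    and \<phi>: "\<phi> \<in> test_funs"
  shows "ip (interp \<sigma>0 \<tau>0 g) \<phi> = (\<Sum>t\<in>T. c t * ip (interp (\<sigma> t) (\<tau> t) (u t)) (partials (ms t) \<phi>))"
proof -
  define \<alpha> where "\<alpha> m = chi m \<sigma>0 + chi m \<tau>0" for m
  have \<alpha>: "\<alpha> m \<le> 2" for m using chi_le_1[of m \<sigma>0] chi_le_1[of m \<tau>0] by (simp add: \<alpha>_def)
  have "\<forall>t\<in>T. \<exists>k\<in>L2. \<forall>\<phi>\<in>test_funs. ip (interp (\<sigma> t) (\<tau> t) (u t)) (partials (ms t) \<phi>) = ip k \<phi>"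
    using weight \<alpha> by (intro ballI interp_weak_partials u) (simp_all add: \<alpha>_def)
  then obtain k where "\<forall>t\<in>T. k t \<in> L2 \<and>
      (\<forall>\<phi>\<in>test_funs. ip (interp (\<sigma> t) (\<tau> t) (u t)) (partials (ms t) \<phi>) = ip (k t) \<phi>)"
    unfolding Bex_def bchoice_iff by blast
  then have k: "\<And>t. t \<in> T \<Longrightarrow> k t \<in> L2"
    "\<And>t \<phi>. t \<in> T \<Longrightarrow> \<phi> \<in> test_funs \<Longrightarrow> ip (interp (\<sigma> t) (\<tau> t) (u t)) (partials (ms t) \<phi>) = ip (k t) \<phi>"
    by auto
  \<comment> \<open>Each summand is an \<open>L2\<close> function by the smoothness of the
    interpolants, so the claim becomes that one \<open>L2\<close> function vanishes.\<close>
  define D where "D x = (\<Sum>t\<in>T. c t * k t x) - interp \<sigma>0 \<tau>0 g x" for x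
  have sL2: "(\<lambda>x. \<Sum>t\<in>T. c t * k t x) \<in> L2" by (intro L2_sum L2_cmult k)
  have DL2: "D \<in> L2" unfolding D_def by (intro L2_diff sL2 interp_L2 g)
  have D_ip: "ip D \<phi> = (\<Sum>t\<in>T. c t * ip (interp (\<sigma> t) (\<tau> t) (u t)) (partials (ms t) \<phi>)) - ip (interp \<sigma>0 \<tau>0 g) \<phi>"
    if \<phi>: "\<phi> \<in> test_funs" for \<phi>
  proof -
    have \<phi>L2: "\<phi> \<in> L2" by (rule test_funs_L2[OF \<phi>])
    have "ip D \<phi> = ip (\<lambda>x. \<Sum>t\<in>T. c t * k t x) \<phi> - ip (interp \<sigma>0 \<tau>0 g) \<phi>"
      unfolding D_def by (intro ip_diff_left sL2 interp_L2 g \<phi>L2)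
    also have "ip (\<lambda>x. \<Sum>t\<in>T. c t * k t x) \<phi> = (\<Sum>t\<in>T. ip (\<lambda>x. c t * k t x) \<phi>)"
      by (intro ip_sum_left L2_cmult k \<phi>L2)
    finally show ?thesis using k(2)[OF _ \<phi>] by simp
  qed
  have D_test: "ip D (tensor_fun \<psi>) = 0" if \<psi>: "\<And>m. \<psi> m \<in> test_funs" for \<psi>
  proof -
    have "\<forall>m. \<exists>w. deriv_chain (\<alpha> m) w \<and> (\<forall>j\<le>\<alpha> m. \<forall>i\<le>1. \<forall>i'\<le>1. i + i' + j = \<alpha> m \<longrightarrow>
      (\<forall>f\<in>L2. ip (p m i i' f) ((partial 1 ^^ j) (\<psi> m)) = ip f (w j)))"
      by (intro allI adjoint_deriv_chain \<alpha> \<psi>)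
    then obtain W where "\<forall>m. deriv_chain (\<alpha> m) (W m) \<and> (\<forall>j\<le>\<alpha> m. \<forall>i\<le>1. \<forall>i'\<le>1. i + i' + j = \<alpha> m \<longrightarrow>
      (\<forall>f\<in>L2. ip (p m i i' f) ((partial 1 ^^ j) (\<psi> m)) = ip f (W m j)))"
      unfolding choice_iff by blast
    then have W: "\<And>m. deriv_chain (\<alpha> m) (W m)"
      "\<And>m j i i' f. j \<le> \<alpha> m \<Longrightarrow> i \<le> 1 \<Longrightarrow> i' \<le> 1 \<Longrightarrow> i + i' + j = \<alpha> m \<Longrightarrow> f \<in> L2 \<Longrightarrow>
        ip (p m i i' f) ((partial 1 ^^ j) (\<psi> m)) = ip f (W m j)"
      by auto
    \<comment> \<open>The adjoints lead to the chain at index \<open>\<gamma> m\<close>,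
      independently of how the weight is split between the two index sets.\<close>
    have pair: "ip (interp \<sigma>' \<tau>' v) (tensor_fun (\<lambda>m. (partial 1 ^^ \<gamma> m) (\<psi> m))) = ip v (tensor_fun (\<lambda>m. W m (\<gamma> m)))"
      if v: "v \<in> L2" and \<gamma>: "\<And>m. chi m \<sigma>' + chi m \<tau>' + \<gamma> m = \<alpha> m" for \<sigma>' \<tau>' \<gamma> v
    proof (rule tensor_op_pairing[OF is_tensor_op_interp _ _ _ _ v])
      fix m
      show "p m (chi m \<sigma>') (chi m \<tau>') f \<in> L2" if "f \<in> L2" for f
        by (intro bounded_L2_op_L2[OF p_bounded] chi_le_1 that)
      show "(partial 1 ^^ \<gamma> m) (\<psi> m) \<in> L2" by (intro test_funs_L2 test_funs_derivs \<psi>)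
      have le: "\<gamma> m \<le> \<alpha> m" using \<gamma>[of m] by simp
      then show "W m (\<gamma> m) \<in> L2" using W(1)[of m] by (simp add: deriv_chain_def)
      show "ip (p m (chi m \<sigma>') (chi m \<tau>') f) ((partial 1 ^^ \<gamma> m) (\<psi> m)) = ip f (W m (\<gamma> m))" if "f \<in> L2" for f
        by (intro W(2) le chi_le_1 \<gamma> that)
    qed
    \<comment> \<open>The identity for \<open>g\<close> is made homogeneous: \<open>None\<close>
      carries \<open>g\<close> with coefficient \<open>-1\<close> and no derivatives.\<close>
    define T' where "T' = insert None (Some ` T)"
    define u' where "u' t = (case t of None \<Rightarrow> g | Some t \<Rightarrow> u t)" for t
    define c' where "c' t = (case t of None \<Rightarrow> -1 | Some t \<Rightarrow> c t)" for t
    define \<gamma> where "\<gamma> t m = (case t of None \<Rightarrow> 0 | Some t \<Rightarrow> count_list (ms t) m)" for t m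
    have sum_T': "(\<Sum>t\<in>T'. F t) = F None + (\<Sum>t\<in>T. F (Some t))" for F :: "'t option \<Rightarrow> real"
      using T by (simp add: T'_def sum.reindex)
    have "(\<Sum>t\<in>T'. c' t * ip (u' t) (tensor_fun (\<lambda>m. W m (\<gamma> t m)))) = 0"
    proof (rule tensor_deriv_chain_annihilated[OF \<alpha> _ _ _ _ W(1)])
      show "finite T'" using T by (simp add: T'_def)
      show "u' t \<in> L2" if "t \<in> T'" for t using that u g by (auto simp: T'_def u'_def)
      show "\<gamma> t m \<le> \<alpha> m" if "t \<in> T'" for t m
        using that weight[of _ m] by (auto simp: T'_def \<gamma>_def \<alpha>_def) (metis le_add2)
      fix \<theta> :: "'n \<Rightarrow> real \<Rightarrow> real" assume \<theta>: "\<And>m. \<theta> m \<in> test_funs"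
      show "(\<Sum>t\<in>T'. c' t * ip (u' t) (tensor_fun (\<lambda>m. (partial 1 ^^ \<gamma> t m) (\<theta> m)))) = 0"
        using eq[OF test_funs_tensor_fun[of \<theta>, OF \<theta>]]
        by (simp add: sum_T' c'_def u'_def \<gamma>_def partials_tensor_fun[OF \<theta>])
    qed
    then have "(\<Sum>t\<in>T. c t * ip (u t) (tensor_fun (\<lambda>m. W m (count_list (ms t) m)))) = ip g (tensor_fun (\<lambda>m. W m 0))"
      by (simp add: sum_T' c'_def u'_def \<gamma>_def)
    moreover have "ip (interp (\<sigma> t) (\<tau> t) (u t)) (partials (ms t) (tensor_fun \<psi>))
        = ip (u t) (tensor_fun (\<lambda>m. W m (count_list (ms t) m)))" if "t \<in> T" for t
      unfolding partials_tensor_fun[OF \<psi>] using weight[OF that] by (intro pair u that) (simp add: \<alpha>_def)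
    moreover have "ip (interp \<sigma>0 \<tau>0 g) (tensor_fun \<psi>) = ip g (tensor_fun (\<lambda>m. W m 0))"
      using pair[OF g, of \<sigma>0 \<tau>0 "\<lambda>_. 0"] by (simp add: \<alpha>_def)
    ultimately show ?thesis using D_ip[OF test_funs_tensor_fun[of \<psi>, OF \<psi>]] by simp
  qed
  have "L2_eq D (\<lambda>x. 0)"
  proof (rule L2_eq_0_if_orthogonal_tensors[OF DL2])
    fix w :: "'n \<Rightarrow> real \<Rightarrow> real" assume w: "\<And>m. w m \<in> L2"
    \<comment> \<open>At order zero a chain is just a square-integrable function, so orthogonality
      to products of test functions extends to all products.\<close>
    have "(\<Sum>t\<in>{()}. 1 * ip D (tensor_fun (\<lambda>m. w m))) = 0"
      by (rule tensor_deriv_chain_annihilated[of "\<lambda>_. 0" "{()}" "\<lambda>_. D" "\<lambda>_ _. 0" "\<lambda>_. 1" "\<lambda>m _. w m"])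
        (use DL2 D_test w in \<open>auto simp: deriv_chain_def\<close>)
    then show "ip D (tensor_fun w) = 0" by simp
  qed
  then have "ip D \<phi> = ip (\<lambda>x. 0) \<phi>" by (intro ip_cong_L2_eq_left DL2 L2_zero test_funs_L2 \<phi>)
  then show ?thesis using D_ip[OF \<phi>] by simp
qed

end


section \<open>Alternating forms in coordinates\<close>

abbreviation ax :: "'n \<Rightarrow> real ^ 'n::finite" where
  "ax m \<equiv> axis m 1"

lemma alternating_form_length: "alternating_form k \<omega> \<Longrightarrow> length vs \<noteq> k \<Longrightarrow> \<omega> vs = 0"
  by (simp add: alternating_form_def)

lemma alternating_form_linear:
  fixes \<omega> :: "'n::finite form"
  assumes "alternating_form k \<omega>"
  shows "linear (\<lambda>v. \<omega> (xs @ v # ys))"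
proof (cases "length (xs @ 0 # ys) = k")
  case True
  then have "linear (\<lambda>v. \<omega> ((xs @ 0 # ys)[length xs := v]))"
    using assms unfolding alternating_form_def by (metis length_append length_Cons less_add_Suc1 add_Suc_right)
  then show ?thesis by simp
next
  case False
  then have "\<omega> (xs @ v # ys) = 0" for v using assms by (intro alternating_form_length) auto
  then show ?thesis by (simp add: linear_zero)
qed

lemma alternating_form_repeat:
  assumes "alternating_form k \<omega>" "i < j" "j < length vs" "vs ! i = vs ! j"
  shows "\<omega> vs = 0"
  using assms unfolding alternating_form_def by (cases "length vs = k") auto

lemma alternating_form_repeat_append:
  assumes "alternating_form k \<omega>"
  shows "\<omega> (xs @ v # ys @ v # zs) = 0"
proof (rule alternating_form_repeat[OF assms])
  show "length xs < Suc (length xs + length ys)" by simp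
  show "(xs @ v # ys @ v # zs) ! length xs = (xs @ v # ys @ v # zs) ! Suc (length xs + length ys)"
    using nth_append_length[of "xs @ v # ys" v zs] by simp
qed simp

text \<open>Polarisation: the value with \<open>a + b\<close> in both places vanishes and is
  expanded.\<close>

lemma alternating_form_swap:
  assumes "alternating_form k \<omega>"
  shows "\<omega> (xs @ a # b # zs) = - \<omega> (xs @ b # a # zs)"
proof -
  have add1: "\<omega> (xs @ (u + v) # ys) = \<omega> (xs @ u # ys) + \<omega> (xs @ v # ys)" for u v xs ys
    using linear_add[OF alternating_form_linear[OF assms]] .
  have rep: "\<omega> (xs @ v # v # zs) = 0" for v
    using alternating_form_repeat_append[OF assms, of xs v "[]" zs] by simp
  have "0 = \<omega> (xs @ (a + b) # (a + b) # zs)" by (simp add: rep)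
  also have "\<dots> = \<omega> (xs @ a # (a + b) # zs) + \<omega> (xs @ b # (a + b) # zs)" by (rule add1)
  also have "\<omega> (xs @ a # (a + b) # zs) = \<omega> (xs @ a # a # zs) + \<omega> (xs @ a # b # zs)"
    using add1[of "xs @ [a]"] by simp
  also have "\<omega> (xs @ b # (a + b) # zs) = \<omega> (xs @ b # a # zs) + \<omega> (xs @ b # b # zs)"
    using add1[of "xs @ [b]"] by simp
  finally show ?thesis by (simp add: rep)
qed

lemma alternating_form_move:
  assumes "alternating_form k \<omega>"
  shows "\<omega> (xs @ a # ys @ zs) = (-1) ^ length ys * \<omega> (xs @ ys @ a # zs)"
proof (induction ys arbitrary: xs)
  case (Cons y ys)
  have "\<omega> (xs @ a # y # ys @ zs) = - \<omega> ((xs @ [y]) @ a # ys @ zs)"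
    using alternating_form_swap[OF assms, of xs a y "ys @ zs"] by simp
  also have "\<dots> = - ((-1) ^ length ys * \<omega> ((xs @ [y]) @ ys @ a # zs))"
    by (simp only: Cons.IH)
  finally show ?case by simp
qed simp

lemma alternating_form_zero: "alternating_form k (\<lambda>vs. 0)"
  by (simp add: alternating_form_def linear_zero)

lemma alternating_form_add:
  "alternating_form k \<omega> \<Longrightarrow> alternating_form k \<eta> \<Longrightarrow> alternating_form k (\<lambda>vs. \<omega> vs + \<eta> vs)"
  unfolding alternating_form_def by (auto intro!: linear_compose_add)

lemma linear_cmult: "linear f \<Longrightarrow> linear (\<lambda>x. (c::real) * f x)"
  using linear_compose_scale_right[of f c] by simp

lemma alternating_form_cmult:
  "alternating_form k \<omega> \<Longrightarrow> alternating_form k (\<lambda>vs. c * \<omega> vs)"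
  unfolding alternating_form_def by (auto intro!: linear_cmult)

lemma alternating_form_sum:
  "(\<And>i. i \<in> I \<Longrightarrow> alternating_form k (\<omega> i)) \<Longrightarrow> alternating_form k (\<lambda>vs. \<Sum>i\<in>I. \<omega> i vs)"
  by (induction I rule: infinite_finite_induct)
    (auto intro: alternating_form_zero alternating_form_add)

lemma alternating_form_Cons:
  assumes "alternating_form (Suc k) \<omega>"
  shows "alternating_form k (\<lambda>vs. \<omega> (v # vs))"
  unfolding alternating_form_def
proof (intro conjI allI impI)
  fix vs :: "(real ^ 'a) list" and i j
  show "length vs \<noteq> k \<Longrightarrow> \<omega> (v # vs) = 0"
    using alternating_form_length[OF assms, of "v # vs"] by simp
  assume l: "length vs = k"
  show "i < k \<Longrightarrow> linear (\<lambda>u. \<omega> (v # vs[i := u]))"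
    using alternating_form_linear[OF assms, of "v # take i vs" "drop (Suc i) vs"] l
    by (simp add: upd_conv_take_nth_drop)
  show "i < j \<Longrightarrow> j < k \<Longrightarrow> vs ! i = vs ! j \<Longrightarrow> \<omega> (v # vs) = 0"
    using alternating_form_repeat[OF assms, of "Suc i" "Suc j" "v # vs"] l by simp
qed

lemma length_remove_nth: "i < length xs \<Longrightarrow> length (remove_nth i xs) = length xs - 1"
  by (simp add: remove_nth_def)

lemma nth_remove_nth:
  "i < length xs \<Longrightarrow> q < length xs - 1 \<Longrightarrow> remove_nth i xs ! q = (if q < i then xs ! q else xs ! Suc q)"
  by (auto simp: remove_nth_def nth_append min_def)

lemma remove_nth_map: "remove_nth i (map f xs) = map f (remove_nth i xs)"
  by (simp add: remove_nth_def take_map drop_map)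

lemma remove_nth_append_Cons: "remove_nth (length xs) (xs @ a # ys) = xs @ ys"
  by (simp add: remove_nth_def)

lemma remove_nth_update_same: "remove_nth i (xs[i := v]) = remove_nth i xs"
  by (simp add: remove_nth_def)

lemma remove_nth_update_other:
  assumes "i < length xs" "l < length xs" "i \<noteq> l"
  shows "remove_nth l (xs[i := v]) = (remove_nth l xs)[(if i < l then i else i - 1) := v]"
  using assms
  by (intro nth_equalityI)
    (auto simp: length_remove_nth nth_remove_nth nth_list_update split: if_splits)

text \<open>The common shape of \<open>wedge1\<close> and \<open>s_map\<close>, so that alternation
  is proved once; the first argument of \<open>\<Phi>\<close> is the vector removed from the
  list.\<close>

definition alt_sum :: "(real ^ 'n::finite \<Rightarrow> 'n form) \<Rightarrow> 'n form" where
  "alt_sum \<Phi> vs = (\<Sum>i<length vs. (-1) ^ i * \<Phi> (vs ! i) (remove_nth i vs))"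

text \<open>If \<open>v\<^sub>i = v\<^sub>j\<close>, the summands \<open>i\<close> and \<open>j\<close> cancel and the other ones vanish.\<close>

lemma alternating_form_alt_sum:
  fixes \<Phi> :: "real ^ 'n::finite \<Rightarrow> 'n form"
  assumes alt: "\<And>v. alternating_form k (\<Phi> v)" and lin: "\<And>ws. linear (\<lambda>v. \<Phi> v ws)"
  shows "alternating_form (Suc k) (alt_sum \<Phi>)"
  unfolding alternating_form_def
proof (intro conjI allI impI)
  fix vs :: "(real ^ 'n) list" assume "length vs \<noteq> Suc k"
  then show "alt_sum \<Phi> vs = 0"
    unfolding alt_sum_def
    by (intro sum.neutral ballI) (auto simp: length_remove_nth intro: alternating_form_length[OF alt])
next
  fix vs :: "(real ^ 'n) list" and i assume l: "length vs = Suc k" "i < Suc k"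
  have "linear (\<lambda>v. \<Phi> (vs[i := v] ! j) (remove_nth j (vs[i := v])))" if j: "j < Suc k" for j
  proof (cases "j = i")
    case True
    then show ?thesis using lin l by (simp add: remove_nth_update_same)
  next
    case False
    let ?i = "if i < j then i else i - 1"
    have "?i < k" using False j l by auto
    moreover have "length (remove_nth j vs) = k" using l j by (simp add: length_remove_nth)
    ultimately have "linear (\<lambda>v. \<Phi> (vs ! j) ((remove_nth j vs)[?i := v]))"
      using alt[of "vs ! j"] unfolding alternating_form_def by blast
    moreover have "remove_nth j (vs[i := v]) = (remove_nth j vs)[?i := v]" for v
      using False j l by (intro remove_nth_update_other) auto
    ultimately show ?thesis using False by simp
  qed
  then have "linear (\<lambda>v. \<Sum>j<Suc k. (-1) ^ j * \<Phi> (vs[i := v] ! j) (remove_nth j (vs[i := v])))"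
    by (intro linear_compose_sum ballI linear_cmult) auto
  then show "linear (\<lambda>v. alt_sum \<Phi> (vs[i := v]))"
    unfolding alt_sum_def using l by simp
next
  fix vs :: "(real ^ 'n) list" and i j
  assume l: "length vs = Suc k" "i < j" "j < Suc k" "vs ! i = vs ! j"
  let ?f = "\<lambda>l. (-1) ^ l * \<Phi> (vs ! l) (remove_nth l vs)"
  have other: "?f q = 0" if q: "q < Suc k" "q \<noteq> i" "q \<noteq> j" for q
  proof -
    let ?i = "if i < q then i else i - 1" and ?j = "if j < q then j else j - 1"
    have "\<Phi> (vs ! q) (remove_nth q vs) = 0"
    proof (rule alternating_form_repeat[OF alt])
      show "?i < ?j" "?j < length (remove_nth q vs)"
        using q l by (auto simp: length_remove_nth)
      show "remove_nth q vs ! ?i = remove_nth q vs ! ?j"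
        using q l by (auto simp: nth_remove_nth)
    qed
    then show ?thesis by simp
  qed
  \<comment> \<open>The list is cut at the two equal entries.\<close>
  define xs where "xs = take i vs"
  define ys where "ys = take (j - Suc i) (drop (Suc i) vs)"
  define zs where "zs = drop (Suc j) vs"
  define v where "v = vs ! i"
  have drop_i: "drop (Suc i) vs = ys @ v # zs"
  proof -
    have "drop (Suc i) vs ! (j - Suc i) = v" using l by (simp add: v_def)
    moreover have "j - Suc i < length (drop (Suc i) vs)" using l by simp
    ultimately show ?thesis
      using id_take_nth_drop[of "j - Suc i" "drop (Suc i) vs"] l
      by (simp add: ys_def zs_def add.commute)
  qed
  have vs: "vs = xs @ v # ys @ v # zs"
    using id_take_nth_drop[of i vs] l drop_i by (simp add: xs_def v_def)
  have lx: "length xs = i" and ly: "j = Suc (i + length ys)" using l by (auto simp: xs_def ys_def)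
  have "remove_nth i vs = xs @ ys @ v # zs"
    using remove_nth_append_Cons[of xs v "ys @ v # zs"] by (simp add: vs lx)
  moreover have "remove_nth j vs = xs @ v # ys @ zs"
    using remove_nth_append_Cons[of "xs @ v # ys" v zs] by (simp add: vs lx ly)
  moreover have "vs ! i = v" "vs ! j = v" using l by (auto simp: v_def)
  ultimately have "?f i + ?f j = (-1) ^ i * \<Phi> v (xs @ ys @ v # zs) + (-1) ^ j * \<Phi> v (xs @ v # ys @ zs)"
    by simp
  \<comment> \<open>Carrying \<open>v\<close> across \<open>ys\<close> costs
    \<open>length ys\<close> signs, and \<open>j - i\<close> is one more than that, so the two terms
    have opposite signs.\<close>
  also have "\<dots> = 0"
  proof -
    have "(-1) ^ length ys * (-1) ^ length ys = (1::real)"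
      by (simp flip: power_mult_distrib)
    then show ?thesis
      unfolding alternating_form_move[OF alt] ly
      by (simp add: power_add mult.assoc[symmetric])
  qed
  finally have ij: "?f i + ?f j = 0" .
  have "alt_sum \<Phi> vs = (\<Sum>q\<in>{..<Suc k}. ?f q)" by (simp add: alt_sum_def l(1))
  also have "\<dots> = (\<Sum>q\<in>{i, j}. ?f q)"
    using l other by (intro sum.mono_neutral_right) auto
  also have "\<dots> = 0" using ij l by simp
  finally show "alt_sum \<Phi> vs = 0" .
qed

lemma wedge1_alt_sum: "wedge1 m \<omega> = alt_sum (\<lambda>v us. v $ m * \<omega> us)"
  by (rule ext) (simp add: wedge1_def alt_sum_def mult.assoc)

lemma s_map_alt_sum: "s_map \<mu> vs ws = alt_sum (\<lambda>v us. \<mu> us (v # ws)) vs"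
  by (simp add: s_map_def alt_sum_def)

lemma alternating_form_wedge1:
  fixes \<omega> :: "'n::finite form"
  assumes "alternating_form k \<omega>"
  shows "alternating_form (Suc k) (wedge1 m \<omega>)"
  unfolding wedge1_alt_sum
proof (rule alternating_form_alt_sum)
  show "linear (\<lambda>v :: real ^ 'n. v $ m * \<omega> ws)" for ws
    by (rule linearI) (auto simp: distrib_right)
qed (rule alternating_form_cmult[OF assms])

lemma Alt_D:
  assumes "\<mu> \<in> Alt k l"
  shows "alternating_form k (\<lambda>vs. \<mu> vs ws)" "alternating_form l (\<mu> vs)"
  using assms by (auto simp: Alt_def)

lemma Alt_I:
  "(\<And>ws. alternating_form k (\<lambda>vs. \<mu> vs ws)) \<Longrightarrow> (\<And>vs. alternating_form l (\<mu> vs)) \<Longrightarrow> \<mu> \<in> Alt k l"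
  by (auto simp: Alt_def)

lemma Alt_add: "\<mu> \<in> Alt k l \<Longrightarrow> \<nu> \<in> Alt k l \<Longrightarrow> (\<lambda>vs ws. \<mu> vs ws + \<nu> vs ws) \<in> Alt k l"
  unfolding Alt_def by (auto intro!: alternating_form_add)

lemma Alt_cmult: "\<mu> \<in> Alt k l \<Longrightarrow> (\<lambda>vs ws. c * \<mu> vs ws) \<in> Alt k l"
  unfolding Alt_def by (auto intro!: alternating_form_cmult)

lemma Alt_sum: "(\<And>i. i \<in> I \<Longrightarrow> \<mu> i \<in> Alt k l) \<Longrightarrow> (\<lambda>vs ws. \<Sum>i\<in>I. \<mu> i vs ws) \<in> Alt k l"
  unfolding Alt_def by (auto intro!: alternating_form_sum)

lemma Alt_zero: "(\<lambda>vs ws. 0) \<in> Alt k l"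
  by (intro Alt_I alternating_form_zero)

lemma s_map_Alt:
  assumes "\<mu> \<in> Alt k (Suc l)"
  shows "s_map \<mu> \<in> Alt (Suc k) l"
proof (rule Alt_I)
  show "alternating_form (Suc k) (\<lambda>vs. s_map \<mu> vs ws)" for ws
    unfolding s_map_alt_sum
  proof (rule alternating_form_alt_sum)
    show "linear (\<lambda>v. \<mu> us (v # ws))" for us
      using alternating_form_linear[OF Alt_D(2)[OF assms], of us "[]" ws] by simp
  qed (rule Alt_D(1)[OF assms])
  show "alternating_form l (s_map \<mu> vs)" for vs
    unfolding s_map_def[abs_def]
    by (intro alternating_form_sum alternating_form_cmult alternating_form_Cons Alt_D(2)[OF assms])
qed

lemma wedge1_Alt:
  assumes "\<mu> \<in> Alt k l"
  shows "(\<lambda>vs ws. wedge1 m (\<lambda>vs'. \<mu> vs' ws) vs) \<in> Alt (Suc k) l"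
proof (rule Alt_I)
  show "alternating_form (Suc k) (\<lambda>vs. wedge1 m (\<lambda>vs'. \<mu> vs' ws) vs)" for ws
    by (intro alternating_form_wedge1 Alt_D(1)[OF assms])
  show "alternating_form l (\<lambda>ws. wedge1 m (\<lambda>vs'. \<mu> vs' ws) vs)" for vs
    unfolding wedge1_def mult.assoc
    by (intro alternating_form_sum alternating_form_cmult Alt_D(2)[OF assms])
qed

section \<open>Forms are determined by their basis coefficients\<close>

lemma insort_split: "\<exists>xs ys. S = xs @ ys \<and> insort a S = xs @ a # ys"
proof (induction S)
  case (Cons b S)
  then obtain xs ys where "S = xs @ ys" "insort a S = xs @ a # ys" by blast
  then show ?case
    by (cases "a \<le> b") (auto intro: exI[of _ "[]"] exI[of _ "b # xs"])
qed simp

text \<open>Sorting changes the value by a sign only. The prefix \<open>ps\<close> collects the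
  entries already carried back to the front.\<close>

lemma alternating_form_eq_0_sort:
  fixes \<omega> :: "'n::{finite,linorder} form"
  assumes "alternating_form k \<omega>"
  shows "\<omega> (ps @ map ax (sort ms)) = 0 \<Longrightarrow> \<omega> (ps @ map ax ms) = 0"
proof (induction ms arbitrary: ps)
  case (Cons a ms)
  obtain xs ys where xy: "sort ms = xs @ ys" "insort a (sort ms) = xs @ a # ys"
    using insort_split by blast
  have "\<omega> (ps @ map ax xs @ ax a # map ax ys) = 0"
    using Cons.prems xy by simp
  then have "\<omega> ((ps @ [ax a]) @ map ax (sort ms)) = 0"
    using alternating_form_move[OF assms, of ps "ax a" "map ax xs" "map ax ys"] xy by simp
  from Cons.IH[OF this] show ?case by simp
qed simp

lemma alternating_form_eq_0I:
  fixes \<omega> :: "'n::{finite,linorder} form"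
  assumes \<omega>: "alternating_form k \<omega>" and zero: "\<And>\<sigma>. card \<sigma> = k \<Longrightarrow> \<omega> (basis_list \<sigma>) = 0"
  shows "\<omega> vs = 0"
proof -
  have axes: "\<omega> (map ax ms) = 0" for ms
  proof (cases "length ms = k \<and> distinct ms")
    case True
    then have "card (set ms) = k" by (simp add: distinct_card)
    from zero[OF this] have "\<omega> ([] @ map ax (sort ms)) = 0"
      using True by (simp add: basis_list_def sorted_list_of_set_sort_remdups distinct_remdups_id)
    then show ?thesis using alternating_form_eq_0_sort[OF \<omega>, of "[]" ms] by simp
  next
    case False
    show ?thesis
    proof (cases "length ms = k")
      case True
      then obtain i j where "i < j" "j < length ms" "ms ! i = ms ! j"
        using False by (metis distinct_conv_nth linorder_neqE_nat)
      then show ?thesis by (intro alternating_form_repeat[OF \<omega>, of i j]) auto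
    next
      case False
      then show ?thesis by (intro alternating_form_length[OF \<omega>]) simp
    qed
  qed
  \<comment> \<open>Arguments are exchanged for axis vectors from the end of the list, one linear
    extension at a time; \<open>ms\<close> collects those already exchanged.\<close>
  have "\<omega> (vs @ map ax ms) = 0" for ms
  proof (induction vs arbitrary: ms rule: rev_induct)
    case (snoc v vs)
    have "(\<lambda>v. \<omega> (vs @ v # map ax ms)) = (\<lambda>v. 0)"
    proof (rule linear_eq_stdbasis)
      show "linear (\<lambda>v. \<omega> (vs @ v # map ax ms))" by (rule alternating_form_linear[OF \<omega>])
      show "\<omega> (vs @ b # map ax ms) = 0" if "b \<in> Basis" for b
        using that snoc[of "_ # ms"] by (auto elim!: Basis_cart_cases)
    qed (rule linear_zero)
    from fun_cong[OF this, of v] show ?case by simp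
  qed (simp add: axes)
  from this[of "[]"] show ?thesis by simp
qed

lemma length_basis_list [simp]: "length (basis_list \<sigma>) = card \<sigma>"
  by (simp add: basis_list_def)

lemma coeff_form_wrong_degree:
  "\<mu> \<in> Alt k l \<Longrightarrow> card \<sigma> \<noteq> k \<or> card \<tau> \<noteq> l \<Longrightarrow> coeff_form \<mu> \<sigma> \<tau> = 0"
  unfolding coeff_form_def using Alt_D alternating_form_length length_basis_list by metis

lemma Alt_eqI:
  fixes \<mu> \<nu> :: "'n::{finite,linorder} form2"
  assumes \<mu>: "\<mu> \<in> Alt k l" and \<nu>: "\<nu> \<in> Alt k l"
    and eq: "\<And>\<sigma> \<tau>. card \<sigma> = k \<Longrightarrow> card \<tau> = l \<Longrightarrow> coeff_form \<mu> \<sigma> \<tau> = coeff_form \<nu> \<sigma> \<tau>"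
  shows "\<mu> = \<nu>"
proof -
  define d where "d vs ws = \<mu> vs ws + (-1) * \<nu> vs ws" for vs ws
  have d: "d \<in> Alt k l" unfolding d_def by (intro Alt_add Alt_cmult \<mu> \<nu>)
  have "d vs ws = 0" for vs ws
  proof (rule alternating_form_eq_0I[OF Alt_D(2)[OF d]])
    fix \<tau> :: "'n set" assume \<tau>: "card \<tau> = l"
    show "d vs (basis_list \<tau>) = 0"
      by (rule alternating_form_eq_0I[OF Alt_D(1)[OF d, of "basis_list \<tau>"]])
        (use eq \<tau> in \<open>simp add: d_def coeff_form_def\<close>)
  qed
  then show ?thesis by (simp add: d_def fun_eq_iff)
qed

text \<open>The sign of carrying \<open>m\<close> between the front and its sorted place in
  \<open>\<sigma>\<close>. It is the same whether or not \<open>m\<close> belongs to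
  \<open>\<sigma>\<close>.\<close>

definition pos_sign :: "'n::{finite,linorder} set \<Rightarrow> 'n \<Rightarrow> real" where
  "pos_sign \<sigma> m = (-1) ^ card {j \<in> \<sigma>. j < m}"

lemma sorted_list_of_set_nth_card:
  fixes \<sigma> :: "'n::{finite,linorder} set"
  assumes "i < card \<sigma>"
  shows "card {j \<in> \<sigma>. j < sorted_list_of_set \<sigma> ! i} = i"
proof -
  let ?S = "sorted_list_of_set \<sigma>"
  have S: "sorted_wrt (<) ?S" "set ?S = \<sigma>" "length ?S = card \<sigma>" "distinct ?S" by simp_all
  have mono: "a < b \<Longrightarrow> b < card \<sigma> \<Longrightarrow> ?S ! a < ?S ! b" for a b
    using sorted_wrt_nth_less[OF S(1)] S(3) by simp
  have "{j \<in> \<sigma>. j < ?S ! i} = (!) ?S ` {..<i}"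
  proof (intro set_eqI iffI)
    fix j assume j: "j \<in> {j \<in> \<sigma>. j < ?S ! i}"
    then have "j \<in> set ?S" by (simp add: S(2))
    then obtain q where q: "q < card \<sigma>" "?S ! q = j" unfolding in_set_conv_nth S(3) by blast
    have "q < i"
    proof (rule ccontr)
      assume "\<not> q < i"
      then have "?S ! i \<le> ?S ! q" using mono[of i q] q(1) by (cases "i = q") auto
      then show False using j q(2) by (auto dest: leD)
    qed
    then show "j \<in> (!) ?S ` {..<i}" using q by auto
  next
    fix j assume "j \<in> (!) ?S ` {..<i}"
    then obtain q where q: "q < i" "j = ?S ! q" by auto
    then have "j \<in> set ?S" using assms S(3) nth_mem[of q ?S] by simp
    then show "j \<in> {j \<in> \<sigma>. j < ?S ! i}" using q mono[of q i] assms by (simp add: S(2))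
  qed
  moreover have "inj_on ((!) ?S) {..<i}"
    using S(3,4) assms by (intro inj_on_nth) auto
  ultimately show ?thesis by (simp add: card_image)
qed

lemma remove_nth_sorted_list_of_set:
  fixes \<sigma> :: "'n::{finite,linorder} set"
  assumes "i < card \<sigma>"
  shows "remove_nth i (sorted_list_of_set \<sigma>) = sorted_list_of_set (\<sigma> - {sorted_list_of_set \<sigma> ! i})"
proof -
  let ?S = "sorted_list_of_set \<sigma>"
  have S: "?S = take i ?S @ ?S ! i # drop (Suc i) ?S" using assms by (intro id_take_nth_drop) simp
  have "?S ! i \<notin> set (take i ?S)"
  proof -
    have "distinct (take i ?S @ ?S ! i # drop (Suc i) ?S)" unfolding S[symmetric] by simp
    then show ?thesis by simp
  qed
  then have "remove1 (?S ! i) (take i ?S @ ?S ! i # drop (Suc i) ?S) = remove_nth i ?S"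
    by (simp add: remove1_append remove_nth_def)
  then show ?thesis unfolding S[symmetric] by (simp add: sorted_list_of_set_remove)
qed

text \<open>The position of \<open>m\<close> in the sorted list is the number of smaller elements,
  which turns positional signs into \<open>pos_sign\<close>.\<close>

lemma alt_sum_basis_list:
  fixes \<sigma> :: "'n::{finite,linorder} set"
  shows "alt_sum \<Phi> (basis_list \<sigma>) = (\<Sum>m\<in>\<sigma>. pos_sign \<sigma> m * \<Phi> (ax m) (basis_list (\<sigma> - {m})))"
proof -
  let ?S = "sorted_list_of_set \<sigma>"
  have bij: "bij_betw ((!) ?S) {..<card \<sigma>} \<sigma>"
    by (rule bij_betw_nth) simp_all
  have "alt_sum \<Phi> (basis_list \<sigma>) = (\<Sum>i<card \<sigma>. pos_sign \<sigma> (?S ! i) * \<Phi> (ax (?S ! i)) (basis_list (\<sigma> - {?S ! i})))"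
    unfolding alt_sum_def length_basis_list
    by (intro sum.cong refl)
      (simp add: basis_list_def remove_nth_map remove_nth_sorted_list_of_set pos_sign_def sorted_list_of_set_nth_card)
  also have "\<dots> = (\<Sum>m\<in>\<sigma>. pos_sign \<sigma> m * \<Phi> (ax m) (basis_list (\<sigma> - {m})))"
    by (rule sum.reindex_bij_betw[OF bij])
  finally show ?thesis .
qed

lemma alternating_form_Cons_basis_list:
  fixes \<tau> :: "'n::{finite,linorder} set"
  assumes \<omega>: "alternating_form k \<omega>"
  shows "\<omega> (ax m # basis_list \<tau>) = (if m \<in> \<tau> then 0 else pos_sign \<tau> m * \<omega> (basis_list (insert m \<tau>)))"
proof (cases "m \<in> \<tau>")
  case True
  then have "m \<in> set (sorted_list_of_set \<tau>)" by simp
  then obtain i where "i < card \<tau>" "sorted_list_of_set \<tau> ! i = m"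
    unfolding in_set_conv_nth by auto
  then have "\<omega> (ax m # basis_list \<tau>) = 0"
    by (intro alternating_form_repeat[OF \<omega>, of 0 "Suc i"]) (auto simp: basis_list_def)
  then show ?thesis using True by simp
next
  case False
  define N where "N = insert m \<tau>"
  let ?S = "sorted_list_of_set N"
  have "m \<in> set ?S" by (simp add: N_def del: sorted_list_of_set_insert_remove)
  then obtain i where i: "i < card N" "?S ! i = m"
    unfolding in_set_conv_nth by auto
  have S: "?S = take i ?S @ m # drop (Suc i) ?S"
    using id_take_nth_drop[of i ?S] i by simp
  have T: "take i ?S @ drop (Suc i) ?S = sorted_list_of_set \<tau>"
    using remove_nth_sorted_list_of_set[OF i(1)] i(2) False by (simp add: remove_nth_def N_def)
  have "card {j \<in> N. j < m} = i"
    using sorted_list_of_set_nth_card[OF i(1)] i(2) by simp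
  moreover have "{j \<in> N. j < m} = {j \<in> \<tau>. j < m}" by (auto simp: N_def)
  ultimately have sign: "pos_sign \<tau> m = (-1) ^ i" by (simp add: pos_sign_def)
  have "\<omega> (ax m # basis_list \<tau>) = \<omega> ([] @ ax m # map ax (take i ?S) @ map ax (drop (Suc i) ?S))"
    unfolding basis_list_def T[symmetric] by simp
  also have "\<dots> = (-1) ^ length (map ax (take i ?S)) * \<omega> ([] @ map ax (take i ?S) @ ax m # map ax (drop (Suc i) ?S))"
    by (rule alternating_form_move[OF \<omega>])
  also have "[] @ map ax (take i ?S) @ ax m # map ax (drop (Suc i) ?S) = map ax (take i ?S @ m # drop (Suc i) ?S)"
    by simp
  also have "\<dots> = basis_list N" unfolding S[symmetric] basis_list_def ..
  also have "length (map ax (take i ?S)) = i" using i by simp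
  finally show ?thesis using False by (simp add: sign N_def)
qed

text \<open>Reading the formula from left to right, \<open>m\<close> moves from
  \<open>\<sigma>\<close> to \<open>\<tau>\<close>; if it is in \<open>\<tau>\<close> already, an
  argument repeats and the term vanishes. This is the origin of weight preservation.\<close>

lemma coeff_form_s_map:
  fixes \<sigma> \<tau> :: "'n::{finite,linorder} set"
  assumes "\<mu> \<in> Alt k l"
  shows "coeff_form (s_map \<mu>) \<sigma> \<tau> =
    (\<Sum>m\<in>\<sigma> - \<tau>. pos_sign \<sigma> m * pos_sign \<tau> m * coeff_form \<mu> (\<sigma> - {m}) (insert m \<tau>))"
proof -
  have "coeff_form (s_map \<mu>) \<sigma> \<tau> = (\<Sum>m\<in>\<sigma>. if m \<in> \<tau> then 0 else
      pos_sign \<sigma> m * pos_sign \<tau> m * coeff_form \<mu> (\<sigma> - {m}) (insert m \<tau>))"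
    unfolding coeff_form_def s_map_alt_sum alt_sum_basis_list
    by (intro sum.cong) (auto simp: alternating_form_Cons_basis_list[OF Alt_D(2)[OF assms]])
  also have "\<dots> = (\<Sum>m\<in>\<sigma> - \<tau>. pos_sign \<sigma> m * pos_sign \<tau> m * coeff_form \<mu> (\<sigma> - {m}) (insert m \<tau>))"
    by (rule sum.mono_neutral_cong_right) auto
  finally show ?thesis .
qed

lemma wedge1_basis_list:
  fixes \<sigma> :: "'n::{finite,linorder} set"
  shows "wedge1 m \<omega> (basis_list \<sigma>) = (if m \<in> \<sigma> then pos_sign \<sigma> m * \<omega> (basis_list (\<sigma> - {m})) else 0)"
proof -
  have "wedge1 m \<omega> (basis_list \<sigma>) = (\<Sum>j\<in>\<sigma>. if j = m then pos_sign \<sigma> m * \<omega> (basis_list (\<sigma> - {m})) else 0)"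
    unfolding wedge1_alt_sum alt_sum_basis_list by (intro sum.cong) (auto simp: axis_def)
  then show ?thesis by simp
qed

lemma alternating_form_dx:
  fixes \<sigma> :: "'n::{finite,linorder} set"
  shows "alternating_form (card \<sigma>) (dx \<sigma>)"
proof -
  have "alternating_form (length ms) (foldr wedge1 ms (\<lambda>vs. if vs = [] then 1 else 0))" for ms :: "'n list"
    by (induction ms) (auto intro: alternating_form_wedge1 simp: alternating_form_def[of 0])
  from this[of "sorted_list_of_set \<sigma>"] show ?thesis by (simp add: dx_def)
qed

lemma dx_basis_list:
  fixes \<sigma> \<tau> :: "'n::{finite,linorder} set"
  shows "dx \<sigma> (basis_list \<tau>) = (if \<sigma> = \<tau> then 1 else 0)"
proof (induction "card \<sigma>" arbitrary: \<sigma> \<tau>)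
  case 0
  then have "\<sigma> = {}" by simp
  then show ?case by (auto simp: dx_def basis_list_def sorted_list_of_set_eq_Nil_iff)
next
  case (Suc k)
  then have ne: "\<sigma> \<noteq> {}" by auto
  define m where "m = Min \<sigma>"
  have m: "m \<in> \<sigma>" "\<And>j. j \<in> \<sigma> \<Longrightarrow> m \<le> j" using ne by (auto simp: m_def)
  have "dx \<sigma> = wedge1 m (dx (\<sigma> - {m}))"
    using sorted_list_of_set_nonempty[OF _ ne] by (simp add: dx_def m_def)
  then have eq: "dx \<sigma> (basis_list \<tau>) = (if m \<in> \<tau> then pos_sign \<tau> m * (if \<sigma> - {m} = \<tau> - {m} then 1 else 0) else 0)"
    using Suc m(1) by (simp add: wedge1_basis_list)
  show ?case
  proof (cases "\<sigma> = \<tau>")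
    case True
    \<comment> \<open>The removed element is the least one, so no sign arises.\<close>
    have empty: "{j \<in> \<tau>. j < m} = {}" using m(2) True by force
    show ?thesis unfolding eq pos_sign_def empty using True m(1) by simp
  next
    case False
    then have "m \<in> \<tau> \<Longrightarrow> \<sigma> - {m} \<noteq> \<tau> - {m}" using m(1) by blast
    then show ?thesis unfolding eq using False by simp
  qed
qed

definition from_coeff :: "nat \<Rightarrow> nat \<Rightarrow> ('n::{finite,linorder} set \<Rightarrow> 'n set \<Rightarrow> real) \<Rightarrow> 'n form2" where
  "from_coeff k l f vs ws = (\<Sum>\<sigma> | card \<sigma> = k. \<Sum>\<tau> | card \<tau> = l. f \<sigma> \<tau> * (dx \<sigma> vs * dx \<tau> ws))"

lemma dx_tensor_Alt:
  assumes "card \<sigma> = k" "card \<tau> = l"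
  shows "(\<lambda>vs ws. dx \<sigma> vs * dx \<tau> ws) \<in> Alt k l"
proof (rule Alt_I)
  show "alternating_form k (\<lambda>vs. dx \<sigma> vs * dx \<tau> ws)" for ws
    using alternating_form_cmult[OF alternating_form_dx[of \<sigma>], of "dx \<tau> ws"] assms(1)
    by (simp add: mult.commute)
  show "alternating_form l (\<lambda>ws. dx \<sigma> vs * dx \<tau> ws)" for vs
    using alternating_form_cmult[OF alternating_form_dx[of \<tau>]] assms(2) by simp
qed

lemma from_coeff_Alt: "from_coeff k l f \<in> Alt k l"
proof -
  have "(\<lambda>vs ws. from_coeff k l f vs ws) \<in> Alt k l"
    unfolding from_coeff_def by (intro Alt_sum Alt_cmult dx_tensor_Alt) auto
  then show ?thesis by simp
qed

lemma coeff_from_coeff: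
  assumes "card \<sigma> = k" "card \<tau> = l"
  shows "coeff_form (from_coeff k l f) \<sigma> \<tau> = f \<sigma> \<tau>"
proof -
  have "coeff_form (from_coeff k l f) \<sigma> \<tau> =
      (\<Sum>\<sigma>' | card \<sigma>' = k. \<Sum>\<tau>' | card \<tau>' = l. if \<tau>' = \<tau> then (if \<sigma>' = \<sigma> then f \<sigma> \<tau> else 0) else 0)"
    unfolding coeff_form_def from_coeff_def
    by (intro sum.cong refl) (auto simp: dx_basis_list)
  also have "\<dots> = (\<Sum>\<sigma>' | card \<sigma>' = k. if \<sigma>' = \<sigma> then f \<sigma> \<tau> else 0)"
    using assms by (intro sum.cong) auto
  also have "\<dots> = f \<sigma> \<tau>" using assms by simp
  finally show ?thesis .
qed


section \<open>Bijectivity of \<open>s\<close> and weight-preserving maps\<close>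

type_synonym 'n coeffs = "'n set \<Rightarrow> 'n set \<Rightarrow> real"

definition s_coeff :: "'n::{finite,linorder} coeffs \<Rightarrow> 'n coeffs" where
  "s_coeff f \<sigma> \<tau> = (\<Sum>m\<in>\<sigma> - \<tau>. pos_sign \<sigma> m * pos_sign \<tau> m * f (\<sigma> - {m}) (insert m \<tau>))"

text \<open>The same formula with the two tensor factors exchanged; as the signs are symmetric in
  both factors, it is the adjoint of \<open>s_coeff\<close>.\<close>

definition s_adj :: "'n::{finite,linorder} coeffs \<Rightarrow> 'n coeffs" where
  "s_adj f \<sigma> \<tau> = s_coeff (\<lambda>\<sigma> \<tau>. f \<tau> \<sigma>) \<tau> \<sigma>"

definition coeff_inner :: "'n::{finite,linorder} coeffs \<Rightarrow> 'n coeffs \<Rightarrow> real" where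
  "coeff_inner f g = (\<Sum>\<sigma>\<in>UNIV. \<Sum>\<tau>\<in>UNIV. f \<sigma> \<tau> * g \<sigma> \<tau>)"

lemma pos_sign_square [simp]: "pos_sign \<sigma> m * pos_sign \<sigma> m = 1"
  unfolding pos_sign_def by (simp flip: power_mult_distrib)

lemma pos_sign_same [simp]:
  "pos_sign (\<sigma> - {m}) m = pos_sign \<sigma> m" "pos_sign (insert m \<sigma>) m = pos_sign \<sigma> m"
proof -
  have "{j \<in> \<sigma> - {m}. j < m} = {j \<in> \<sigma>. j < m}" "{j \<in> insert m \<sigma>. j < m} = {j \<in> \<sigma>. j < m}" by auto
  then show "pos_sign (\<sigma> - {m}) m = pos_sign \<sigma> m" "pos_sign (insert m \<sigma>) m = pos_sign \<sigma> m"
    unfolding pos_sign_def by simp_all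
qed

lemma pos_sign_insert:
  assumes "m \<notin> \<sigma>"
  shows "pos_sign (insert m \<sigma>) j = pos_sign \<sigma> j * (if m < j then -1 else 1)"
proof (cases "m < j")
  case True
  have "{i \<in> insert m \<sigma>. i < j} = insert m {i \<in> \<sigma>. i < j}" using True by auto
  moreover have "card (insert m {i \<in> \<sigma>. i < j}) = Suc (card {i \<in> \<sigma>. i < j})"
    using assms by (intro card_insert_disjoint) auto
  ultimately show ?thesis using True unfolding pos_sign_def by simp
next
  case False
  then have "{i \<in> insert m \<sigma>. i < j} = {i \<in> \<sigma>. i < j}" by auto
  then show ?thesis using False unfolding pos_sign_def by simp
qed

text \<open>Moving \<open>m\<close> from one set to the other flips both signs at \<open>j\<close>
  or neither.\<close>

lemma pos_sign_transfer:
  assumes "m \<in> \<tau>" "m \<notin> \<sigma>"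
  shows "pos_sign (insert m \<sigma>) j * pos_sign (\<tau> - {m}) j = pos_sign \<sigma> j * pos_sign \<tau> j"
proof -
  have "pos_sign \<tau> j = pos_sign (\<tau> - {m}) j * (if m < j then -1 else 1)"
    using pos_sign_insert[of m "\<tau> - {m}" j] assms(1) by (simp add: insert_absorb)
  then show ?thesis using pos_sign_insert[OF assms(2)] by simp
qed

lemma sum_triple:
  fixes F :: "'n::finite set \<Rightarrow> 'n set \<Rightarrow> 'n \<Rightarrow> real"
  shows "(\<Sum>\<sigma>\<in>UNIV. \<Sum>\<tau>\<in>UNIV. \<Sum>m\<in>A \<sigma> \<tau>. F \<sigma> \<tau> m) =
    (\<Sum>(\<sigma>, \<tau>, m)\<in>(SIGMA \<sigma>:UNIV. SIGMA \<tau>:UNIV. A \<sigma> \<tau>). F \<sigma> \<tau> m)"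
  by (simp add: sum.Sigma)

text \<open>The triples of both sums correspond by moving \<open>m\<close> from the first set to the
  second, which does not change its two signs.\<close>

lemma coeff_inner_s_adj: "coeff_inner (s_coeff f) g = coeff_inner f (s_adj g)"
proof -
  have "coeff_inner (s_coeff f) g = (\<Sum>(\<sigma>, \<tau>, m)\<in>(SIGMA \<sigma>:UNIV. SIGMA \<tau>:UNIV. \<sigma> - \<tau>).
      pos_sign \<sigma> m * pos_sign \<tau> m * f (\<sigma> - {m}) (insert m \<tau>) * g \<sigma> \<tau>)"
    unfolding coeff_inner_def s_coeff_def sum_distrib_right sum_triple ..
  also have "\<dots> = (\<Sum>(\<sigma>, \<tau>, m)\<in>(SIGMA \<sigma>:UNIV. SIGMA \<tau>:UNIV. \<tau> - \<sigma>).
      f \<sigma> \<tau> * (pos_sign \<tau> m * pos_sign \<sigma> m * g (insert m \<sigma>) (\<tau> - {m})))"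
    by (rule sum.reindex_bij_witness[where i = "\<lambda>(\<sigma>, \<tau>, m). (insert m \<sigma>, \<tau> - {m}, m)"
          and j = "\<lambda>(\<sigma>, \<tau>, m). (\<sigma> - {m}, insert m \<tau>, m)"])
      (auto simp: insert_absorb)
  also have "\<dots> = coeff_inner f (s_adj g)"
    unfolding coeff_inner_def s_adj_def s_coeff_def sum_distrib_left sum_triple ..
  finally show ?thesis .
qed

text \<open>The diagonal part comes from moving the same \<open>m\<close> forth and back, where the
  signs square to one; in the rest two different directions change sides, and the signs
  factor.\<close>

lemma s_adj_s_coeff:
  "s_adj (s_coeff f) \<sigma> \<tau> = real (card (\<tau> - \<sigma>)) * f \<sigma> \<tau> +
    (\<Sum>m\<in>\<tau> - \<sigma>. \<Sum>j\<in>\<sigma> - \<tau>. pos_sign \<sigma> m * pos_sign \<tau> m * (pos_sign \<sigma> j * pos_sign \<tau> j) *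
      f (insert m (\<sigma> - {j})) (insert j (\<tau> - {m})))"
proof -
  have "pos_sign \<tau> m * pos_sign \<sigma> m * s_coeff f (insert m \<sigma>) (\<tau> - {m}) =
      f \<sigma> \<tau> + (\<Sum>j\<in>\<sigma> - \<tau>. pos_sign \<sigma> m * pos_sign \<tau> m * (pos_sign \<sigma> j * pos_sign \<tau> j) *
        f (insert m (\<sigma> - {j})) (insert j (\<tau> - {m})))" if m: "m \<in> \<tau> - \<sigma>" for m
  proof -
    have set: "insert m \<sigma> - (\<tau> - {m}) = insert m (\<sigma> - \<tau>)" using m by auto
    have fin: "finite (\<sigma> - \<tau>)" and nin: "m \<notin> \<sigma> - \<tau>" using m by auto
    have ids: "insert m \<sigma> - {m} = \<sigma>" "insert m (\<tau> - {m}) = \<tau>" using m by auto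
    have "s_coeff f (insert m \<sigma>) (\<tau> - {m}) = pos_sign \<sigma> m * pos_sign \<tau> m * f \<sigma> \<tau> +
      (\<Sum>j\<in>\<sigma> - \<tau>. pos_sign (insert m \<sigma>) j * pos_sign (\<tau> - {m}) j * f (insert m \<sigma> - {j}) (insert j (\<tau> - {m})))"
      unfolding s_coeff_def set sum.insert[OF fin nin] ids by simp
    also have "(\<Sum>j\<in>\<sigma> - \<tau>. pos_sign (insert m \<sigma>) j * pos_sign (\<tau> - {m}) j * f (insert m \<sigma> - {j}) (insert j (\<tau> - {m})))
      = (\<Sum>j\<in>\<sigma> - \<tau>. pos_sign \<sigma> j * pos_sign \<tau> j * f (insert m (\<sigma> - {j})) (insert j (\<tau> - {m})))"
    proof (rule sum.cong[OF refl])
      fix j assume "j \<in> \<sigma> - \<tau>"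
      then have "insert m \<sigma> - {j} = insert m (\<sigma> - {j})" using m by auto
      then show "pos_sign (insert m \<sigma>) j * pos_sign (\<tau> - {m}) j * f (insert m \<sigma> - {j}) (insert j (\<tau> - {m})) =
          pos_sign \<sigma> j * pos_sign \<tau> j * f (insert m (\<sigma> - {j})) (insert j (\<tau> - {m}))"
        using pos_sign_transfer[of m \<tau> \<sigma> j] m by simp
    qed
    finally have eq: "s_coeff f (insert m \<sigma>) (\<tau> - {m}) = pos_sign \<sigma> m * pos_sign \<tau> m * f \<sigma> \<tau> +
      (\<Sum>j\<in>\<sigma> - \<tau>. pos_sign \<sigma> j * pos_sign \<tau> j * f (insert m (\<sigma> - {j})) (insert j (\<tau> - {m})))" .
    have "pos_sign \<tau> m * pos_sign \<sigma> m * (pos_sign \<sigma> m * pos_sign \<tau> m * f \<sigma> \<tau>)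
      = (pos_sign \<tau> m * pos_sign \<tau> m) * (pos_sign \<sigma> m * pos_sign \<sigma> m) * f \<sigma> \<tau>"
      by (simp only: ac_simps)
    then show ?thesis
      unfolding eq distrib_left by (simp add: sum_distrib_left mult.assoc mult.left_commute)
  qed
  then show ?thesis
    unfolding s_adj_def s_coeff_def[of "\<lambda>\<sigma> \<tau>. s_coeff f \<tau> \<sigma>"] by (simp add: sum.distrib)
qed

text \<open>The parts that move two different directions agree for both orders of composition. What
  remains is the difference of \<open>card (\<tau> - \<sigma>)\<close> and
  \<open>card (\<sigma> - \<tau>)\<close>, in which the intersection cancels.\<close>

lemma s_commutator:
  "s_adj (s_coeff f) \<sigma> \<tau> - s_coeff (s_adj f) \<sigma> \<tau> = (real (card \<tau>) - real (card \<sigma>)) * f \<sigma> \<tau>"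
proof -
  have "s_coeff (s_adj f) \<sigma> \<tau> = s_adj (s_coeff (\<lambda>\<sigma> \<tau>. f \<tau> \<sigma>)) \<tau> \<sigma>"
    by (simp add: s_adj_def[abs_def])
  also have "\<dots> = real (card (\<sigma> - \<tau>)) * f \<sigma> \<tau> +
    (\<Sum>m\<in>\<sigma> - \<tau>. \<Sum>j\<in>\<tau> - \<sigma>. pos_sign \<tau> m * pos_sign \<sigma> m * (pos_sign \<tau> j * pos_sign \<sigma> j) *
      f (insert j (\<sigma> - {m})) (insert m (\<tau> - {j})))"
    by (rule s_adj_s_coeff)
  also have "(\<Sum>m\<in>\<sigma> - \<tau>. \<Sum>j\<in>\<tau> - \<sigma>. pos_sign \<tau> m * pos_sign \<sigma> m * (pos_sign \<tau> j * pos_sign \<sigma> j) *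
      f (insert j (\<sigma> - {m})) (insert m (\<tau> - {j}))) =
    (\<Sum>j\<in>\<tau> - \<sigma>. \<Sum>m\<in>\<sigma> - \<tau>. pos_sign \<sigma> j * pos_sign \<tau> j * (pos_sign \<sigma> m * pos_sign \<tau> m) *
      f (insert j (\<sigma> - {m})) (insert m (\<tau> - {j})))"
    by (subst sum.swap) (intro sum.cong refl, simp)
  finally have "s_adj (s_coeff f) \<sigma> \<tau> - s_coeff (s_adj f) \<sigma> \<tau> =
      (real (card (\<tau> - \<sigma>)) - real (card (\<sigma> - \<tau>))) * f \<sigma> \<tau>"
    by (simp add: s_adj_s_coeff left_diff_distrib)
  moreover have "card \<tau> = card (\<tau> - \<sigma>) + card (\<tau> \<inter> \<sigma>)" "card \<sigma> = card (\<sigma> - \<tau>) + card (\<tau> \<inter> \<sigma>)"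
    using card_Diff_subset_Int[of \<tau> \<sigma>] card_Diff_subset_Int[of \<sigma> \<tau>]
      card_mono[of \<tau> "\<tau> \<inter> \<sigma>"] card_mono[of \<sigma> "\<tau> \<inter> \<sigma>"] by (auto simp: Int_commute)
  ultimately show ?thesis by simp
qed

definition bidegree :: "nat \<Rightarrow> nat \<Rightarrow> 'n::{finite,linorder} coeffs \<Rightarrow> bool" where
  "bidegree k l f \<longleftrightarrow> (\<forall>\<sigma> \<tau>. card \<sigma> \<noteq> k \<or> card \<tau> \<noteq> l \<longrightarrow> f \<sigma> \<tau> = 0)"

lemma coeff_inner_self: "0 \<le> coeff_inner f f" "coeff_inner f f = 0 \<Longrightarrow> f = (\<lambda>\<sigma> \<tau>. 0)"
proof -
  show "0 \<le> coeff_inner f f" unfolding coeff_inner_def by (intro sum_nonneg) simp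
  assume "coeff_inner f f = 0"
  then have "(\<Sum>\<tau>\<in>UNIV. f \<sigma> \<tau> * f \<sigma> \<tau>) = 0" for \<sigma>
    unfolding coeff_inner_def
    by (subst (asm) sum_nonneg_eq_0_iff) (auto intro: sum_nonneg)
  then have "f \<sigma> \<tau> * f \<sigma> \<tau> = 0" for \<sigma> \<tau>
    by (subst (asm) sum_nonneg_eq_0_iff) auto
  then show "f = (\<lambda>\<sigma> \<tau>. 0)" by (auto simp: fun_eq_iff)
qed

text \<open>As \<open>s\<close> and its adjoint satisfy an \<open>sl\<^sub>2\<close> relation, the kernel of \<open>s\<close> is trivial below the middle
  degree.\<close>

lemma s_norm_identity:
  assumes f: "bidegree k l f"
  shows "coeff_inner (s_coeff f) (s_coeff f) =
    coeff_inner (s_adj f) (s_adj f) + (real l - real k) * coeff_inner f f"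
proof -
  have "coeff_inner f (s_adj (s_coeff f)) - coeff_inner (s_coeff (s_adj f)) f
     = (\<Sum>\<sigma>\<in>UNIV. \<Sum>\<tau>\<in>UNIV. f \<sigma> \<tau> * (s_adj (s_coeff f) \<sigma> \<tau> - s_coeff (s_adj f) \<sigma> \<tau>))"
    unfolding coeff_inner_def
    by (simp add: right_diff_distrib sum_subtractf mult.commute)
  also have "\<dots> = (\<Sum>\<sigma>\<in>UNIV. \<Sum>\<tau>\<in>UNIV. (real l - real k) * (f \<sigma> \<tau> * f \<sigma> \<tau>))"
    unfolding s_commutator
  proof (intro sum.cong refl)
    fix \<sigma> \<tau> :: "'a set"
    show "f \<sigma> \<tau> * ((real (card \<tau>) - real (card \<sigma>)) * f \<sigma> \<tau>) = (real l - real k) * (f \<sigma> \<tau> * f \<sigma> \<tau>)"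
      using f by (cases "f \<sigma> \<tau> = 0") (auto simp: bidegree_def)
  qed
  finally show ?thesis
    unfolding coeff_inner_s_adj[of f "s_coeff f"] coeff_inner_s_adj[of "s_adj f" f]
    by (simp add: coeff_inner_def sum_distrib_left)
qed

text \<open>For \<open>k < l\<close> the norm identity writes zero as a sum of two nonnegative
  terms, the second with a positive factor.\<close>

lemma s_coeff_injective:
  assumes f: "bidegree k l f" and "k < l" and zero: "s_coeff f = (\<lambda>\<sigma> \<tau>. 0)"
  shows "f = (\<lambda>\<sigma> \<tau>. 0)"
proof (rule coeff_inner_self(2))
  have "coeff_inner (s_coeff f) (s_coeff f) = 0" by (simp add: zero coeff_inner_def)
  then have "coeff_inner (s_adj f) (s_adj f) + (real l - real k) * coeff_inner f f = 0"
    using s_norm_identity[OF f] by simp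
  moreover have "0 \<le> (real l - real k) * coeff_inner f f" using assms(2) coeff_inner_self(1)[of f] by simp
  ultimately have "(real l - real k) * coeff_inner f f = 0" using coeff_inner_self(1)[of "s_adj f"] by linarith
  then show "coeff_inner f f = 0" using assms(2) by simp
qed

lemma s_adj_injective:
  assumes f: "bidegree k l f" and "l < k" and zero: "s_adj f = (\<lambda>\<sigma> \<tau>. 0)"
  shows "f = (\<lambda>\<sigma> \<tau>. 0)"
proof -
  have "(\<lambda>\<sigma> \<tau>. f \<tau> \<sigma>) = (\<lambda>\<sigma> \<tau>. 0)"
  proof (rule s_coeff_injective)
    show "bidegree l k (\<lambda>\<sigma> \<tau>. f \<tau> \<sigma>)" using f by (auto simp: bidegree_def)
    have "s_coeff (\<lambda>\<sigma> \<tau>. f \<tau> \<sigma>) \<sigma> \<tau> = s_adj f \<tau> \<sigma>" for \<sigma> \<tau> by (simp add: s_adj_def)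
    then show "s_coeff (\<lambda>\<sigma> \<tau>. f \<tau> \<sigma>) = (\<lambda>\<sigma> \<tau>. 0)" by (simp add: fun_eq_iff zero)
  qed fact
  then show ?thesis by (simp add: fun_eq_iff)
qed

lemma bidegree_s_adj:
  assumes "bidegree (Suc k) l f"
  shows "bidegree k (Suc l) (s_adj f)"
  unfolding bidegree_def s_adj_def s_coeff_def
proof (intro allI impI sum.neutral ballI)
  fix \<sigma> \<tau> :: "'a set" and m assume d: "card \<sigma> \<noteq> k \<or> card \<tau> \<noteq> Suc l" and m: "m \<in> \<tau> - \<sigma>"
  have "card (insert m \<sigma>) \<noteq> Suc k \<or> card (\<tau> - {m}) \<noteq> l"
    using d m by (auto simp: card_Diff_singleton) (metis Suc_pred card_gt_0_iff finite empty_iff)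
  then show "pos_sign \<tau> m * pos_sign \<sigma> m * f (insert m \<sigma>) (\<tau> - {m}) = 0"
    using assms by (auto simp: bidegree_def)
qed

lemma s_coeff_linear:
  "s_coeff (\<lambda>\<sigma> \<tau>. f \<sigma> \<tau> + g \<sigma> \<tau>) \<sigma> \<tau> = s_coeff f \<sigma> \<tau> + s_coeff g \<sigma> \<tau>"
  "s_coeff (\<lambda>\<sigma> \<tau>. c * f \<sigma> \<tau>) \<sigma> \<tau> = c * s_coeff f \<sigma> \<tau>"
  unfolding s_coeff_def
  by (simp_all add: distrib_left sum.distrib sum_distrib_left mult.left_commute)

text \<open>On bidegree \<open>(k + 1, k)\<close> the self-adjoint operator \<open>s s\<^sup>*\<close> is injective, hence surjective.\<close>

lemma s_coeff_surjective:
  fixes g :: "'n::{finite,linorder} coeffs"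
  shows "\<exists>f. bidegree k (Suc k) f \<and> (\<forall>\<sigma> \<tau>. card \<sigma> = Suc k \<longrightarrow> card \<tau> = k \<longrightarrow> s_coeff f \<sigma> \<tau> = g \<sigma> \<tau>)"
proof -
  define P where "P \<sigma> \<tau> \<longleftrightarrow> card \<sigma> = Suc k \<and> card \<tau> = k" for \<sigma> \<tau> :: "'n set"
  define mask where "mask x \<sigma> \<tau> = (if P \<sigma> \<tau> then x $ (\<sigma>, \<tau>) else 0)"
    for x :: "real ^ ('n set \<times> 'n set)" and \<sigma> \<tau>
  \<comment> \<open>Acting as the identity outside the bidegree makes \<open>K\<close> an
    endomorphism of the whole coordinate space, where injectivity implies surjectivity.\<close>
  define K where "K x = (\<chi> q. if P (fst q) (snd q) then s_coeff (s_adj (mask x)) (fst q) (snd q) else x $ q)"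
    for x :: "real ^ ('n set \<times> 'n set)"
  have mask_deg: "bidegree (Suc k) k (mask x)" for x by (auto simp: bidegree_def mask_def P_def)
  have adj_add: "s_adj (\<lambda>\<sigma> \<tau>. f \<sigma> \<tau> + h \<sigma> \<tau>) = (\<lambda>\<sigma> \<tau>. s_adj f \<sigma> \<tau> + s_adj h \<sigma> \<tau>)"
    and adj_cmult: "s_adj (\<lambda>\<sigma> \<tau>. c * f \<sigma> \<tau>) = (\<lambda>\<sigma> \<tau>. c * s_adj f \<sigma> \<tau>)"
    for f h :: "'n coeffs" and c
    by (simp_all add: s_adj_def fun_eq_iff s_coeff_linear)
  have "linear K"
  proof (rule linearI)
    fix x y :: "real ^ ('n set \<times> 'n set)" and c :: real
    have "mask (x + y) = (\<lambda>\<sigma> \<tau>. mask x \<sigma> \<tau> + mask y \<sigma> \<tau>)" by (auto simp: mask_def fun_eq_iff)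
    then show "K (x + y) = K x + K y" by (simp add: K_def vec_eq_iff adj_add s_coeff_linear)
    have "mask (c *\<^sub>R x) = (\<lambda>\<sigma> \<tau>. c * mask x \<sigma> \<tau>)" by (auto simp: mask_def fun_eq_iff)
    then show "K (c *\<^sub>R x) = c *\<^sub>R K x" by (simp add: K_def vec_eq_iff adj_cmult s_coeff_linear)
  qed
  moreover have "x = 0" if "K x = 0" for x
  proof -
    have on: "s_coeff (s_adj (mask x)) \<sigma> \<tau> = 0" if "P \<sigma> \<tau>" for \<sigma> \<tau>
    proof -
      have "K x $ (\<sigma>, \<tau>) = 0" using \<open>K x = 0\<close> by simp
      then show ?thesis using that by (simp add: K_def)
    qed
    have off: "x $ (\<sigma>, \<tau>) = 0" if "\<not> P \<sigma> \<tau>" for \<sigma> \<tau>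
    proof -
      have "K x $ (\<sigma>, \<tau>) = 0" using \<open>K x = 0\<close> by simp
      then show ?thesis using that by (simp add: K_def)
    qed
    \<comment> \<open>Pairing the vanishing of \<open>s_coeff (s_adj (mask x))\<close> with
      \<open>mask x\<close> gives the squared norm of \<open>s_adj (mask x)\<close>.\<close>
    have "coeff_inner (s_adj (mask x)) (s_adj (mask x)) = coeff_inner (s_coeff (s_adj (mask x))) (mask x)"
      by (simp add: coeff_inner_s_adj)
    also have "\<dots> = 0"
      unfolding coeff_inner_def by (intro sum.neutral ballI) (auto simp: mask_def on)
    finally have "s_adj (mask x) = (\<lambda>\<sigma> \<tau>. 0)" by (rule coeff_inner_self(2))
    from s_adj_injective[OF mask_deg _ this] have "mask x = (\<lambda>\<sigma> \<tau>. 0)" by simp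
    then have "mask x \<sigma> \<tau> = 0" for \<sigma> \<tau> by simp
    then have "(if P \<sigma> \<tau> then x $ (\<sigma>, \<tau>) else 0) = 0" for \<sigma> \<tau> unfolding mask_def .
    then have "x $ (\<sigma>, \<tau>) = 0" for \<sigma> \<tau> using off by metis
    then show ?thesis by (simp add: vec_eq_iff)
  qed
  ultimately have "inj K" by (simp add: linear_injective_0)
  with \<open>linear K\<close> have "surj K" by (rule linear_inj_imp_surj)
  then obtain x where x: "K x = (\<chi> q. g (fst q) (snd q))" by (metis surjD)
  have "s_coeff (s_adj (mask x)) \<sigma> \<tau> = g \<sigma> \<tau>" if "P \<sigma> \<tau>" for \<sigma> \<tau>
  proof -
    have "K x $ (\<sigma>, \<tau>) = g \<sigma> \<tau>" using x by simp
    then show ?thesis using that by (simp add: K_def)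
  qed
  then show ?thesis using bidegree_s_adj[OF mask_deg, of x] by (auto simp: P_def)
qed

section \<open>From coefficients back to forms\<close>

lemma coeff_form_linear [simp]:
  "coeff_form (\<lambda>vs ws. \<mu> vs ws + \<nu> vs ws) \<sigma> \<tau> = coeff_form \<mu> \<sigma> \<tau> + coeff_form \<nu> \<sigma> \<tau>"
  "coeff_form (\<lambda>vs ws. \<mu> vs ws - \<nu> vs ws) \<sigma> \<tau> = coeff_form \<mu> \<sigma> \<tau> - coeff_form \<nu> \<sigma> \<tau>"
  "coeff_form (\<lambda>vs ws. c * \<mu> vs ws) \<sigma> \<tau> = c * coeff_form \<mu> \<sigma> \<tau>"
  "coeff_form (\<lambda>vs ws. 0) \<sigma> \<tau> = 0"
  by (simp_all add: coeff_form_def)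

lemma bidegree_coeff_form: "\<mu> \<in> Alt k l \<Longrightarrow> bidegree k l (coeff_form \<mu>)"
  unfolding bidegree_def by (intro allI impI) (rule coeff_form_wrong_degree)

lemma coeff_form_s_map_s_coeff: "\<mu> \<in> Alt k l \<Longrightarrow> coeff_form (s_map \<mu>) = s_coeff (coeff_form \<mu>)"
  by (simp add: fun_eq_iff coeff_form_s_map s_coeff_def)

lemma coeff_from_coeff_bidegree:
  assumes "bidegree k l f"
  shows "coeff_form (from_coeff k l f) = f"
proof (intro ext)
  fix \<sigma> \<tau>
  show "coeff_form (from_coeff k l f) \<sigma> \<tau> = f \<sigma> \<tau>"
  proof (cases "card \<sigma> = k \<and> card \<tau> = l")
    case False
    then have "coeff_form (from_coeff k l f) \<sigma> \<tau> = 0"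
      using coeff_form_wrong_degree[OF from_coeff_Alt] by blast
    then show ?thesis using False assms by (auto simp: bidegree_def)
  qed (simp add: coeff_from_coeff)
qed

lemma s_map_linear:
  "s_map (\<lambda>vs ws. \<mu> vs ws + \<nu> vs ws) = (\<lambda>vs ws. s_map \<mu> vs ws + s_map \<nu> vs ws)"
  "s_map (\<lambda>vs ws. c * \<mu> vs ws) = (\<lambda>vs ws. c * s_map \<mu> vs ws)"
  by (simp_all add: s_map_def fun_eq_iff distrib_left sum.distrib sum_distrib_left mult.left_commute)

lemma bij_betw_s_map:
  "bij_betw s_map (Alt k (Suc k)) (Alt (Suc k) k :: 'n::{finite,linorder} form2 set)"
  unfolding bij_betw_def
proof
  show "inj_on s_map (Alt k (Suc k) :: 'n form2 set)"
  proof (rule inj_onI)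
    fix \<mu> \<nu> :: "'n form2" assume \<mu>: "\<mu> \<in> Alt k (Suc k)" and \<nu>: "\<nu> \<in> Alt k (Suc k)" and eq: "s_map \<mu> = s_map \<nu>"
    define d where "d vs ws = \<mu> vs ws + (-1) * \<nu> vs ws" for vs ws
    have d: "d \<in> Alt k (Suc k)" unfolding d_def by (intro Alt_add Alt_cmult \<mu> \<nu>)
    have "s_map d = (\<lambda>vs ws. s_map \<mu> vs ws + (-1) * s_map \<nu> vs ws)"
      unfolding d_def s_map_linear ..
    then have "s_map d = (\<lambda>vs ws. 0)" by (simp add: eq)
    then have "coeff_form (s_map d) = (\<lambda>\<sigma> \<tau>. 0)" by (simp add: fun_eq_iff coeff_form_def)
    then have "s_coeff (coeff_form d) = (\<lambda>\<sigma> \<tau>. 0)"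
      unfolding coeff_form_s_map_s_coeff[OF d] .
    from s_coeff_injective[OF bidegree_coeff_form[OF d] _ this]
    have "coeff_form d \<sigma> \<tau> = 0" for \<sigma> \<tau> by simp
    then have "coeff_form \<mu> \<sigma> \<tau> = coeff_form \<nu> \<sigma> \<tau>" for \<sigma> \<tau>
      unfolding d_def coeff_form_linear by simp
    then show "\<mu> = \<nu>" by (intro Alt_eqI[OF \<mu> \<nu>])
  qed
  show "s_map ` Alt k (Suc k) = (Alt (Suc k) k :: 'n form2 set)"
  proof (intro set_eqI iffI)
    fix \<nu> :: "'n form2" assume \<nu>: "\<nu> \<in> Alt (Suc k) k"
    obtain f where f: "bidegree k (Suc k) f"
      "\<And>\<sigma> \<tau>. card \<sigma> = Suc k \<Longrightarrow> card \<tau> = k \<Longrightarrow> s_coeff f \<sigma> \<tau> = coeff_form \<nu> \<sigma> \<tau>"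
      using s_coeff_surjective[of k "coeff_form \<nu>"] by blast
    have "s_map (from_coeff k (Suc k) f) = \<nu>"
      by (rule Alt_eqI[OF s_map_Alt[OF from_coeff_Alt] \<nu>])
        (simp add: coeff_form_s_map_s_coeff[OF from_coeff_Alt] coeff_from_coeff_bidegree[OF f(1)] f(2))
    then show "\<nu> \<in> s_map ` Alt k (Suc k)" using from_coeff_Alt by blast
  qed (auto intro: s_map_Alt)
qed

section \<open>Weights and maps that preserve them\<close>

definition weight :: "'n::{finite,linorder} set \<Rightarrow> 'n set \<Rightarrow> 'n \<Rightarrow> nat" where
  "weight \<sigma> \<tau> m = chi m \<sigma> + chi m \<tau>"

definition weight_proj :: "nat \<Rightarrow> nat \<Rightarrow> ('n \<Rightarrow> nat) \<Rightarrow> 'n::{finite,linorder} form2 \<Rightarrow> 'n form2" where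
  "weight_proj k l \<beta> \<mu> = from_coeff k l (\<lambda>\<sigma> \<tau>. if weight \<sigma> \<tau> = \<beta> then coeff_form \<mu> \<sigma> \<tau> else 0)"

lemma weight_proj_Alt: "weight_proj k l \<beta> \<mu> \<in> Alt k l"
  unfolding weight_proj_def by (rule from_coeff_Alt)

lemma coeff_weight_proj:
  assumes "\<mu> \<in> Alt k l"
  shows "coeff_form (weight_proj k l \<beta> \<mu>) \<sigma> \<tau> = (if weight \<sigma> \<tau> = \<beta> then coeff_form \<mu> \<sigma> \<tau> else 0)"
  unfolding weight_proj_def
  using bidegree_coeff_form[OF assms] by (subst coeff_from_coeff_bidegree) (auto simp: bidegree_def)

text \<open>Passing \<open>m\<close> from one factor to the other leaves the weight unchanged, so no
  term of \<open>s_map\<close> mixes weights.\<close>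

lemma s_map_weight_proj:
  fixes \<mu> :: "'n::{finite,linorder} form2"
  assumes \<mu>: "\<mu> \<in> Alt k (Suc l)"
  shows "s_map (weight_proj k (Suc l) \<beta> \<mu>) = weight_proj (Suc k) l \<beta> (s_map \<mu>)"
proof (rule Alt_eqI[OF s_map_Alt[OF weight_proj_Alt] weight_proj_Alt])
  fix \<sigma> \<tau> :: "'n set"
  have w: "weight (\<sigma> - {m}) (insert m \<tau>) = weight \<sigma> \<tau>" if "m \<in> \<sigma> - \<tau>" for m
    using that by (auto simp: weight_def chi_def fun_eq_iff)
  show "coeff_form (s_map (weight_proj k (Suc l) \<beta> \<mu>)) \<sigma> \<tau> = coeff_form (weight_proj (Suc k) l \<beta> (s_map \<mu>)) \<sigma> \<tau>"
    unfolding coeff_weight_proj[OF s_map_Alt[OF \<mu>]] coeff_form_s_map[OF weight_proj_Alt]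
      coeff_form_s_map[OF \<mu>] coeff_weight_proj[OF \<mu>]
    by (auto simp: w intro!: sum.neutral sum.cong)
qed

lemma inner_form_weight_proj:
  assumes "\<mu> \<in> Alt k l" "\<rho> \<in> Alt k l"
  shows "inner_form (weight_proj k l \<beta> \<mu>) \<rho> = inner_form \<mu> (weight_proj k l \<beta> \<rho>)"
  unfolding inner_form_def coeff_weight_proj[OF assms(1)] coeff_weight_proj[OF assms(2)]
  by (intro sum.cong) auto

text \<open>Linearity is asked for on \<open>Alt k l\<close> only, because \<open>inv_into\<close>
  takes unspecified values outside the range of \<open>s_map\<close>.\<close>

definition linear_forms :: "nat \<Rightarrow> nat \<Rightarrow> ('n::finite form2 \<Rightarrow> 'n form2) \<Rightarrow> bool" where
  "linear_forms k l L \<longleftrightarrow>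
     (\<forall>\<mu>\<in>Alt k l. \<forall>\<nu>\<in>Alt k l. L (\<lambda>vs ws. \<mu> vs ws + \<nu> vs ws) = (\<lambda>vs ws. L \<mu> vs ws + L \<nu> vs ws)) \<and>
     (\<forall>\<mu>\<in>Alt k l. \<forall>c. L (\<lambda>vs ws. c * \<mu> vs ws) = (\<lambda>vs ws. c * L \<mu> vs ws))"

lemma linear_forms_add:
  "linear_forms k l L \<Longrightarrow> \<mu> \<in> Alt k l \<Longrightarrow> \<nu> \<in> Alt k l \<Longrightarrow>
    L (\<lambda>vs ws. \<mu> vs ws + \<nu> vs ws) = (\<lambda>vs ws. L \<mu> vs ws + L \<nu> vs ws)"
  by (simp add: linear_forms_def)

lemma linear_forms_cmult:
  "linear_forms k l L \<Longrightarrow> \<mu> \<in> Alt k l \<Longrightarrow> L (\<lambda>vs ws. c * \<mu> vs ws) = (\<lambda>vs ws. c * L \<mu> vs ws)"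
  by (simp add: linear_forms_def)

lemma linear_forms_sum:
  assumes L: "linear_forms k l L" and \<mu>: "\<And>i. i \<in> I \<Longrightarrow> \<mu> i \<in> Alt k l" and "finite I"
  shows "L (\<lambda>vs ws. \<Sum>i\<in>I. c i * \<mu> i vs ws) = (\<lambda>vs ws. \<Sum>i\<in>I. c i * L (\<mu> i) vs ws)"
  using assms(3) \<mu>
proof (induction I rule: finite_induct)
  case empty
  show ?case
    using linear_forms_cmult[OF L Alt_zero, of 0] by simp
next
  case (insert i I)
  have 1: "(\<lambda>vs ws. c i * \<mu> i vs ws) \<in> Alt k l" "(\<lambda>vs ws. \<Sum>i\<in>I. c i * \<mu> i vs ws) \<in> Alt k l"
    using insert.prems by (auto intro!: Alt_sum Alt_cmult)
  have "L (\<lambda>vs ws. \<Sum>i\<in>insert i I. c i * \<mu> i vs ws) = L (\<lambda>vs ws. c i * \<mu> i vs ws + (\<Sum>i\<in>I. c i * \<mu> i vs ws))"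
    using insert.hyps by simp
  also have "\<dots> = (\<lambda>vs ws. L (\<lambda>vs ws. c i * \<mu> i vs ws) vs ws + L (\<lambda>vs ws. \<Sum>i\<in>I. c i * \<mu> i vs ws) vs ws)"
    by (rule linear_forms_add[OF L 1])
  also have "L (\<lambda>vs ws. c i * \<mu> i vs ws) = (\<lambda>vs ws. c i * L (\<mu> i) vs ws)"
    by (rule linear_forms_cmult[OF L insert.prems]) simp
  also have "L (\<lambda>vs ws. \<Sum>i\<in>I. c i * \<mu> i vs ws) = (\<lambda>vs ws. \<Sum>i\<in>I. c i * L (\<mu> i) vs ws)"
    using insert by simp
  finally show ?case using insert.hyps by simp
qed

definition weight_preserving :: "nat \<Rightarrow> nat \<Rightarrow> nat \<Rightarrow> nat \<Rightarrow> ('n::{finite,linorder} form2 \<Rightarrow> 'n form2) \<Rightarrow> bool" where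
  "weight_preserving k l k' l' L \<longleftrightarrow> linear_forms k l L \<and> (\<forall>\<mu>\<in>Alt k l. L \<mu> \<in> Alt k' l') \<and>
     (\<forall>\<mu>\<in>Alt k l. \<forall>\<beta>. L (weight_proj k l \<beta> \<mu>) = weight_proj k' l' \<beta> (L \<mu>))"

text \<open>A map that commutes with the weight projections has no matrix entries between different
  weights: \<open>\<mu>\<close> may be replaced by its part of the target weight before it is
  expanded in the \<open>dx\<close> basis.\<close>

lemma weight_preserving_coeff:
  assumes L: "weight_preserving k l k' l' L" and \<mu>: "\<mu> \<in> Alt k l"
  shows "coeff_form (L \<mu>) \<sigma> \<tau> =
    (\<Sum>(\<sigma>', \<tau>')\<in>{(\<sigma>', \<tau>'). card \<sigma>' = k \<and> card \<tau>' = l \<and> weight \<sigma>' \<tau>' = weight \<sigma> \<tau>}.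
      coeff_form (L (\<lambda>vs ws. dx \<sigma>' vs * dx \<tau>' ws)) \<sigma> \<tau> * coeff_form \<mu> \<sigma>' \<tau>')"
proof -
  let ?A = "{(\<sigma>', \<tau>'). card \<sigma>' = k \<and> card \<tau>' = l \<and> weight \<sigma>' \<tau>' = weight \<sigma> \<tau>}"
  let ?B = "{\<sigma>'. card \<sigma>' = k} \<times> {\<tau>'. card \<tau>' = l}"
  let ?d = "\<lambda>q vs ws. dx (fst q) vs * dx (snd q) ws"
  have "weight_proj k l (weight \<sigma> \<tau>) \<mu> = (\<lambda>vs ws. \<Sum>q\<in>?A. coeff_form \<mu> (fst q) (snd q) * ?d q vs ws)"
  proof (intro ext)
    fix vs ws
    have "weight_proj k l (weight \<sigma> \<tau>) \<mu> vs ws = (\<Sum>q\<in>?B. (if weight (fst q) (snd q) = weight \<sigma> \<tau>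
        then coeff_form \<mu> (fst q) (snd q) else 0) * ?d q vs ws)"
      unfolding weight_proj_def from_coeff_def sum.cartesian_product by (simp add: case_prod_beta)
    also have "\<dots> = (\<Sum>q\<in>?A. coeff_form \<mu> (fst q) (snd q) * ?d q vs ws)"
      by (rule sum.mono_neutral_cong_right) auto
    finally show "weight_proj k l (weight \<sigma> \<tau>) \<mu> vs ws = (\<Sum>q\<in>?A. coeff_form \<mu> (fst q) (snd q) * ?d q vs ws)" .
  qed
  moreover have "L (\<lambda>vs ws. \<Sum>q\<in>?A. coeff_form \<mu> (fst q) (snd q) * ?d q vs ws) =
      (\<lambda>vs ws. \<Sum>q\<in>?A. coeff_form \<mu> (fst q) (snd q) * L (?d q) vs ws)"
    using L by (intro linear_forms_sum[of k l]) (auto simp: weight_preserving_def intro: dx_tensor_Alt)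
  ultimately have *: "weight_proj k' l' (weight \<sigma> \<tau>) (L \<mu>) =
      (\<lambda>vs ws. \<Sum>q\<in>?A. coeff_form \<mu> (fst q) (snd q) * L (?d q) vs ws)"
    using L \<mu> unfolding weight_preserving_def by metis
  have "coeff_form (L \<mu>) \<sigma> \<tau> = coeff_form (weight_proj k' l' (weight \<sigma> \<tau>) (L \<mu>)) \<sigma> \<tau>"
    using L \<mu> by (subst coeff_weight_proj) (auto simp: weight_preserving_def)
  also have "\<dots> = (\<Sum>q\<in>?A. coeff_form \<mu> (fst q) (snd q) * coeff_form (L (?d q)) \<sigma> \<tau>)"
    unfolding * by (simp add: coeff_form_def)
  finally show ?thesis by (simp add: case_prod_beta mult.commute)
qed

text \<open>The inverse of a bijection inherits linearity and commutation with the weight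
  projections; each identity is checked after applying \<open>s_map\<close>.\<close>

lemma weight_preserving_inv_s_map:
  "weight_preserving (Suc k) k k (Suc k)
     (inv_into (Alt k (Suc k)) (s_map :: 'n::{finite,linorder} form2 \<Rightarrow> 'n form2))"
proof -
  let ?s = "s_map :: 'n form2 \<Rightarrow> 'n form2" and ?A = "Alt k (Suc k) :: 'n form2 set"
  let ?i = "inv_into ?A ?s"
  have inj: "inj_on ?s ?A" and img: "?s ` ?A = Alt (Suc k) k"
    using bij_betw_s_map[of k, where 'n = 'n] by (auto simp: bij_betw_def)
  have mem: "?i \<mu> \<in> ?A" and s_i: "?s (?i \<mu>) = \<mu>" if "\<mu> \<in> Alt (Suc k) k" for \<mu>
    using inv_into_into[of \<mu> ?s ?A] f_inv_into_f[of \<mu> ?s ?A] that unfolding img[symmetric] by auto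
  have i_s: "?i \<mu> = \<nu>" if "\<nu> \<in> ?A" "?s \<nu> = \<mu>" for \<mu> \<nu>
    using inv_into_f_f[OF inj that(1)] that(2) by simp
  show ?thesis
    unfolding weight_preserving_def linear_forms_def
    by (intro conjI ballI allI i_s mem)
      (auto simp: s_map_linear s_i s_map_weight_proj mem intro: Alt_add Alt_cmult weight_proj_Alt)
qed

text \<open>Carries forms to a Euclidean space, where orthogonal decompositions exist; it is
  injective on each \<open>Alt k l\<close>.\<close>

definition form_vec :: "'n::{finite,linorder} form2 \<Rightarrow> real ^ ('n set \<times> 'n set)" where
  "form_vec \<mu> = (\<chi> q. coeff_form \<mu> (fst q) (snd q))"

lemma inner_form_vec: "inner_form \<mu> \<nu> = form_vec \<mu> \<bullet> form_vec \<nu>"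
  unfolding inner_form_def inner_vec_def form_vec_def sum.cartesian_product UNIV_Times_UNIV
  by (simp add: case_prod_beta)

lemma form_vec_linear:
  "form_vec (\<lambda>vs ws. \<mu> vs ws + \<nu> vs ws) = form_vec \<mu> + form_vec \<nu>"
  "form_vec (\<lambda>vs ws. \<mu> vs ws - \<nu> vs ws) = form_vec \<mu> - form_vec \<nu>"
  "form_vec (\<lambda>vs ws. c * \<mu> vs ws) = c *\<^sub>R form_vec \<mu>"
  "form_vec (\<lambda>vs ws. 0) = 0"
  by (simp_all add: form_vec_def vec_eq_iff)

definition form_subspace :: "nat \<Rightarrow> nat \<Rightarrow> 'n::{finite,linorder} form2 set \<Rightarrow> bool" where
  "form_subspace k l V \<longleftrightarrow> V \<subseteq> Alt k l \<and> (\<lambda>vs ws. 0) \<in> V \<and>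
     (\<forall>\<mu>\<in>V. \<forall>\<nu>\<in>V. (\<lambda>vs ws. \<mu> vs ws + \<nu> vs ws) \<in> V) \<and> (\<forall>\<mu>\<in>V. \<forall>c. (\<lambda>vs ws. c * \<mu> vs ws) \<in> V)"

lemma form_subspace_add:
  "form_subspace k l V \<Longrightarrow> \<mu> \<in> V \<Longrightarrow> \<nu> \<in> V \<Longrightarrow> (\<lambda>vs ws. \<mu> vs ws + \<nu> vs ws) \<in> V"
  by (simp add: form_subspace_def)

lemma form_subspace_cmult: "form_subspace k l V \<Longrightarrow> \<mu> \<in> V \<Longrightarrow> (\<lambda>vs ws. c * \<mu> vs ws) \<in> V"
  by (simp add: form_subspace_def)

lemma form_vec_eq_iff: "\<mu> \<in> Alt k l \<Longrightarrow> \<nu> \<in> Alt k l \<Longrightarrow> form_vec \<mu> = form_vec \<nu> \<longleftrightarrow> \<mu> = \<nu>"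
  by (auto simp: form_vec_def vec_eq_iff intro: Alt_eqI)

lemma orth_proj_unique:
  assumes V: "form_subspace k l V"
    and \<nu>: "\<nu> \<in> V" "\<And>\<rho>. \<rho> \<in> V \<Longrightarrow> inner_form (\<lambda>vs ws. \<mu> vs ws - \<nu> vs ws) \<rho> = 0"
  shows "orth_proj V \<mu> = \<nu>"
  unfolding orth_proj_def
proof (rule the_equality)
  fix \<nu>' assume \<nu>': "\<nu>' \<in> V \<and> (\<forall>\<rho>\<in>V. inner_form (\<lambda>vs ws. \<mu> vs ws - \<nu>' vs ws) \<rho> = 0)"
  define d where "d vs ws = \<nu>' vs ws + (-1) * \<nu> vs ws" for vs ws
  have d: "d \<in> V" unfolding d_def
    using form_subspace_add[OF V _ form_subspace_cmult[OF V \<nu>(1)]] \<nu>' by blast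
  have fd: "form_vec d = form_vec \<nu>' - form_vec \<nu>" unfolding d_def form_vec_linear by simp
  have "(form_vec \<mu> - form_vec \<nu>) \<bullet> form_vec d = 0" "(form_vec \<mu> - form_vec \<nu>') \<bullet> form_vec d = 0"
    using \<nu>(2)[OF d] \<nu>' d by (auto simp: inner_form_vec form_vec_linear)
  then have "form_vec d \<bullet> form_vec d = 0"
    by (simp add: fd inner_diff_left)
  then have "form_vec \<nu>' = form_vec \<nu>" using fd by simp
  moreover have "\<nu> \<in> Alt k l" "\<nu>' \<in> Alt k l" using V \<nu> \<nu>' by (auto simp: form_subspace_def)
  ultimately show "\<nu>' = \<nu>" by (simp add: form_vec_eq_iff)
qed (use \<nu> in blast)

lemma orth_proj_exists:
  assumes V: "form_subspace k l V"
  shows "\<exists>\<nu>\<in>V. \<forall>\<rho>\<in>V. inner_form (\<lambda>vs ws. \<mu> vs ws - \<nu> vs ws) \<rho> = 0"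
proof -
  have sub: "subspace (form_vec ` V)"
    unfolding subspace_def
  proof (intro conjI ballI allI)
    have "(\<lambda>vs ws. 0) \<in> V" using V by (simp add: form_subspace_def)
    then show "0 \<in> form_vec ` V" by (metis form_vec_linear(4) imageI)
    show "x + y \<in> form_vec ` V" if xy: "x \<in> form_vec ` V" "y \<in> form_vec ` V" for x y
    proof -
      obtain \<mu>1 \<mu>2 where m: "x = form_vec \<mu>1" "y = form_vec \<mu>2" "\<mu>1 \<in> V" "\<mu>2 \<in> V" using xy by blast
      then have "(\<lambda>vs ws. \<mu>1 vs ws + \<mu>2 vs ws) \<in> V" by (intro form_subspace_add[OF V])
      then show ?thesis unfolding m(1,2) form_vec_linear(1)[symmetric] by (rule imageI)
    qed
    show "c *\<^sub>R x \<in> form_vec ` V" if x: "x \<in> form_vec ` V" for c x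
    proof -
      obtain \<mu>1 where m: "x = form_vec \<mu>1" "\<mu>1 \<in> V" using x by blast
      then have "(\<lambda>vs ws. c * \<mu>1 vs ws) \<in> V" by (intro form_subspace_cmult[OF V])
      then show ?thesis unfolding m(1) form_vec_linear(3)[symmetric] by (rule imageI)
    qed
  qed
  obtain y z where yz: "y \<in> span (form_vec ` V)" "\<And>w. w \<in> span (form_vec ` V) \<Longrightarrow> orthogonal z w"
    "form_vec \<mu> = y + z"
    using orthogonal_subspace_decomp_exists[of "form_vec ` V" "form_vec \<mu>"] by blast
  have span: "span (form_vec ` V) = form_vec ` V" using sub by (rule span_eq_iff[THEN iffD2])
  obtain \<nu> where \<nu>: "\<nu> \<in> V" "y = form_vec \<nu>" using yz(1) unfolding span by blast
  have "inner_form (\<lambda>vs ws. \<mu> vs ws - \<nu> vs ws) \<rho> = 0" if "\<rho> \<in> V" for \<rho>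
    using yz(2)[OF span_base[OF imageI[OF that]]] yz(3) \<nu>(2)
    by (simp add: inner_form_vec form_vec_linear orthogonal_def)
  then show ?thesis using \<nu>(1) by blast
qed

lemma orth_proj_props:
  assumes "form_subspace k l V"
  shows "orth_proj V \<mu> \<in> V"
    and "\<rho> \<in> V \<Longrightarrow> inner_form (\<lambda>vs ws. \<mu> vs ws - orth_proj V \<mu> vs ws) \<rho> = 0"
proof -
  obtain \<nu> where \<nu>: "\<nu> \<in> V"
    "\<forall>\<rho>\<in>V. inner_form (\<lambda>vs ws. \<mu> vs ws - \<nu> vs ws) \<rho> = 0"
    using orth_proj_exists[OF assms, of \<mu>] by (elim bexE)
  have eq: "orth_proj V \<mu> = \<nu>"
    by (rule orth_proj_unique[OF assms \<nu>(1)]) (rule bspec[OF \<nu>(2)])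
  show "orth_proj V \<mu> \<in> V" unfolding eq by (rule \<nu>(1))
  show "\<rho> \<in> V \<Longrightarrow> inner_form (\<lambda>vs ws. \<mu> vs ws - orth_proj V \<mu> vs ws) \<rho> = 0"
    unfolding eq by (rule bspec[OF \<nu>(2)])
qed

lemma form_subspace_orth_compl: "form_subspace k l (orth_compl k l R)"
  unfolding form_subspace_def orth_compl_def
  by (auto intro: Alt_zero Alt_add Alt_cmult simp: inner_form_vec form_vec_linear inner_add_left)

text \<open>The weight projections commute with \<open>s_map\<close> and are self-adjoint, so they
  map the orthogonal complement of its range into itself. A self-adjoint map that leaves a subspace
  invariant commutes with the orthogonal projection onto it.\<close>

lemma weight_preserving_orth_proj:
  "weight_preserving (Suc k) l (Suc k) l
     (orth_proj (orth_compl (Suc k) l (s_map ` (Alt k (Suc l) :: 'n::{finite,linorder} form2 set))))"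
proof -
  let ?V = "orth_compl (Suc k) l (s_map ` Alt k (Suc l)) :: 'n form2 set"
  note V = form_subspace_orth_compl[of "Suc k" l "s_map ` Alt k (Suc l) :: 'n form2 set"]
  note props = orth_proj_props[OF V]
  have VA: "\<mu> \<in> ?V \<Longrightarrow> \<mu> \<in> Alt (Suc k) l" for \<mu> by (simp add: orth_compl_def)
  have Vproj: "weight_proj (Suc k) l \<beta> \<mu> \<in> ?V" if \<mu>: "\<mu> \<in> ?V" for \<mu> \<beta>
    unfolding orth_compl_def
  proof (intro CollectI conjI weight_proj_Alt ballI)
    fix \<rho> :: "'n form2" assume "\<rho> \<in> s_map ` Alt k (Suc l)"
    then obtain \<eta> where \<eta>: "\<eta> \<in> Alt k (Suc l)" "\<rho> = s_map \<eta>" by blast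
    have "inner_form (weight_proj (Suc k) l \<beta> \<mu>) \<rho> = inner_form \<mu> (weight_proj (Suc k) l \<beta> \<rho>)"
      using VA[OF \<mu>] \<eta> by (intro inner_form_weight_proj) (auto intro: s_map_Alt)
    also have "\<dots> = inner_form \<mu> (s_map (weight_proj k (Suc l) \<beta> \<eta>))"
      by (simp add: \<eta> s_map_weight_proj)
    also have "\<dots> = 0"
      using \<mu> weight_proj_Alt[of k "Suc l" \<beta> \<eta>] by (auto simp: orth_compl_def)
    finally show "inner_form (weight_proj (Suc k) l \<beta> \<mu>) \<rho> = 0" .
  qed
  have orth: "(form_vec \<mu> - form_vec (orth_proj ?V \<mu>)) \<bullet> form_vec \<rho> = 0" if "\<rho> \<in> ?V" for \<mu> \<rho>
    using props(2)[OF that, of \<mu>] by (simp add: inner_form_vec form_vec_linear)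
  show ?thesis
    unfolding weight_preserving_def linear_forms_def
  proof (intro conjI ballI allI)
    fix \<mu> \<nu> :: "'n form2" and c \<beta>
    show "orth_proj ?V (\<lambda>vs ws. \<mu> vs ws + \<nu> vs ws) = (\<lambda>vs ws. orth_proj ?V \<mu> vs ws + orth_proj ?V \<nu> vs ws)"
    proof (rule orth_proj_unique[OF V])
      show "(\<lambda>vs ws. orth_proj ?V \<mu> vs ws + orth_proj ?V \<nu> vs ws) \<in> ?V"
        by (intro form_subspace_add[OF V] props(1))
      show "inner_form (\<lambda>vs ws. \<mu> vs ws + \<nu> vs ws - (orth_proj ?V \<mu> vs ws + orth_proj ?V \<nu> vs ws)) \<rho> = 0"
        if "\<rho> \<in> ?V" for \<rho>
        using orth[OF that, of \<mu>] orth[OF that, of \<nu>]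
        by (simp add: inner_form_vec form_vec_linear inner_diff_left inner_add_left)
    qed
    show "orth_proj ?V (\<lambda>vs ws. c * \<mu> vs ws) = (\<lambda>vs ws. c * orth_proj ?V \<mu> vs ws)"
    proof (rule orth_proj_unique[OF V])
      show "(\<lambda>vs ws. c * orth_proj ?V \<mu> vs ws) \<in> ?V"
        by (intro form_subspace_cmult[OF V] props(1))
      show "inner_form (\<lambda>vs ws. c * \<mu> vs ws - c * orth_proj ?V \<mu> vs ws) \<rho> = 0" if "\<rho> \<in> ?V" for \<rho>
        using orth[OF that, of \<mu>]
        by (simp add: inner_form_vec form_vec_linear inner_diff_left)
    qed
    show "orth_proj ?V \<mu> \<in> Alt (Suc k) l" using VA props(1) .
    assume \<mu>: "\<mu> \<in> Alt (Suc k) l"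
    show "orth_proj ?V (weight_proj (Suc k) l \<beta> \<mu>) = weight_proj (Suc k) l \<beta> (orth_proj ?V \<mu>)"
    proof (rule orth_proj_unique[OF V Vproj[OF props(1)]])
      fix \<rho> :: "'n form2" assume \<rho>: "\<rho> \<in> ?V"
      have "inner_form (weight_proj (Suc k) l \<beta> \<mu>) \<rho> - inner_form (weight_proj (Suc k) l \<beta> (orth_proj ?V \<mu>)) \<rho> = 0"
        using orth[OF Vproj[OF \<rho>], of \<mu>] \<mu> VA[OF \<rho>] VA[OF props(1)]
        by (simp add: inner_form_weight_proj inner_form_vec[of _ "weight_proj (Suc k) l \<beta> \<rho>"] inner_diff_left)
      then show "inner_form (\<lambda>vs ws. weight_proj (Suc k) l \<beta> \<mu> vs ws - weight_proj (Suc k) l \<beta> (orth_proj ?V \<mu>) vs ws) \<rho> = 0"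
        by (simp add: inner_form_vec form_vec_linear inner_diff_left)
    qed
  qed
qed


section \<open>The BGG operators\<close>

definition alt_distr :: "nat \<Rightarrow> nat \<Rightarrow> 'n::finite distr \<Rightarrow> bool" where
  "alt_distr k l U \<longleftrightarrow> (\<forall>\<phi>\<in>test_funs. U \<phi> \<in> Alt k l)"

text \<open>A term \<open>(c, \<sigma>, \<tau>, ms)\<close> stands for \<open>c\<close> times the coefficient of \<open>dx\<^sup>\<sigma> \<otimes> dx\<^sup>\<tau>\<close>, differentiated in the
  directions \<open>ms\<close>.\<close>

type_synonym 'n dterm = "real \<times> 'n set \<times> 'n set \<times> 'n list"

definition term_sum :: "'n::{finite,linorder} dterm list \<Rightarrow> 'n distr \<Rightarrow> ((real, 'n) vec \<Rightarrow> real) \<Rightarrow> real" where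
  "term_sum ts U \<phi> = (\<Sum>(c, \<sigma>, \<tau>, ms)\<leftarrow>ts. c * coeff_form (U (partials ms \<phi>)) \<sigma> \<tau>)"

definition terms_of_weight :: "nat \<Rightarrow> nat \<Rightarrow> ('n \<Rightarrow> nat) \<Rightarrow> 'n::{finite,linorder} dterm list \<Rightarrow> bool" where
  "terms_of_weight k l \<alpha> ts \<longleftrightarrow> (\<forall>(c, \<sigma>, \<tau>, ms)\<in>set ts.
     card \<sigma> = k \<and> card \<tau> = l \<and> (\<forall>m. weight \<sigma> \<tau> m + count_list ms m = \<alpha> m))"

text \<open>The list \<open>ts\<close> must not depend on \<open>U\<close>: the same terms are
  evaluated at \<open>u\<close> and at its interpolant.\<close>

definition has_terms :: "nat \<Rightarrow> nat \<Rightarrow> ('n::{finite,linorder} distr \<Rightarrow> 'n distr) \<Rightarrow> 'n set \<Rightarrow> 'n set \<Rightarrow>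
    'n dterm list \<Rightarrow> bool" where
  "has_terms k l D \<sigma> \<tau> ts \<longleftrightarrow> terms_of_weight k l (weight \<sigma> \<tau>) ts \<and>
     (\<forall>U. alt_distr k l U \<longrightarrow> (\<forall>\<phi>\<in>test_funs. coeff_form (D U \<phi>) \<sigma> \<tau> = term_sum ts U \<phi>))"

definition weighted_op :: "nat \<Rightarrow> nat \<Rightarrow> nat \<Rightarrow> nat \<Rightarrow> ('n::{finite,linorder} distr \<Rightarrow> 'n distr) \<Rightarrow> bool" where
  "weighted_op k l k' l' D \<longleftrightarrow> (\<forall>U. alt_distr k l U \<longrightarrow> alt_distr k' l' (D U)) \<and>
     (\<forall>\<sigma> \<tau>. card \<sigma> = k' \<longrightarrow> card \<tau> = l' \<longrightarrow> (\<exists>ts. has_terms k l D \<sigma> \<tau> ts))"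

lemma ext_d_Alt:
  assumes U: "alt_distr k l U" and \<phi>: "\<phi> \<in> test_funs"
  shows "ext_d U \<phi> \<in> Alt (Suc k) l"
proof -
  have "(\<lambda>vs ws. (-1) * (\<Sum>m\<in>UNIV. wedge1 m (\<lambda>vs'. U (partial (ax m) \<phi>) vs' ws) vs)) \<in> Alt (Suc k) l"
    using U test_funs_partial[OF \<phi> axis_Basis]
    by (intro Alt_cmult Alt_sum wedge1_Alt) (auto simp: alt_distr_def)
  then show ?thesis by (simp add: ext_d_def[abs_def])
qed

text \<open>The derivative in direction \<open>m\<close> enters the coefficient at
  \<open>\<sigma>\<close> through the one at \<open>\<sigma> - {m}\<close>; the unit of weight lost
  at \<open>m\<close> is made up by the derivative.\<close>

lemma weighted_op_ext_d: "weighted_op k l (Suc k) l ext_d"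
  unfolding weighted_op_def
proof (intro conjI allI impI)
  fix U :: "'n::{finite,linorder} distr"
  assume "alt_distr k l U"
  then show "alt_distr (Suc k) l (ext_d U)" using ext_d_Alt by (auto simp: alt_distr_def)
next
  fix \<sigma> \<tau> :: "'n::{finite,linorder} set"
  assume c: "card \<sigma> = Suc k" "card \<tau> = l"
  \<comment> \<open>The minus sign is that of the distributional derivative.\<close>
  define ts where "ts = map (\<lambda>m. (- pos_sign \<sigma> m, \<sigma> - {m}, \<tau>, [m])) (sorted_list_of_set \<sigma>)"
  have "terms_of_weight k l (weight \<sigma> \<tau>) ts"
    using c by (auto simp: terms_of_weight_def ts_def weight_def chi_def card_Diff_singleton)
  moreover have "coeff_form (ext_d U \<phi>) \<sigma> \<tau> = term_sum ts U \<phi>" for U :: "'n distr" and \<phi>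
  proof -
    have "coeff_form (ext_d U \<phi>) \<sigma> \<tau> = - (\<Sum>m\<in>UNIV. if m \<in> \<sigma> then
        pos_sign \<sigma> m * coeff_form (U (partial (ax m) \<phi>)) (\<sigma> - {m}) \<tau> else 0)"
      unfolding coeff_form_def ext_d_def wedge1_basis_list ..
    also have "(\<Sum>m\<in>UNIV. if m \<in> \<sigma> then
        pos_sign \<sigma> m * coeff_form (U (partial (ax m) \<phi>)) (\<sigma> - {m}) \<tau> else 0) =
        (\<Sum>m\<in>\<sigma>. pos_sign \<sigma> m * coeff_form (U (partial (ax m) \<phi>)) (\<sigma> - {m}) \<tau>)"
      by (rule sum.mono_neutral_cong_right) auto
    also have "- \<dots> = term_sum ts U \<phi>"
      unfolding term_sum_def ts_def
      by (simp add: o_def sum_list_distinct_conv_sum_set sum_negf)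
    finally show ?thesis .
  qed
  ultimately show "\<exists>ts. has_terms k l ext_d \<sigma> \<tau> ts"
    unfolding has_terms_def by blast
qed

lemma weighted_op_pointwise:
  fixes L :: "'n::{finite,linorder} form2 \<Rightarrow> 'n form2"
  assumes L: "weight_preserving k l k' l' L"
  shows "weighted_op k l k' l' (\<lambda>U \<phi>. L (U \<phi>))"
  unfolding weighted_op_def
proof (intro conjI allI impI)
  fix U :: "'n distr"
  assume "alt_distr k l U"
  then show "alt_distr k' l' (\<lambda>\<phi>. L (U \<phi>))"
    using L by (auto simp: alt_distr_def weight_preserving_def)
next
  fix \<sigma> \<tau> :: "'n set"
  let ?A = "{(\<sigma>', \<tau>'). card \<sigma>' = k \<and> card \<tau>' = l \<and> weight \<sigma>' \<tau>' = weight \<sigma> \<tau>}"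
  obtain qs where qs: "set qs = ?A" "distinct qs"
    using finite_distinct_list[of ?A] finite by auto
  define ts where "ts = map (\<lambda>(\<sigma>', \<tau>').
    (coeff_form (L (\<lambda>vs ws. dx \<sigma>' vs * dx \<tau>' ws)) \<sigma> \<tau>, \<sigma>', \<tau>', [] :: 'n list)) qs"
  have "terms_of_weight k l (weight \<sigma> \<tau>) ts"
    using qs(1) by (auto simp: terms_of_weight_def ts_def)
  moreover have "coeff_form (L (U \<phi>)) \<sigma> \<tau> = term_sum ts U \<phi>"
    if "alt_distr k l U" "\<phi> \<in> test_funs" for U :: "'n distr" and \<phi>
  proof -
    have "U \<phi> \<in> Alt k l" using that by (simp add: alt_distr_def)
    from weight_preserving_coeff[OF L this, of \<sigma> \<tau>] show ?thesis
      unfolding term_sum_def ts_def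
      by (simp add: o_def case_prod_beta sum_list_distinct_conv_sum_set[OF qs(2)] qs(1))
  qed
  ultimately show "\<exists>ts. has_terms k l (\<lambda>U \<phi>. L (U \<phi>)) \<sigma> \<tau> ts"
    unfolding has_terms_def by blast
qed

lemma term_sum_concat_map: "term_sum (concat (map f xs)) U \<phi> = (\<Sum>x\<leftarrow>xs. term_sum (f x) U \<phi>)"
  by (induction xs) (simp_all add: term_sum_def)

lemma weighted_op_compose:
  fixes D1 D2 :: "'n::{finite,linorder} distr \<Rightarrow> 'n distr"
  assumes D1: "weighted_op k l k1 l1 D1" and D2: "weighted_op k1 l1 k2 l2 D2"
  shows "weighted_op k l k2 l2 (\<lambda>U. D2 (D1 U))"
  unfolding weighted_op_def
proof (intro conjI allI impI)
  fix U :: "'n distr" assume "alt_distr k l U"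
  then show "alt_distr k2 l2 (D2 (D1 U))" using D1 D2 by (auto simp: weighted_op_def)
next
  fix \<sigma> \<tau> :: "'n set" assume c: "card \<sigma> = k2" "card \<tau> = l2"
  define ts1 where "ts1 \<sigma> \<tau> = (SOME ts. has_terms k l D1 \<sigma> \<tau> ts)" for \<sigma> \<tau>
  have t1: "has_terms k l D1 \<sigma> \<tau> (ts1 \<sigma> \<tau>)" if "card \<sigma> = k1" "card \<tau> = l1" for \<sigma> \<tau>
  proof -
    have "\<exists>ts. has_terms k l D1 \<sigma> \<tau> ts" using D1 that unfolding weighted_op_def by blast
    then show ?thesis unfolding ts1_def by (rule someI_ex)
  qed
  have w1: "terms_of_weight k l (weight \<sigma> \<tau>) (ts1 \<sigma> \<tau>)" if "card \<sigma> = k1" "card \<tau> = l1" for \<sigma> \<tau>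
    using t1[OF that] by (simp add: has_terms_def)
  have e1: "coeff_form (D1 U \<phi>) \<sigma> \<tau> = term_sum (ts1 \<sigma> \<tau>) U \<phi>"
    if "card \<sigma> = k1" "card \<tau> = l1" "alt_distr k l U" "\<phi> \<in> test_funs" for \<sigma> \<tau> U \<phi>
    using t1[OF that(1,2)] that(3,4) by (simp add: has_terms_def)
  obtain ts2 where t2: "has_terms k1 l1 D2 \<sigma> \<tau> ts2"
    using D2 c unfolding weighted_op_def by blast
  have w2: "terms_of_weight k1 l1 (weight \<sigma> \<tau>) ts2" using t2 by (simp add: has_terms_def)
  have e2: "coeff_form (D2 U \<phi>) \<sigma> \<tau> = term_sum ts2 U \<phi>"
    if "alt_distr k1 l1 U" "\<phi> \<in> test_funs" for U \<phi>
    using t2 that by (simp add: has_terms_def)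
  \<comment> \<open>The derivatives \<open>ms\<close> of the outer operator act on the test function
    first, so they stand at the inner end of the list \<open>ms' @ ms\<close>.\<close>
  define comp where "comp = (\<lambda>(c, \<sigma>1, \<tau>1, ms). map (\<lambda>(c', \<sigma>', \<tau>', ms'). (c * c', \<sigma>', \<tau>', ms' @ ms)) (ts1 \<sigma>1 \<tau>1))"
  define ts where "ts = concat (map comp ts2)"
  have "terms_of_weight k l (weight \<sigma> \<tau>) ts"
    unfolding terms_of_weight_def
  proof (intro ballI, clarify)
    fix c \<sigma>' \<tau>' and ms :: "'n list" assume "(c, \<sigma>', \<tau>', ms) \<in> set ts"
    then obtain c2 \<sigma>1 \<tau>1 ms2 c1 ms1 where t: "(c2, \<sigma>1, \<tau>1, ms2) \<in> set ts2" "(c1, \<sigma>', \<tau>', ms1) \<in> set (ts1 \<sigma>1 \<tau>1)"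
      "ms = ms1 @ ms2"
      by (auto simp: ts_def comp_def)
    have a: "card \<sigma>1 = k1" "card \<tau>1 = l1" "\<And>m. weight \<sigma>1 \<tau>1 m + count_list ms2 m = weight \<sigma> \<tau> m"
      using w2 t(1) by (auto simp: terms_of_weight_def)
    have b: "card \<sigma>' = k" "card \<tau>' = l" "\<And>m. weight \<sigma>' \<tau>' m + count_list ms1 m = weight \<sigma>1 \<tau>1 m"
      using w1[OF a(1,2)] t(2) by (auto simp: terms_of_weight_def)
    show "card \<sigma>' = k \<and> card \<tau>' = l \<and> (\<forall>m. weight \<sigma>' \<tau>' m + count_list ms m = weight \<sigma> \<tau> m)"
      using b(1,2) a(3) b(3) by (simp add: t(3) count_list_append add.assoc[symmetric])
  qed
  moreover have "coeff_form (D2 (D1 U) \<phi>) \<sigma> \<tau> = term_sum ts U \<phi>"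
    if U: "alt_distr k l U" and \<phi>: "\<phi> \<in> test_funs" for U :: "'n distr" and \<phi>
  proof -
    have D1U: "alt_distr k1 l1 (D1 U)" using D1 U by (simp add: weighted_op_def)
    have "coeff_form (D2 (D1 U) \<phi>) \<sigma> \<tau> =
        (\<Sum>(c, \<sigma>1, \<tau>1, ms)\<leftarrow>ts2. c * coeff_form (D1 U (partials ms \<phi>)) \<sigma>1 \<tau>1)"
      using e2[OF D1U \<phi>] by (simp add: term_sum_def)
    also have "\<dots> = (\<Sum>t\<leftarrow>ts2. term_sum (comp t) U \<phi>)"
    proof (intro arg_cong[of _ _ sum_list] map_cong[OF refl], clarify)
      fix c \<sigma>1 \<tau>1 and ms :: "'n list" assume t: "(c, \<sigma>1, \<tau>1, ms) \<in> set ts2"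
      then have a: "card \<sigma>1 = k1" "card \<tau>1 = l1" using w2 by (auto simp: terms_of_weight_def)
      show "c * coeff_form (D1 U (partials ms \<phi>)) \<sigma>1 \<tau>1 = term_sum (comp (c, \<sigma>1, \<tau>1, ms)) U \<phi>"
        unfolding e1[OF a U test_funs_partials[OF \<phi>]] comp_def term_sum_def
        by (simp add: o_def case_prod_beta sum_list_const_mult[symmetric] mult.assoc)
    qed
    also have "\<dots> = term_sum ts U \<phi>"
      unfolding ts_def by (simp add: term_sum_concat_map)
    finally show ?thesis .
  qed
  ultimately show "\<exists>ts. has_terms k l (\<lambda>U. D2 (D1 U)) \<sigma> \<tau> ts"
    unfolding has_terms_def by blast
qed

text \<open>In each case the operator is composed of \<open>ext_d\<close> and pointwise
  weight-preserving maps. Two derivatives occur only for \<open>k + 1 = J\<close>, which is why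
  second-order regularity is needed.\<close>

lemma weighted_op_BGG:
  assumes J: "1 \<le> J"
  shows "weighted_op k (l_deg J k) (Suc k) (l_deg J (Suc k)) (BGG J k :: 'n::{finite,linorder} distr \<Rightarrow> 'n distr)"
proof -
  consider "k + 1 < J" | "k + 1 = J" | "J \<le> k" by linarith
  then show ?thesis
  proof cases
    case 1
    have "weight_preserving (Suc k) (J - 1) (Suc k) (J - 1)
        (orth_proj (orth_compl (k + 1) (J - 1) (s_range_into (k + 1) J) :: 'n form2 set))"
      using weight_preserving_orth_proj[of k "J - 1"] J by simp
    from weighted_op_compose[OF weighted_op_ext_d weighted_op_pointwise[OF this]]
    have "weighted_op k (J - 1) (Suc k) (J - 1) (BGG J k :: 'n distr \<Rightarrow> 'n distr)" using 1 by (simp add: BGG_def[abs_def])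
    moreover have "l_deg J k = J - 1" "l_deg J (Suc k) = J - 1" using 1 by (auto simp: l_deg_def)
    ultimately show ?thesis by simp
  next
    case 2
    then have J': "J = Suc k" by simp
    have "weighted_op k k (Suc k) (Suc k) (\<lambda>U :: 'n distr. ext_d (\<lambda>\<phi>. inv_into (Alt k (Suc k)) s_map (ext_d U \<phi>)))"
      by (rule weighted_op_compose[OF weighted_op_compose[OF weighted_op_ext_d
            weighted_op_pointwise[OF weight_preserving_inv_s_map]] weighted_op_ext_d])
    then show ?thesis by (simp add: BGG_def[abs_def] l_deg_def J')
  next
    case 3
    then have "(BGG J k :: 'n distr \<Rightarrow> 'n distr) = ext_d" "l_deg J k = J" "l_deg J (Suc k) = J"
      using J by (auto simp: BGG_def[abs_def] l_deg_def)
    then show ?thesis using weighted_op_ext_d by simp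
  qed
qed

section \<open>Distributions given by square-integrable forms\<close>

lemma dist_of_ip: "dist_of u \<phi> vs ws = ip (\<lambda>x. u x vs ws) \<phi>"
  by (simp add: dist_of_def ip_def)

lemma coeff_form_dist_of: "coeff_form (dist_of u \<phi>) \<sigma> \<tau> = ip (\<lambda>x. coeff_form (u x) \<sigma> \<tau>) \<phi>"
  by (simp add: coeff_form_def dist_of_ip)

lemma ip_cong_cube: "(\<And>x. x \<in> cbox 0 One \<Longrightarrow> f x = g x) \<Longrightarrow> ip f h = ip g h"
  unfolding ip_def by (rule Bochner_Integration.integral_cong) auto

lemma alternating_form_ip:
  fixes f :: "real ^ 'n \<Rightarrow> 'n::finite form"
  assumes f: "\<And>x. x \<in> cbox 0 One \<Longrightarrow> alternating_form k (f x)"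
    and L2: "\<And>vs. (\<lambda>x. f x vs) \<in> L2" and \<phi>: "\<phi> \<in> L2"
  shows "alternating_form k (\<lambda>vs. ip (\<lambda>x. f x vs) \<phi>)"
  unfolding alternating_form_def
proof (intro conjI allI impI)
  fix vs :: "(real ^ 'n) list" and i j
  have zero: "ip (\<lambda>x. f x vs) \<phi> = 0" if "\<And>x. x \<in> cbox 0 One \<Longrightarrow> f x vs = 0"
    using ip_cong_cube[of "\<lambda>x. f x vs" "\<lambda>x. 0" \<phi>] that by simp
  show "length vs \<noteq> k \<Longrightarrow> ip (\<lambda>x. f x vs) \<phi> = 0"
    by (intro zero alternating_form_length[OF f])
  assume l: "length vs = k"
  show "i < j \<Longrightarrow> j < k \<Longrightarrow> vs ! i = vs ! j \<Longrightarrow> ip (\<lambda>x. f x vs) \<phi> = 0"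
    using l by (intro zero alternating_form_repeat[OF f, of _ i j]) auto
  show "i < k \<Longrightarrow> linear (\<lambda>v. ip (\<lambda>x. f x (vs[i := v])) \<phi>)"
  proof -
    assume "i < k"
    then have lin: "linear (\<lambda>v. f x (vs[i := v]))" if "x \<in> cbox 0 One" for x
      using f[OF that] l unfolding alternating_form_def by simp
    show ?thesis
    proof (rule linearI)
      fix v w c
      have "ip (\<lambda>x. f x (vs[i := v + w])) \<phi> = ip (\<lambda>x. f x (vs[i := v]) + f x (vs[i := w])) \<phi>"
        by (rule ip_cong_cube) (rule linear_add[OF lin])
      then show "ip (\<lambda>x. f x (vs[i := v + w])) \<phi> = ip (\<lambda>x. f x (vs[i := v])) \<phi> + ip (\<lambda>x. f x (vs[i := w])) \<phi>"
        by (simp add: ip_add_left L2 \<phi>)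
      have "ip (\<lambda>x. f x (vs[i := c *\<^sub>R v])) \<phi> = ip (\<lambda>x. c * f x (vs[i := v])) \<phi>"
        by (rule ip_cong_cube) (use linear_scale[OF lin] in simp)
      then show "ip (\<lambda>x. f x (vs[i := c *\<^sub>R v])) \<phi> = c *\<^sub>R ip (\<lambda>x. f x (vs[i := v])) \<phi>" by simp
    qed
  qed
qed

lemma alt_distr_dist_of:
  assumes u: "\<And>x. x \<in> cbox 0 One \<Longrightarrow> u x \<in> Alt k l" and L2: "\<And>vs ws. (\<lambda>x. u x vs ws) \<in> L2"
  shows "alt_distr k l (dist_of u)"
  unfolding alt_distr_def
proof
  fix \<phi> :: "real ^ 'a \<Rightarrow> real" assume "\<phi> \<in> test_funs"
  then have \<phi>: "\<phi> \<in> L2" by (rule test_funs_L2)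
  have "alternating_form k (\<lambda>vs. ip (\<lambda>x. u x vs ws) \<phi>)" for ws
    using alternating_form_ip[of k "\<lambda>x vs. u x vs ws"] Alt_D(1)[OF u] L2 \<phi> by blast
  moreover have "alternating_form l (\<lambda>ws. ip (\<lambda>x. u x vs ws) \<phi>)" for vs
    using alternating_form_ip[of l "\<lambda>x ws. u x vs ws"] Alt_D(2)[OF u] L2 \<phi> by blast
  ultimately show "dist_of u \<phi> \<in> Alt k l"
    by (intro Alt_I) (simp_all add: dist_of_ip[abs_def])
qed

lemma BGG_E_subset_Alt: "BGG_E J k \<subseteq> Alt k (l_deg J k)"
  by (auto simp: BGG_E_def l_deg_def orth_compl_def)

context quasi_interpolation
begin

lemma tensor_interp_from_coeff:
  "tensor_interp p k l u x = from_coeff k l (\<lambda>\<sigma> \<tau>. interp \<sigma> \<tau> (\<lambda>y. coeff_form (u y) \<sigma> \<tau>) x)"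
  by (intro ext) (simp add: tensor_interp_def from_coeff_def)

lemma alt_distr_tensor_interp:
  assumes "\<And>vs ws. (\<lambda>x. u x vs ws) \<in> L2"
  shows "alt_distr k l (dist_of (tensor_interp p k l u))"
proof (rule alt_distr_dist_of)
  show "tensor_interp p k l u x \<in> Alt k l" for x
    unfolding tensor_interp_from_coeff by (rule from_coeff_Alt)
  have c: "(\<lambda>y. coeff_form (u y) \<sigma> \<tau>) \<in> L2" for \<sigma> \<tau>
    unfolding coeff_form_def by (rule assms)
  have "(\<lambda>x. (dx \<sigma> vs * dx \<tau> ws) * interp \<sigma> \<tau> (\<lambda>y. coeff_form (u y) \<sigma> \<tau>) x) \<in> L2" for \<sigma> \<tau> vs ws
    by (intro L2_cmult interp_L2 c)
  then show "(\<lambda>x. tensor_interp p k l u x vs ws) \<in> L2" for vs ws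
    unfolding tensor_interp_def by (intro L2_sum) (simp add: mult.commute)
qed

lemma coeff_dist_of_tensor_interp:
  "card \<sigma> = k \<Longrightarrow> card \<tau> = l \<Longrightarrow>
    coeff_form (dist_of (tensor_interp p k l u) \<phi>) \<sigma> \<tau> = ip (interp \<sigma> \<tau> (\<lambda>y. coeff_form (u y) \<sigma> \<tau>)) \<phi>"
  unfolding coeff_form_dist_of tensor_interp_from_coeff by (simp add: coeff_from_coeff)

text \<open>One list of terms describes a coefficient of \<open>D\<close> on both sides: at
  \<open>u\<close> the sum is represented by \<open>g\<close>, and at the interpolant of
  \<open>u\<close> it is the right side of \<open>interp_commutes_weighted\<close>.\<close>

lemma tensor_interp_commutes_weighted_op:
  assumes D: "weighted_op k l k' l' D"
    and u: "\<And>x. x \<in> cbox 0 One \<Longrightarrow> u x \<in> Alt k l" "\<And>vs ws. (\<lambda>x. u x vs ws) \<in> L2"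
    and g: "\<And>vs ws. (\<lambda>x. g x vs ws) \<in> L2"
    and Du: "dist_eq (D (dist_of u)) (dist_of g)"
  shows "dist_eq (dist_of (tensor_interp p k' l' g)) (D (dist_of (tensor_interp p k l u)))"
  unfolding dist_eq_def
proof
  fix \<phi> :: "(real, 'n) vec \<Rightarrow> real" assume \<phi>: "\<phi> \<in> test_funs"
  have U: "alt_distr k l (dist_of u)" by (rule alt_distr_dist_of[OF u])
  have \<Pi>u: "alt_distr k l (dist_of (tensor_interp p k l u))" by (rule alt_distr_tensor_interp[OF u(2)])
  show "dist_of (tensor_interp p k' l' g) \<phi> = D (dist_of (tensor_interp p k l u)) \<phi>"
  proof (rule Alt_eqI)
    show "dist_of (tensor_interp p k' l' g) \<phi> \<in> Alt k' l'"
      using alt_distr_tensor_interp[OF g] \<phi> by (simp add: alt_distr_def)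
    show "D (dist_of (tensor_interp p k l u)) \<phi> \<in> Alt k' l'"
      using D \<Pi>u \<phi> by (simp add: weighted_op_def alt_distr_def)
    fix \<sigma> \<tau> :: "'n set" assume c: "card \<sigma> = k'" "card \<tau> = l'"
    obtain ts where "has_terms k l D \<sigma> \<tau> ts"
      using D c unfolding weighted_op_def by blast
    then have ts: "terms_of_weight k l (weight \<sigma> \<tau>) ts"
      and eq: "\<And>U \<phi>. alt_distr k l U \<Longrightarrow> \<phi> \<in> test_funs \<Longrightarrow> coeff_form (D U \<phi>) \<sigma> \<tau> = term_sum ts U \<phi>"
      by (simp_all add: has_terms_def)
    \<comment> \<open>Positions serve as indices, since the same term may occur more than once in
      the list.\<close>
    define T where "T = {..<length ts}"
    define cc where "cc t = fst (ts ! t)" for t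
    define \<sigma>' where "\<sigma>' t = fst (snd (ts ! t))" for t
    define \<tau>' where "\<tau>' t = fst (snd (snd (ts ! t)))" for t
    define ms where "ms t = snd (snd (snd (ts ! t)))" for t
    have term_sum: "term_sum ts U \<psi> = (\<Sum>t\<in>T. cc t * coeff_form (U (partials (ms t) \<psi>)) (\<sigma>' t) (\<tau>' t))" for U \<psi>
      unfolding term_sum_def sum_list_sum_nth
      by (simp add: T_def cc_def \<sigma>'_def \<tau>'_def ms_def case_prod_beta atLeast0LessThan)
    have deg: "card (\<sigma>' t) = k" "card (\<tau>' t) = l"
      and wt: "chi m (\<sigma>' t) + chi m (\<tau>' t) + count_list (ms t) m = chi m \<sigma> + chi m \<tau>" if "t \<in> T" for t m
    proof -
      have "ts ! t \<in> set ts" using that by (simp add: T_def)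
      from bspec[OF ts[unfolded terms_of_weight_def] this]
      show "card (\<sigma>' t) = k" "card (\<tau>' t) = l"
        "chi m (\<sigma>' t) + chi m (\<tau>' t) + count_list (ms t) m = chi m \<sigma> + chi m \<tau>"
        by (auto simp: \<sigma>'_def \<tau>'_def ms_def case_prod_beta weight_def)
    qed
    define uu where "uu t y = coeff_form (u y) (\<sigma>' t) (\<tau>' t)" for t y
    have "ip (interp \<sigma> \<tau> (\<lambda>y. coeff_form (g y) \<sigma> \<tau>)) \<phi> =
        (\<Sum>t\<in>T. cc t * ip (interp (\<sigma>' t) (\<tau>' t) (uu t)) (partials (ms t) \<phi>))"
    proof (rule interp_commutes_weighted[OF _ _ _ wt _ \<phi>])
      show "finite T" by (simp add: T_def)
      show "uu t \<in> L2" for t unfolding uu_def coeff_form_def by (rule u(2))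
      show "(\<lambda>y. coeff_form (g y) \<sigma> \<tau>) \<in> L2" unfolding coeff_form_def by (rule g)
      fix \<psi> :: "(real, 'n) vec \<Rightarrow> real" assume \<psi>: "\<psi> \<in> test_funs"
      have "ip (\<lambda>y. coeff_form (g y) \<sigma> \<tau>) \<psi> = coeff_form (D (dist_of u) \<psi>) \<sigma> \<tau>"
        using Du \<psi> by (simp add: coeff_form_dist_of dist_eq_def)
      also have "\<dots> = (\<Sum>t\<in>T. cc t * ip (uu t) (partials (ms t) \<psi>))"
        unfolding eq[OF U \<psi>] term_sum coeff_form_dist_of uu_def ..
      finally show "ip (\<lambda>y. coeff_form (g y) \<sigma> \<tau>) \<psi> = (\<Sum>t\<in>T. cc t * ip (uu t) (partials (ms t) \<psi>))" .
    qed
    also have "\<dots> = coeff_form (D (dist_of (tensor_interp p k l u)) \<phi>) \<sigma> \<tau>"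
      unfolding eq[OF \<Pi>u \<phi>] term_sum
      by (intro sum.cong refl) (simp add: coeff_dist_of_tensor_interp deg uu_def[abs_def])
    finally show "coeff_form (dist_of (tensor_interp p k' l' g) \<phi>) \<sigma> \<tau> =
        coeff_form (D (dist_of (tensor_interp p k l u)) \<phi>) \<sigma> \<tau>"
      by (simp add: coeff_dist_of_tensor_interp c)
  qed
qed

end

theorem theorem2:
  fixes J :: nat
    and S :: "'n::{finite,linorder} \<Rightarrow> nat \<Rightarrow> (real \<Rightarrow> real) set"
    and p :: "'n \<Rightarrow> nat \<Rightarrow> nat \<Rightarrow> (real \<Rightarrow> real) \<Rightarrow> (real \<Rightarrow> real)"
  assumes "1 \<le> J" and "J \<le> CARD('n)"
    and "\<And>m a. a \<le> 2 \<Longrightarrow> fin_dim_L2_subspace (S m a)"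
    and "\<And>m a f. a \<le> 1 \<Longrightarrow> f \<in> S m a \<Longrightarrow> \<exists>g \<in> S m (a + 1). weak_deriv f g"
    and "\<And>m a g. a \<le> 1 \<Longrightarrow> g \<in> S m (a + 1) \<Longrightarrow> \<exists>f \<in> S m a. weak_deriv f g"
    and "\<And>m i j. i \<le> 1 \<Longrightarrow> j \<le> 1 \<Longrightarrow> bounded_L2_op (p m i j)"
    and "\<And>m i j f. i \<le> 1 \<Longrightarrow> j \<le> 1 \<Longrightarrow> f \<in> L2 \<Longrightarrow> p m i j f \<in> S m (i + j)"
    and "\<And>m j u u'. j \<le> 1 \<Longrightarrow> u \<in> L2 \<Longrightarrow> u' \<in> L2 \<Longrightarrow> weak_deriv u u' \<Longrightarrow>
           weak_deriv (p m 0 j u) (p m 1 j u')"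
    and "\<And>m f. f \<in> L2 \<Longrightarrow> L2_eq (p m 0 1 f) (p m 1 0 f)"
  shows "\<forall>k<CARD('n). \<forall>u \<in> H_BGG J k.
           dist_eq (dist_of (tensor_interp p (k + 1) (l_deg J (k + 1)) (BGG_fun J k u)))
                   (BGG J k (dist_of (tensor_interp p k (l_deg J k) u)))"
proof (intro allI impI ballI)
  fix k and u :: "(real, 'n) vec \<Rightarrow> 'n form2"
  assume u: "u \<in> H_BGG J k"
  interpret quasi_interpolation S p
    by unfold_locales (fact assms)+
  define g where "g = BGG_fun J k u"
  have ex: "\<exists>g. g \<in> L2_forms (BGG_E J (k + 1)) \<and> dist_eq (BGG J k (dist_of u)) (dist_of g)"
    using u by (auto simp: H_BGG_def)
  \<comment> \<open>Membership of \<open>u\<close> in \<open>H_BGG\<close> guarantees that the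
    choice behind \<open>BGG_fun\<close> has a candidate; the commutation then holds for whichever
    representative is chosen.\<close>
  have g: "g \<in> L2_forms (BGG_E J (k + 1))" "dist_eq (BGG J k (dist_of u)) (dist_of g)"
    using someI_ex[OF ex] by (auto simp: g_def BGG_fun_def)
  have uL2: "(\<lambda>x. u x vs ws) \<in> L2" for vs ws using u by (simp add: H_BGG_def L2_forms_def)
  have gL2: "(\<lambda>x. g x vs ws) \<in> L2" for vs ws using g(1) by (simp add: L2_forms_def)
  have uA: "u x \<in> Alt k (l_deg J k)" if "x \<in> cbox 0 One" for x
    using u that BGG_E_subset_Alt by (auto simp: H_BGG_def L2_forms_def)
  show "dist_eq (dist_of (tensor_interp p (k + 1) (l_deg J (k + 1)) (BGG_fun J k u)))
      (BGG J k (dist_of (tensor_interp p k (l_deg J k) u)))"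
    using tensor_interp_commutes_weighted_op[OF weighted_op_BGG[OF assms(1)] uA uL2 gL2 g(2)]
    by (simp add: g_def)
qed

end
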